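(* Fix an integer $d\ge 2$, $\kappa_*>0$ and $\Lambda\ge 1$. There exist $\eta_0=\eta_0(d,\kappa_* )>0$ and constants $C,B\ge 1$ depending only on $d,\kappa_*,\Lambda$ such that for every $N\ge 2$, every $0<\kappa\le\kappa_*$, every $0<\eta<\eta_0$, every bounded probability density $\rho$ on $\mathbb R^d$ with $\|\rho\|_{L^\infty}\le\Lambda$, every configuration $X_N=(x_1,\dots,x_N)\in(\mathbb R^d)^N$ of pairwise distinct points, and every globally Lipschitz vector field $u:\mathbb R^d\to\mathbb R^d$, one has $$\mathcal F_N^{\kappa,\sharp}(X_N,\rho)+B\,\varepsilon_N^\kappa(\eta)\ \ge\ \varepsilon_N^\kappa(\eta)\ \ge 0$$ and $$|\mathcal H_N^{g_{\kappa,d}}(X_N,\rho;u)|\le C\,\|\nabla u\|_{L^\infty}\Bigl(\mathcal F_N^{\kappa,\sharp}(X_N,\rho)+B\,\varepsilon_N^\kappa(\eta)\Bigr).$$ The same constants $C,B$ and the same scale $\eta_0$ work simultaneously for all such $N,\kappa,\eta,\rho,X_N,u$; in particular they do not depend on the particle separations, contain no negative power of $\kappa$, and do not depend on moments, support, or further regularity of $\rho$.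
   Context: Yukawa kernel: for $\kappa>0$, $g_{\kappa,d}(x)=(2\pi)^{-d/2}\left(\frac{\kappa}{|x|}\right)^{\nu_d}K_{\nu_d}(\kappa|x|)$, $\nu_d=\frac d2-1$, where $K_\nu$ is the modified Bessel function of the second kind; $(-\Delta+\kappa^2)g_{\kappa,d}=\delta_0$. For a collision-free configuration $X_N$ put $\mu_{X_N}=\frac1N\sum_{i=1}^N\delta_{x_i}$ and $$\mathcal F_N^{g_{\kappa,d}}(X_N,\rho)=\iint_{x\ne y}g_{\kappa,d}(x-y)\,d(\mu_{X_N}-\rho)(x)\,d(\mu_{X_N}-\rho)(y),$$ $$\mathcal H_N^{g_{\kappa,d}}(X_N,\rho;u)=\iint_{x\ne y}(u(x)-u(y))\cdot\nabla g_{\kappa,d}(x-y)\,d(\mu_{X_N}-\rho)(x)\,d(\mu_{X_N}-\rho)(y).$$ (Expanded: particle–particle sums over ordered pairs $i\neq j$ with factor $1/N^2$, cross term with factor $-2/N$, and the background double integral.) Normalization: $c_{\kappa,d}=0$ for $d\ge3$ and $c_{\kappa,2}=\frac{\log\kappa}{2\pi}$; $\mathcal F_N^{\kappa,\sharp}(X_N,\rho)=\mathcal F_N^{g_{\kappa,d}}(X_N,\rho)-\frac{c_{\kappa,d}}{N}$. Error: $\ell_2(r)=1+\log_+(1/r)$, $\ell_d(r)=r^{2-d}$ for $d\ge3$, and $\varepsilon_N^\kappa(\eta)=\frac{\ell_d(\eta)}N+\eta^2+\kappa^2\eta^2$. For a globally Lipschitz field, $\|\nabla u\|_{L^\infty}$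 denotes its Lipschitz seminorm. *)

theory Defs
  imports "HOL-Probability.Essential_Supremum"
begin

text \<open>
  The modified Bessel function of the second kind, for real order and positive argument, by
  its integral formula \<open>K\<^sub>\<nu>(r) = \<integral>\<^sub>0\<^sup>\<infinity> exp(-r cosh t) cosh(\<nu> t) dt\<close>,
  which converges absolutely for every \<open>r > 0\<close>.
\<close>

definition bessel_K :: "real \<Rightarrow> real \<Rightarrow> real" where
  "bessel_K \<nu> r = (LBINT t:{0..}. exp (- r * cosh t) * cosh (\<nu> * t))"

text \<open>The value at the origin is junk; it only enters integrals, on null sets.\<close>

definition yukawa :: "real \<Rightarrow> 'a::euclidean_space \<Rightarrow> real" where
  "yukawa \<kappa> x = (let d = real DIM('a); \<nu> = d / 2 - 1 in
     (2 * pi) powr (- d / 2) * (\<kappa> / norm x) powr \<nu> * bessel_K \<nu> (\<kappa> * norm x))"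

definition gradient :: "('a::euclidean_space \<Rightarrow> real) \<Rightarrow> 'a \<Rightarrow> 'a" where
  "gradient f x = (\<Sum>b\<in>Basis. frechet_derivative f (at x) b *\<^sub>R b)"

text \<open>
  The double integral of a symmetric kernel \<open>k\<close> against the square of the signed measure
  \<open>\<mu> - \<rho>\<close> off the diagonal, where \<open>\<mu>\<close> is the empirical measure of the points
  \<open>X 0, \<dots>, X (N - 1)\<close>, expanded by bilinearity.  As \<open>\<rho>\<close> is a density,
  the diagonal matters only in the particle-particle term.
\<close>

definition offdiag_square ::
    "('a::euclidean_space \<Rightarrow> 'a \<Rightarrow> real) \<Rightarrow> nat \<Rightarrow> (nat \<Rightarrow> 'a) \<Rightarrow> ('a \<Rightarrow> real) \<Rightarrow> real" where
  "offdiag_square k N X \<rho> =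
     1 / (real N)\<^sup>2 * (\<Sum>i<N. \<Sum>j\<in>{..<N} - {i}. k (X i) (X j))
     - 2 / real N * (\<Sum>i<N. LINT y|lborel. k (X i) y * \<rho> y)
     + integral\<^sup>L (lborel \<Otimes>\<^sub>M lborel) (\<lambda>(x, y). k x y * \<rho> x * \<rho> y)"

definition modulated_energy ::
    "real \<Rightarrow> nat \<Rightarrow> (nat \<Rightarrow> 'a::euclidean_space) \<Rightarrow> ('a \<Rightarrow> real) \<Rightarrow> real" where
  "modulated_energy \<kappa> N X \<rho> = offdiag_square (\<lambda>x y. yukawa \<kappa> (x - y)) N X \<rho>"

definition commutator ::
    "real \<Rightarrow> nat \<Rightarrow> (nat \<Rightarrow> 'a::euclidean_space) \<Rightarrow> ('a \<Rightarrow> real) \<Rightarrow> ('a \<Rightarrow> 'a) \<Rightarrow> real" where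
  "commutator \<kappa> N X \<rho> u =
     offdiag_square (\<lambda>x y. (u x - u y) \<bullet> gradient (yukawa \<kappa>) (x - y)) N X \<rho>"

definition c_norm :: "real \<Rightarrow> nat \<Rightarrow> real" where
  "c_norm \<kappa> d = (if d = 2 then ln \<kappa> / (2 * pi) else 0)"

definition normalized_energy ::
    "real \<Rightarrow> nat \<Rightarrow> (nat \<Rightarrow> 'a::euclidean_space) \<Rightarrow> ('a \<Rightarrow> real) \<Rightarrow> real" where
  "normalized_energy \<kappa> N X \<rho> = modulated_energy \<kappa> N X \<rho> - c_norm \<kappa> DIM('a) / real N"

definition ell :: "nat \<Rightarrow> real \<Rightarrow> real" where
  "ell d r = (if d = 2 then 1 + max 0 (ln (1 / r)) else r powr (2 - real d))"

definition err :: "nat \<Rightarrow> nat \<Rightarrow> real \<Rightarrow> real \<Rightarrow> real" where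
  "err d N \<kappa> \<eta> = ell d \<eta> / real N + \<eta>\<^sup>2 + \<kappa>\<^sup>2 * \<eta>\<^sup>2"

definition prob_density :: "('a::euclidean_space \<Rightarrow> real) \<Rightarrow> bool" where
  "prob_density \<rho> \<longleftrightarrow> \<rho> \<in> borel_measurable borel \<and> (AE x in lborel. 0 \<le> \<rho> x) \<and>
     integrable lborel \<rho> \<and> (LINT x|lborel. \<rho> x) = 1"

definition Linf_norm :: "('a::euclidean_space \<Rightarrow> real) \<Rightarrow> ereal" where
  "Linf_norm f = esssup lborel (\<lambda>x. ereal \<bar>f x\<bar>)"

text \<open>Only meaningful for globally Lipschitz \<open>u\<close>; otherwise the supremum is unbounded.\<close>

definition lip_seminorm :: "('a::euclidean_space \<Rightarrow> 'a) \<Rightarrow> real" where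
  "lip_seminorm u = (SUP (x, y)\<in>{(x, y). x \<noteq> y}. dist (u x) (u y) / dist x y)"

end

theory Submission
  imports Defs "HOL-Probability.Probability"
begin

text \<open>
  With the heat kernel \<open>p\<^sub>t\<close>, the Yukawa kernel is the mixture
  \<open>g = \<integral>\<^sub>0\<^sup>\<infinity> e\<^bsup>-\<kappa>\<^sup>2t\<^esup> p\<^sub>t dt\<close>.  Split it at \<open>t = \<eta>\<^sup>2\<close> into a
  nonnegative near part of mass at most \<open>\<eta>\<^sup>2\<close> and a smooth, positive definite far part.
  As the background is bounded, the modulated energy dominates, up to the error term, both the
  far energy of \<open>\<nu> = \<mu> - \<rho>\<close> and the near pair interaction of the particles.

  The near part of the commutator is bounded pairwise, since
  \<open>|x| |\<nabla>p\<^sub>t(x)| \<le> C p\<^bsub>2t\<^esub>(x)\<close>.  The far kernel is, up to a factor, the convolution of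
  \<open>p\<^sub>s\<close>, \<open>s = \<eta>\<^sup>2/2\<close>, with the mixture of the \<open>p\<^sub>t\<close> over \<open>t > s\<close>.  Let \<open>h\<close> be the
  convolution of that mixture with \<open>\<nu>\<close>; then \<open>\<kappa>\<^sup>2h - \<Delta>h\<close> is a multiple of \<open>p\<^sub>s * \<nu>\<close>, and
  the far energy is \<open>\<integral> |\<nabla>h|\<^sup>2 + \<kappa>\<^sup>2h\<^sup>2\<close>.  The far commutator is
  \<open>2 \<integral> u \<cdot> \<nabla>h (\<kappa>\<^sup>2h - \<Delta>h)\<close>, which is integrated by parts through the stress tensor of \<open>h\<close>,
  plus a remainder from commuting \<open>u\<close> with the convolution by \<open>p\<^sub>s\<close>.  The remainder is at most
  \<open>C L \<surd>s \<integral> |\<nabla>h| (p\<^bsub>2s\<^esub> * |\<nu>|)\<close>, and \<open>s \<integral> (p\<^bsub>2s\<^esub> * |\<nu>|)\<^sup>2\<close> is controlled by the near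
  pair interaction up to time \<open>4\<eta>\<^sup>2\<close>.
\<close>

section \<open>The Gaussian heat kernel\<close>

text \<open>Uniformity in \<kappa> is the obstacle: the total mass of the weight exp (-\<kappa>^2 t)
  and, in the plane, the far kernel at the origin both blow up as \<kappa> tends to 0. Near and far
  parts are therefore compared through heat kernels at times of order \<eta>^2, where exp
  (\<kappa>^2 \<eta>^2) is bounded because \<kappa> \<eta> \<le> 1; the one logarithm of \<kappa>
  that survives is cancelled exactly by \<open>c_norm\<close>. The stress tensor is used because it
  costs a single derivative of u, which is all a Lipschitz field offers. The choice s = \<eta>^2/2
  comes from the semigroup law: truncation at 2s factors into a convolution with p_s, which smooths
  the charge, and a truncation at s, which defines the potential. The time 4\<eta>^2 arises in three
  doublings: p_s becomes p_2s when the increment of u is absorbed, p_4s when this is squared, and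
  p_4s is compared with the mixture over [4s, 8s]. Hence the energy is bounded from below twice, at
  \<eta>^2 for the far energy and at 4\<eta>^2 for the near pairs.\<close>

lemma integrable_lborel_shift:
  fixes f :: "'a::euclidean_space \<Rightarrow> real"
  assumes "integrable lborel f"
  shows "integrable lborel (\<lambda>x. f (c + x))"
proof -
  have [measurable]: "f \<in> borel_measurable borel"
    using assms by auto
  have "integrable (distr lborel borel ((+) c)) f"
    using assms by (simp add: lborel_distr_plus)
  then show ?thesis
    by (subst (asm) integrable_distr_eq) auto
qed

lemma integral_lborel_shift:
  fixes f :: "'a::euclidean_space \<Rightarrow> real"
  assumes [measurable]: "f \<in> borel_measurable borel"
  shows "(LBINT x. f (c + x)) = (LBINT x. f x)"
proof -
  have "(LBINT x. f x) = (\<integral>x. f x \<partial>distr lborel borel ((+) c))"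
    by (simp add: lborel_distr_plus)
  also have "\<dots> = (LBINT x. f (c + x))"
    by (subst integral_distr) auto
  finally show ?thesis by simp
qed

lemma integrable_lborel_diff:
  fixes f :: "'a::euclidean_space \<Rightarrow> real"
  assumes "integrable lborel f"
  shows "integrable lborel (\<lambda>x. f (x - c))"
  using integrable_lborel_shift[OF assms, of "- c"] by simp

lemma integral_lborel_diff:
  fixes f :: "'a::euclidean_space \<Rightarrow> real"
  assumes "f \<in> borel_measurable borel"
  shows "(LBINT x. f (x - c)) = (LBINT x. f x)"
  using integral_lborel_shift[OF assms, of "- c"] by simp

lemma lborel_distr_uminus_euclidean:
  "distr lborel borel uminus = (lborel :: 'a::euclidean_space measure)"
  using lborel_affine[of "-1" "0::'a"] by (simp add: density_1 id_def)

lemma integral_lborel_uminus: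
  fixes f :: "'a::euclidean_space \<Rightarrow> real"
  assumes [measurable]: "f \<in> borel_measurable borel"
  shows "(LBINT x. f (- x)) = (LBINT x. f x)"
proof -
  have "(LBINT x. f x) = (\<integral>x. f x \<partial>distr lborel borel uminus)"
    by (simp add: lborel_distr_uminus_euclidean)
  also have "\<dots> = (LBINT x. f (- x))"
    by (subst integral_distr) auto
  finally show ?thesis by simp
qed

definition heat :: "real \<Rightarrow> 'a::euclidean_space \<Rightarrow> real" where
  "heat t x = (4 * pi * t) powr (- (real DIM('a) / 2)) * exp (- ((norm x)\<^sup>2 / (4 * t)))"

lemma heat_nonneg [simp]: "0 \<le> heat t x"
  by (simp add: heat_def)

lemma heat_minus [simp]: "heat t (- x) = heat t x"
  by (simp add: heat_def)

lemma heat_commute: "heat t (x - y) = heat t (y - x)"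
  by (metis heat_minus minus_diff_eq)

lemma measurable_heat [measurable (raw)]:
  fixes f :: "'b \<Rightarrow> 'a::euclidean_space"
  assumes [measurable]: "g \<in> borel_measurable M" "f \<in> borel_measurable M"
  shows "(\<lambda>x. heat (g x) (f x)) \<in> borel_measurable M"
  unfolding heat_def by measurable

lemma heat_le_zero: "0 < t \<Longrightarrow> heat t (x::'a::euclidean_space) \<le> heat t (0::'a)"
  unfolding heat_def by (intro mult_left_mono) auto

lemma heat_zero: "heat t (0::'a::euclidean_space) = (4 * pi * t) powr (- (real DIM('a) / 2))"
  by (simp add: heat_def)

text \<open>The coordinates are independent Gaussians of variance 2t, so the unit mass of the kernel
  reduces to that of \<open>normal_density\<close>.\<close>

lemma heat_eq_prod:
  fixes x :: "'a::euclidean_space"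
  assumes t: "0 < t"
  shows "heat t x = (\<Prod>b\<in>Basis. normal_density 0 (sqrt (2 * t)) (x \<bullet> b))"
proof -
  have nd: "normal_density 0 (sqrt (2 * t)) y = (1 / sqrt (4 * pi * t)) * exp (- (y\<^sup>2 / (4 * t)))" for y
    using t by (simp add: normal_density_def)
  have "(\<Prod>b\<in>Basis. normal_density 0 (sqrt (2 * t)) (x \<bullet> b)) =
     (1 / sqrt (4 * pi * t)) ^ DIM('a) * exp (\<Sum>b\<in>Basis. - ((x \<bullet> b)\<^sup>2 / (4 * t)))"
    unfolding nd by (simp only: prod.distrib prod_constant exp_sum[OF finite_Basis])
  also have "(\<Sum>b\<in>Basis. - ((x \<bullet> b)\<^sup>2 / (4 * t))) = - ((norm x)\<^sup>2 / (4 * t))"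
    unfolding sum_negf sum_divide_distrib[symmetric] power2_norm_eq_inner
    by (subst euclidean_inner[of x x]) (simp only: power2_eq_square)
  also have "(1 / sqrt (4 * pi * t)) ^ DIM('a) = (4 * pi * t) powr (- (real DIM('a) / 2))"
  proof -
    have "1 / sqrt (4 * pi * t) = (4 * pi * t) powr (- (1 / 2))"
      using t by (subst powr_minus, subst powr_half_sqrt) (auto simp: divide_inverse)
    also have "\<dots> ^ DIM('a) = (4 * pi * t) powr (- (real DIM('a) / 2))"
      using t by (subst powr_realpow[symmetric]) (simp, simp only: powr_powr, simp)
    finally show ?thesis .
  qed
  finally show ?thesis by (simp add: heat_def)
qed

lemma nn_integral_heat:
  assumes t: "0 < t"
  shows "(\<integral>\<^sup>+x. ennreal (heat t (x::'a::euclidean_space)) \<partial>lborel) = 1"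
proof -
  have sg: "0 < sqrt (2 * t)" using t by simp
  have *: "(\<integral>\<^sup>+x. ennreal (normal_density 0 (sqrt (2 * t)) x) \<partial>lborel) = 1"
  proof -
    interpret prob_space "density lborel (normal_density 0 (sqrt (2 * t)))"
      using sg by (rule prob_space_normal_density)
    show ?thesis using emeasure_space_1 by (simp add: emeasure_density)
  qed
  have "(\<integral>\<^sup>+x. ennreal (heat t (x::'a)) \<partial>lborel) =
    (\<integral>\<^sup>+x. (\<Prod>b\<in>Basis. ennreal (normal_density 0 (sqrt (2 * t)) ((x::'a) \<bullet> b))) \<partial>lborel)"
    by (simp add: heat_eq_prod[OF t] prod_ennreal)
  also have "\<dots> = 1"
    by (subst nn_integral_lborel_prod) (auto simp: *)
  finally show ?thesis .
qed

lemma integrable_heat: "0 < t \<Longrightarrow> integrable lborel (heat t :: 'a::euclidean_space \<Rightarrow> real)"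
  by (subst integrable_iff_bounded) (simp add: nn_integral_heat)

lemma integral_heat: "0 < t \<Longrightarrow> (LBINT x. heat t (x::'a::euclidean_space)) = 1"
  by (subst integral_eq_nn_integral) (auto simp: nn_integral_heat)

text \<open>Completing the square in x. The x-dependence is concentrated in one Gaussian of unit
  mass around a weighted mean of the centres, so the semigroup law and its first-moment version both
  follow by integrating that Gaussian.\<close>

lemma heat_mult:
  fixes a b x :: "'a::euclidean_space"
  assumes s: "0 < s" and t: "0 < t"
  shows "heat s (x - a) * heat t (x - b) =
    heat (s + t) (a - b) * heat (s * t / (s + t)) (x - (t / (s + t)) *\<^sub>R a - (s / (s + t)) *\<^sub>R b)"
proof -
  let ?d = "- (real DIM('a) / 2)"
  have pos: "s + t > 0" "s \<noteq> 0" "t \<noteq> 0" "s + t \<noteq> 0" using s t by auto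
  have c: "(4 * pi * s) powr ?d * (4 * pi * t) powr ?d =
    (4 * pi * (s + t)) powr ?d * (4 * pi * (s * t / (s + t))) powr ?d"
  proof -
    have "(4 * pi * s) * (4 * pi * t) = (4 * pi * (s + t)) * (4 * pi * (s * t / (s + t)))"
      using pos by (simp add: field_simps)
    then show ?thesis
      using s t by (subst (1 2) powr_mult[symmetric]) (auto simp: mult_ac)
  qed
  have n: "(norm (x - a))\<^sup>2 / (4 * s) + (norm (x - b))\<^sup>2 / (4 * t) =
    (norm (a - b))\<^sup>2 / (4 * (s + t)) +
    (norm (x - (t / (s + t)) *\<^sub>R a - (s / (s + t)) *\<^sub>R b))\<^sup>2 / (4 * (s * t / (s + t)))"
  proof -
    \<comment> \<open>With weights p + q = 1 the claim becomes the barycentric identity p|y|^2 +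
      q|z|^2 = pq|z - y|^2 + |py + qz|^2.\<close>
    define p q where "p = t / (s + t)" and "q = s / (s + t)"
    define S where "S = s + t"
    have st: "s = q * S" "t = p * S" "p + q = 1" and S: "S > 0" and pq: "p > 0" "q > 0"
      using pos s t by (auto simp: p_def q_def S_def add.commute[of s t] simp flip: add_divide_distrib)
    have r: "s * t / (s + t) = p * q * S"
      unfolding S_def[symmetric] using S by (subst st(1), subst st(2)) simp
    have x: "x = p *\<^sub>R x + q *\<^sub>R x" using st(3) by (metis scaleR_left_distrib scaleR_one)
    define y z where "y = x - a" and "z = x - b"
    have w: "x - p *\<^sub>R a - q *\<^sub>R b = p *\<^sub>R y + q *\<^sub>R z"
      unfolding y_def z_def by (subst x) (simp add: algebra_simps)
    have ab: "a - b = z - y" by (simp add: y_def z_def)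
    have e1: "(norm (p *\<^sub>R y + q *\<^sub>R z))\<^sup>2 = p\<^sup>2 * (y \<bullet> y) + 2 * p * q * (y \<bullet> z) + q\<^sup>2 * (z \<bullet> z)"
      unfolding power2_norm_eq_inner by (simp add: inner_simps inner_commute power2_eq_square algebra_simps)
    have e2: "(norm (z - y))\<^sup>2 = y \<bullet> y - 2 * (y \<bullet> z) + z \<bullet> z"
      unfolding power2_norm_eq_inner by (simp add: inner_simps inner_commute algebra_simps)
    have "p * (y \<bullet> y) + q * (z \<bullet> z) = p * q * (y \<bullet> y - 2 * (y \<bullet> z) + z \<bullet> z)
        + (p\<^sup>2 * (y \<bullet> y) + 2 * p * q * (y \<bullet> z) + q\<^sup>2 * (z \<bullet> z))"
    proof -
      have "p * q * (y \<bullet> y - 2 * (y \<bullet> z) + z \<bullet> z)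
        + (p\<^sup>2 * (y \<bullet> y) + 2 * p * q * (y \<bullet> z) + q\<^sup>2 * (z \<bullet> z)) = (p + q) * (p * (y \<bullet> y) + q * (z \<bullet> z))"
        by (simp add: algebra_simps power2_eq_square)
      then show ?thesis using st(3) by simp
    qed
    then have "(p * (y \<bullet> y) + q * (z \<bullet> z)) / (4 * (p * q * S)) = (p * q * (y \<bullet> y - 2 * (y \<bullet> z) + z \<bullet> z)
        + (p\<^sup>2 * (y \<bullet> y) + 2 * p * q * (y \<bullet> z) + q\<^sup>2 * (z \<bullet> z))) / (4 * (p * q * S))"
      by simp
    moreover have "(p * (y \<bullet> y) + q * (z \<bullet> z)) / (4 * (p * q * S)) = (norm y)\<^sup>2 / (4 * s) + (norm z)\<^sup>2 / (4 * t)"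
      unfolding st(1,2) using S pq by (simp add: field_simps power2_norm_eq_inner)
    moreover have "(p * q * (y \<bullet> y - 2 * (y \<bullet> z) + z \<bullet> z)
        + (p\<^sup>2 * (y \<bullet> y) + 2 * p * q * (y \<bullet> z) + q\<^sup>2 * (z \<bullet> z))) / (4 * (p * q * S)) =
        (norm (a - b))\<^sup>2 / (4 * S) + (norm (x - p *\<^sub>R a - q *\<^sub>R b))\<^sup>2 / (4 * (s * t / (s + t)))"
      unfolding r w ab e1 e2 using S pq by (simp add: add_divide_distrib)
    ultimately show ?thesis
      unfolding p_def[symmetric] q_def[symmetric] unfolding S_def[symmetric] y_def z_def by (simp only:)
  qed
  have e: "exp (- (v + w)) = exp (- v) * exp (- w)" for v w :: real
    by (simp flip: exp_add)
  have "heat s (x - a) * heat t (x - b) = ((4 * pi * s) powr ?d * (4 * pi * t) powr ?d) *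
     exp (- ((norm (x - a))\<^sup>2 / (4 * s) + (norm (x - b))\<^sup>2 / (4 * t)))"
    unfolding heat_def e by (simp only: mult_ac)
  also have "\<dots> = heat (s + t) (a - b) * heat (s * t / (s + t)) (x - (t / (s + t)) *\<^sub>R a - (s / (s + t)) *\<^sub>R b)"
    unfolding c n heat_def e by (simp only: mult_ac)
  finally show ?thesis .
qed

lemma heat_convolution:
  fixes a b :: "'a::euclidean_space"
  assumes s: "0 < s" and t: "0 < t"
  shows "(LBINT x. heat s (x - a) * heat t (x - b)) = heat (s + t) (a - b)"
proof -
  have r: "0 < s * t / (s + t)" using s t by simp
  have *: "x - (t / (s + t)) *\<^sub>R a - (s / (s + t)) *\<^sub>R b = x - ((t / (s + t)) *\<^sub>R a + (s / (s + t)) *\<^sub>R b)" for x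
    by (simp add: algebra_simps)
  show ?thesis
    unfolding heat_mult[OF s t] * using integral_lborel_diff[of "heat (s * t / (s + t)) :: 'a \<Rightarrow> real"] integral_heat[OF r, where ?'a='a]
    by simp
qed

text \<open>With z = |x|^2/(4t), half of the exponent in exp (-z) absorbs sqrt z or z, and the other
  half is the exponent of the kernel at time 2t. The factor 2^(d/2) is the ratio of the two
  normalizations.\<close>

lemma inner_le_norm_heat:
  fixes x :: "'a::euclidean_space"
  assumes t: "0 < t"
  shows "norm x * heat t x \<le> 2 * sqrt t * 2 powr (real DIM('a) / 2) * heat (2 * t) x"
    and "(norm x)\<^sup>2 / (2 * t) * heat t x \<le> 2 * 2 powr (real DIM('a) / 2) * heat (2 * t) x"
proof -
  define z where "z = (norm x)\<^sup>2 / (4 * t)"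
  have z: "z \<ge> 0" using t by (simp add: z_def)
  have h2: "2 powr (real DIM('a) / 2) * heat (2 * t) x = (4 * pi * t) powr (- (real DIM('a) / 2)) * exp (- (z / 2))"
  proof -
    have "(4 * pi * (2 * t)) powr (- (real DIM('a) / 2)) = (4 * pi * t) powr (- (real DIM('a) / 2)) * 2 powr (- (real DIM('a) / 2))"
      using t by (subst powr_mult[symmetric]) (auto simp: mult_ac)
    then show ?thesis by (simp add: heat_def z_def powr_minus)
  qed
  have h1: "heat t x = (4 * pi * t) powr (- (real DIM('a) / 2)) * exp (- z)"
    by (simp add: heat_def z_def)
  have e: "exp (- (z / 2)) = exp (- z) * exp (z / 2)"
    by (simp flip: exp_add)
  have ez: "1 + z / 2 \<le> exp (z / 2)" by (rule exp_ge_add_one_self)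
  \<comment> \<open>Squaring exp (z/4) \<ge> 1 + z/4 suffices, since (1 + z/4)^2 exceeds z by the
    square (1 - z/4)^2.\<close>
  have ez2: "z \<le> exp (z / 2)"
  proof -
    have "exp (z / 2) = exp (z / 4) ^ 2" by (simp add: power2_eq_square flip: exp_add)
    moreover have "(1 + z / 4) ^ 2 \<le> exp (z / 4) ^ 2" by (intro power_mono) (use z in auto)
    moreover have "(1 + z / 4) ^ 2 - z = (1 - z / 4) ^ 2" by (simp add: power2_eq_square algebra_simps)
    moreover have "(1 - z / 4) ^ 2 \<ge> 0" by simp
    ultimately show ?thesis by linarith
  qed
  have ez1: "sqrt z \<le> exp (z / 2)"
  proof -
    have "sqrt z \<le> 1 + z / 2" using arith_geo_mean_sqrt[of 1 z] z by simp
    with ez show ?thesis by linarith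
  qed
  have nx: "norm x = 2 * sqrt t * sqrt z"
    using t by (simp add: z_def real_sqrt_divide real_sqrt_mult)
  have "norm x * heat t x = 2 * sqrt t * ((4 * pi * t) powr (- (real DIM('a) / 2)) * (exp (- z) * sqrt z))"
    unfolding nx h1 by simp
  also have "\<dots> \<le> 2 * sqrt t * ((4 * pi * t) powr (- (real DIM('a) / 2)) * (exp (- z) * exp (z / 2)))"
    using t ez1 by (intro mult_left_mono) auto
  also have "\<dots> = 2 * sqrt t * 2 powr (real DIM('a) / 2) * heat (2 * t) x"
    using h2 e by simp
  finally show "norm x * heat t x \<le> 2 * sqrt t * 2 powr (real DIM('a) / 2) * heat (2 * t) x" .
  have "(norm x)\<^sup>2 / (2 * t) * heat t x = 2 * ((4 * pi * t) powr (- (real DIM('a) / 2)) * (exp (- z) * z))"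
    using t unfolding h1 by (simp add: z_def)
  also have "\<dots> \<le> 2 * ((4 * pi * t) powr (- (real DIM('a) / 2)) * (exp (- z) * exp (z / 2)))"
    using ez2 by (intro mult_left_mono) auto
  also have "\<dots> = 2 * 2 powr (real DIM('a) / 2) * heat (2 * t) x"
    using h2 e by simp
  finally show "(norm x)\<^sup>2 / (2 * t) * heat t x \<le> 2 * 2 powr (real DIM('a) / 2) * heat (2 * t) x" .
qed

lemma integrable_inner_heat:
  assumes t: "0 < t"
  shows "integrable lborel (\<lambda>x::'a::euclidean_space. (x \<bullet> e) * heat t x)"
proof (rule Bochner_Integration.integrable_bound)
  show "integrable lborel (\<lambda>x::'a. norm e * (2 * sqrt t * 2 powr (real DIM('a) / 2) * heat (2 * t) x))"
    using t by (intro integrable_mult_right integrable_heat) auto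
  show "AE x::'a in lborel. norm ((x \<bullet> e) * heat t x) \<le> norm (norm e * (2 * sqrt t * 2 powr (real DIM('a) / 2) * heat (2 * t) x))"
  proof (rule AE_I2)
    fix x :: 'a
    have "norm ((x \<bullet> e) * heat t x) \<le> (norm x * norm e) * heat t x"
      using Cauchy_Schwarz_ineq2[of x e] by (simp add: abs_mult mult_right_mono)
    also have "\<dots> = norm e * (norm x * heat t x)" by simp
    also have "\<dots> \<le> norm e * (2 * sqrt t * 2 powr (real DIM('a) / 2) * heat (2 * t) x)"
      using inner_le_norm_heat(1)[OF t] by (intro mult_left_mono) auto
    finally show "norm ((x \<bullet> e) * heat t x) \<le> norm (norm e * (2 * sqrt t * 2 powr (real DIM('a) / 2) * heat (2 * t) x))"
      using t by (simp add: abs_mult)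
  qed
qed measurable

lemma integral_inner_heat:
  "(LBINT x. ((x::'a::euclidean_space) \<bullet> e) * heat t x) = 0"
  using integral_lborel_uminus[of "\<lambda>x::'a. (x \<bullet> e) * heat t x"] by simp

text \<open>The second factor is -2 times the derivative of \<open>heat t\<close> along e, so this
  is the differentiated semigroup law. It follows from \<open>heat_mult\<close> by splitting x - b
  at the mean m: the centred part is odd and integrates to 0, and m - b is the fraction t/(s + t) of
  a - b.\<close>

lemma heat_convolution_inner:
  fixes a b :: "'a::euclidean_space"
  assumes s: "0 < s" and t: "0 < t"
  shows "(LBINT x. heat s (x - a) * (((x - b) \<bullet> e) / t * heat t (x - b))) =
    ((a - b) \<bullet> e) / (s + t) * heat (s + t) (a - b)"
proof -
  define r m where "r = s * t / (s + t)" and "m = (t / (s + t)) *\<^sub>R a + (s / (s + t)) *\<^sub>R b"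
  have r: "0 < r" using s t by (simp add: r_def)
  have mb: "m - b = (t / (s + t)) *\<^sub>R (a - b)"
  proof -
    have "b = (t / (s + t)) *\<^sub>R b + (s / (s + t)) *\<^sub>R b"
      using s t by (simp add: add.commute[of s t] flip: scaleR_left_distrib add_divide_distrib)
    then have "m - b = m - ((t / (s + t)) *\<^sub>R b + (s / (s + t)) *\<^sub>R b)" by simp
    then show ?thesis by (simp add: m_def algebra_simps)
  qed
  have *: "heat s (x - a) * (((x - b) \<bullet> e) / t * heat t (x - b)) =
     (heat (s + t) (a - b) / t) * (((x - m) \<bullet> e) * heat r (x - m) + ((m - b) \<bullet> e) * heat r (x - m))" for x
  proof -
    have "heat s (x - a) * (((x - b) \<bullet> e) / t * heat t (x - b)) = ((x - b) \<bullet> e) / t * (heat s (x - a) * heat t (x - b))"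
      by simp
    also have "\<dots> = ((x - b) \<bullet> e) / t * (heat (s + t) (a - b) * heat r (x - m))"
      unfolding heat_mult[OF s t] r_def m_def by (simp add: diff_diff_eq)
    also have "\<dots> = ((x - m) \<bullet> e + (m - b) \<bullet> e) / t * (heat (s + t) (a - b) * heat r (x - m))"
      by (simp add: inner_simps)
    finally show ?thesis by (simp add: field_simps)
  qed
  have i1: "integrable lborel (\<lambda>x. ((x - m) \<bullet> e) * heat r (x - m))"
    using integrable_lborel_diff[OF integrable_inner_heat[OF r]] .
  have i2: "integrable lborel (\<lambda>x. ((m - b) \<bullet> e) * heat r (x - m))"
    using integrable_lborel_diff[OF integrable_heat[OF r, where ?'a='a], of m] by simp
  have "(LBINT x. heat s (x - a) * (((x - b) \<bullet> e) / t * heat t (x - b))) =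
    (heat (s + t) (a - b) / t) * ((LBINT x. ((x - m) \<bullet> e) * heat r (x - m)) + (LBINT x. ((m - b) \<bullet> e) * heat r (x - m)))"
    unfolding * using i1 i2 by simp
  also have "(LBINT x. ((x - m) \<bullet> e) * heat r (x - m)) = 0"
    using integral_lborel_diff[of "\<lambda>x. (x \<bullet> e) * heat r x" m] by (simp add: integral_inner_heat)
  also have "(LBINT x. ((m - b) \<bullet> e) * heat r (x - m)) = (m - b) \<bullet> e"
    using integral_lborel_diff[of "heat r :: 'a \<Rightarrow> real" m] by (simp add: integral_heat[OF r])
  finally show ?thesis using t unfolding mb by simp
qed

section \<open>Differentiation under the integral and integration by parts\<close>

text \<open>The mean value inequality bounds the difference quotients by the constant B, which is
  integrable because the measure is finite, so dominated convergence applies.\<close>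

lemma has_real_derivative_integral:
  fixes f f' :: "real \<Rightarrow> 'b \<Rightarrow> real"
  assumes M: "finite_measure M" and d: "0 < d"
    and f: "\<And>r. \<bar>r - x\<bar> < d \<Longrightarrow> integrable M (f r)"
    and f'[measurable]: "f' x \<in> borel_measurable M"
    and der: "\<And>r t. \<bar>r - x\<bar> < d \<Longrightarrow> t \<in> space M \<Longrightarrow> ((\<lambda>r. f r t) has_real_derivative f' r t) (at r)"
    and bnd: "\<And>r t. \<bar>r - x\<bar> < d \<Longrightarrow> t \<in> space M \<Longrightarrow> \<bar>f' r t\<bar> \<le> B"
  shows "((\<lambda>r. \<integral>t. f r t \<partial>M) has_real_derivative (\<integral>t. f' x t \<partial>M)) (at x)"
proof -
  interpret finite_measure M by fact
  show ?thesis
    unfolding DERIV_def tendsto_at_iff_sequentially o_def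
  proof (intro allI impI)
    fix X :: "nat \<Rightarrow> real"
    assume nz: "\<forall>i. X i \<in> UNIV - {0}" and X: "X \<longlonglongrightarrow> 0"
    \<comment> \<open>Only from index N on do the points x + X n lie in the interval covered by the
      hypotheses; the limit is taken along the shifted sequence.\<close>
    obtain N where N: "\<And>n. n \<ge> N \<Longrightarrow> \<bar>X n\<bar> < d"
      using LIMSEQ_D[OF X d] by auto
    have "(\<lambda>i. \<integral>t. (f (x + X (i + N)) t - f x t) / X (i + N) \<partial>M) \<longlonglongrightarrow> (\<integral>t. f' x t \<partial>M)"
    proof (rule integral_dominated_convergence[where w="\<lambda>_. B"])
      show "(\<lambda>t. (f (x + X (i + N)) t - f x t) / X (i + N)) \<in> borel_measurable M" for i
        using f[of "x + X (i + N)"] f[of x] N[of "i + N"] d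
        by (intro borel_measurable_divide borel_measurable_diff borel_measurable_integrable) auto
      show "AE t in M. (\<lambda>i. (f (x + X (i + N)) t - f x t) / X (i + N)) \<longlonglongrightarrow> f' x t"
      proof (rule AE_I2)
        fix t assume "t \<in> space M"
        then have "((\<lambda>r. f r t) has_real_derivative f' x t) (at x)"
          using d by (intro der) auto
        then have "(\<lambda>i. (f (x + X i) t - f x t) / X i) \<longlonglongrightarrow> f' x t"
          using nz X unfolding DERIV_def tendsto_at_iff_sequentially o_def by auto
        then show "(\<lambda>i. (f (x + X (i + N)) t - f x t) / X (i + N)) \<longlonglongrightarrow> f' x t"
          by (rule LIMSEQ_ignore_initial_segment)
      qed
      show "AE t in M. norm ((f (x + X (i + N)) t - f x t) / X (i + N)) \<le> B" for i
      proof (rule AE_I2)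
        fix t assume t: "t \<in> space M"
        have "norm (f (x + X (i + N)) t - f x t) \<le> B * norm ((x + X (i + N)) - x)"
        proof (rule field_differentiable_bound[where S="ball x d" and f'="\<lambda>r. f' r t"])
          show "((\<lambda>r. f r t) has_real_derivative f' z t) (at z within ball x d)" if "z \<in> ball x d" for z
            using that t by (intro DERIV_subset[OF der]) (auto simp: dist_real_def abs_minus_commute)
          show "norm (f' z t) \<le> B" if "z \<in> ball x d" for z
            using that t bnd[of z t] by (auto simp: dist_real_def abs_minus_commute)
        qed (use N[of "i + N"] d in \<open>auto simp: dist_real_def\<close>)
        then show "norm ((f (x + X (i + N)) t - f x t) / X (i + N)) \<le> B"
          using nz by (simp add: field_simps)
      qed
    qed auto
    also have "(\<lambda>i. \<integral>t. (f (x + X (i + N)) t - f x t) / X (i + N) \<partial>M) =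
      (\<lambda>i. ((\<integral>t. f (x + X (i + N)) t \<partial>M) - (\<integral>t. f x t \<partial>M)) / X (i + N))"
      using f N d by (auto simp: fun_eq_iff)
    finally show "(\<lambda>i. ((\<integral>t. f (x + X i) t \<partial>M) - (\<integral>t. f x t \<partial>M)) / X i) \<longlonglongrightarrow> (\<integral>t. f' x t \<partial>M)"
      by (rule LIMSEQ_offset)
  qed
qed

text \<open>Integration by parts against a function that is only Lipschitz: by translation invariance the
  derivative moves to a difference quotient of \<open>v\<close>, so that differentiability of \<open>v\<close>
  almost everywhere (Rademacher's theorem) is not needed.\<close>

lemma lipschitz_integral_by_parts:
  fixes W W' v :: "'a::euclidean_space \<Rightarrow> real"
  assumes der: "\<And>x. ((\<lambda>r. W (x + r *\<^sub>R b)) has_real_derivative W' x) (at 0)"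
    and cont: "continuous_on UNIV W'"
    and W: "integrable lborel W" and W': "integrable lborel W'"
    and v[measurable]: "v \<in> borel_measurable borel" and vb: "\<And>x. \<bar>v x\<bar> \<le> V"
    and lip: "\<And>x y. \<bar>v x - v y\<bar> \<le> L * norm (x - y)" and b: "norm b = 1"
  shows "\<bar>\<integral>x. v x * W' x \<partial>lborel\<bar> \<le> L * (LBINT x. \<bar>W x\<bar>)"
proof -
  have [measurable]: "W \<in> borel_measurable borel" "W' \<in> borel_measurable borel"
    using W W' by auto
  have L: "0 \<le> L" using lip[of b 0] b by (simp add: order_trans[OF abs_ge_zero])
  have vi: "integrable lborel (\<lambda>x. v x * f x)" if f: "integrable lborel f" for f :: "'a \<Rightarrow> real"
  proof (rule Bochner_Integration.integrable_bound)
    show "integrable lborel (\<lambda>x. V * \<bar>f x\<bar>)" using f by simp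
    show "(\<lambda>x. v x * f x) \<in> borel_measurable lborel" using f by measurable
    have "V \<ge> 0" using vb[of 0] by linarith
    then show "AE x in lborel. norm (v x * f x) \<le> norm (V * \<bar>f x\<bar>)"
      using vb by (auto simp: abs_mult intro!: mult_right_mono)
  qed
  have der': "((\<lambda>r. W (x + r *\<^sub>R b)) has_real_derivative W' (x + r *\<^sub>R b)) (at r)" for x r
  proof -
    have "((\<lambda>h. W ((x + r *\<^sub>R b) + h *\<^sub>R b)) has_real_derivative W' (x + r *\<^sub>R b)) (at (r + - r))"
      using der[of "x + r *\<^sub>R b"] by simp
    then have "((\<lambda>h. W ((x + r *\<^sub>R b) + (h + - r) *\<^sub>R b)) has_real_derivative W' (x + r *\<^sub>R b)) (at r)"
      by (subst (asm) DERIV_shift)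
    then show ?thesis by (simp add: algebra_simps)
  qed
  have shift: "integrable lborel (\<lambda>x. f (x + c))" "(LBINT x. f (x + c)) = (LBINT x. f x)"
    if "integrable lborel f" for f :: "'a \<Rightarrow> real" and c
    using integrable_lborel_shift[OF that, of c] integral_lborel_shift[of f c] that by (auto simp: add.commute)
  define J where "J r = (LBINT x. v x * W' (x + r *\<^sub>R b))" for r
  define A A' where "A = (LBINT x. \<bar>W x\<bar>)" and "A' = (LBINT x. \<bar>W' x\<bar>)"
  have A': "A' \<ge> 0" by (simp add: A'_def)
  have move: "(LBINT x. v x * f (x + c)) = (LBINT x. v (x - c) * f x)"
    if f: "integrable lborel f" for f c
  proof -
    have [measurable]: "f \<in> borel_measurable borel" using f by auto
    have "(LBINT x. v (x - c) * f x) = (LBINT x. v ((c + x) - c) * f (c + x))"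
      by (subst integral_lborel_shift[where c=c, symmetric]) auto
    then show ?thesis by (simp add: add.commute)
  qed
  have vi': "integrable lborel (\<lambda>x. v (x - c) * f x)" if f: "integrable lborel f" for f c
  proof -
    have "integrable lborel (\<lambda>x. v (x + - c) * f ((x + - c) + c))"
      by (rule shift(1)[where f="\<lambda>x. v x * f (x + c)" and c="-c"]) (intro vi shift f)
    then show ?thesis by simp
  qed
  \<comment> \<open>The translation is carried over from f to v, whose increments are at most
    \<open>L * norm c\<close>.\<close>
  have diff: "\<bar>(LBINT x. v x * f (x + c)) - (LBINT x. v x * f x)\<bar> \<le> L * norm c * (LBINT x. \<bar>f x\<bar>)"
    if f: "integrable lborel f" for f c
  proof -
    have "(LBINT x. v x * f (x + c)) - (LBINT x. v x * f x) =
       (LBINT x. v (x - c) * f x - v x * f x)"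
      unfolding move[OF f] using vi[OF f] vi'[OF f] by simp
    also have "\<bar>\<dots>\<bar> \<le> (LBINT x. \<bar>v (x - c) * f x - v x * f x\<bar>)"
      by (rule integral_abs_bound)
    also have "\<dots> \<le> (LBINT x. L * norm c * \<bar>f x\<bar>)"
    proof (rule integral_mono)
      show "\<bar>v (x - c) * f x - v x * f x\<bar> \<le> L * norm c * \<bar>f x\<bar>" for x
      proof -
        have "\<bar>v (x - c) * f x - v x * f x\<bar> = \<bar>v (x - c) - v x\<bar> * \<bar>f x\<bar>"
          by (simp only: left_diff_distrib[symmetric] abs_mult)
        also have "\<dots> \<le> L * norm ((x - c) - x) * \<bar>f x\<bar>"
          by (intro mult_right_mono lip) auto
        finally show ?thesis by simp
      qed
    qed (use vi[OF f] vi'[OF f] f in auto)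
    finally show ?thesis by simp
  qed
  have J_diff: "\<bar>J r - J 0\<bar> \<le> L * \<bar>r\<bar> * A'" for r
    using diff[OF W', of "r *\<^sub>R b"] b by (simp add: J_def A'_def)
  \<comment> \<open>Averaging J over 0 \<le> r \<le> t turns W' into an increment of W by the
    fundamental theorem of calculus, and \<open>diff\<close> bounds the outcome by L t A. Replacing
    J r by J 0 costs t^2 L A'. After division by t the extra term vanishes as t tends to 0.\<close>
  have key: "\<bar>J 0\<bar> \<le> L * A + t * (L * A')" if t: "0 < t" for t
  proof -
    define F where "F p = indicator {0..t} (fst p) * (v (snd p) * W' (snd p + fst p *\<^sub>R b))" for p :: "real \<times> 'a"
    have Fm[measurable]: "F \<in> borel_measurable (lborel \<Otimes>\<^sub>M lborel)"
      unfolding F_def by measurable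
    have Jm[measurable]: "J \<in> borel_measurable borel"
      unfolding J_def by measurable
    have Fi: "integrable (lborel \<Otimes>\<^sub>M lborel) F"
    proof (rule lborel_pair.Fubini_integrable[OF Fm])
      show "integrable lborel (\<lambda>r. \<integral>x. norm (F (r, x)) \<partial>lborel)"
      proof (rule Bochner_Integration.integrable_bound)
        show "integrable lborel (\<lambda>r. indicator {0..t} r * (V * A'))"
          using t by (intro integrable_mult_left integrable_real_indicator) auto
        show "AE r in lborel. norm (LBINT x. norm (F (r, x))) \<le> norm (indicator {0..t} r * (V * A'))"
        proof (rule AE_I2)
          fix r :: real
          have V: "V \<ge> 0" using vb[of 0] by linarith
          have "(LBINT x. norm (F (r, x))) \<le> (LBINT x. indicator {0..t} r * (V * \<bar>W' (x + r *\<^sub>R b)\<bar>))"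
          proof (rule integral_mono')
            show "integrable lborel (\<lambda>x. indicator {0..t} r * (V * \<bar>W' (x + r *\<^sub>R b)\<bar>))"
              using shift(1)[OF W'] by auto
            show "norm (F (r, x)) \<le> indicator {0..t} r * (V * \<bar>W' (x + r *\<^sub>R b)\<bar>)" for x
              using vb by (auto simp: F_def abs_mult indicator_def intro!: mult_right_mono)
            show "0 \<le> indicator {0..t} r * (V * \<bar>W' (x + r *\<^sub>R b)\<bar>)" for x
              using V by (intro mult_nonneg_nonneg) auto
          qed
          also have "\<dots> = indicator {0..t} r * (V * A')"
            using shift[OF integrable_abs[OF W']] unfolding A'_def by simp
          finally show "norm (LBINT x. norm (F (r, x))) \<le> norm (indicator {0..t} r * (V * A'))"
            using V A' by (simp add: abs_mult)
        qed
      qed measurable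
      show "AE r in lborel. integrable lborel (\<lambda>x. F (r, x))"
        unfolding F_def fst_conv snd_conv by (intro AE_I2 integrable_mult_right vi shift(1) W')
    qed
    have "(LBINT r. indicator {0..t} r * J r) = (LBINT r. \<integral>x. F (r, x) \<partial>lborel)"
      unfolding F_def J_def by simp
    also have "\<dots> = (LBINT x. \<integral>r. F (r, x) \<partial>lborel)"
      using lborel_pair.Fubini_integral[of "\<lambda>r x. F (r, x)"] Fi by (simp add: case_prod_beta')
    also have "\<dots> = (LBINT x. v x * (W (x + t *\<^sub>R b) - W x))"
    proof (rule Bochner_Integration.integral_cong[OF refl])
      fix x
      have "(LBINT r. indicator {0..t} r *\<^sub>R W' (x + r *\<^sub>R b)) = W (x + t *\<^sub>R b) - W (x + 0 *\<^sub>R b)"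
      proof (rule integral_FTC_atLeastAtMost)
        show "((\<lambda>r. W (x + r *\<^sub>R b)) has_vector_derivative W' (x + r *\<^sub>R b)) (at r within {0..t})" for r
          by (rule has_vector_derivative_at_within, rule der'[unfolded has_real_derivative_iff_has_vector_derivative])
        show "continuous_on {0..t} (\<lambda>r. W' (x + r *\<^sub>R b))"
          by (intro continuous_on_compose2[OF cont] continuous_intros) auto
      qed (use t in auto)
      then show "(LBINT r. F (r, x)) = v x * (W (x + t *\<^sub>R b) - W x)"
        unfolding F_def by (simp add: mult.left_commute)
    qed
    also have "\<dots> = (LBINT x. v x * W (x + t *\<^sub>R b)) - (LBINT x. v x * W x)"
      using vi[OF W] vi[OF shift(1)[OF W]] by (simp add: right_diff_distrib)
    finally have "\<bar>\<integral>r. indicator {0..t} r * J r \<partial>lborel\<bar> \<le> L * t * A"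
      using diff[OF W, of "t *\<^sub>R b"] b t by (simp add: A_def)
    moreover have "\<bar>t * J 0 - (LBINT r. indicator {0..t} r * J r)\<bar> \<le> t * (t * (L * A'))"
    proof -
      have i0: "integrable lborel (\<lambda>r::real. indicator {0..t} r * c)" for c :: real
        using t by (intro integrable_mult_left integrable_real_indicator) auto
      have i1: "integrable lborel (\<lambda>r. indicator {0..t} r * J r)"
      proof (rule Bochner_Integration.integrable_bound[OF i0[of "\<bar>J 0\<bar> + L * t * A'"]])
        show "AE r in lborel. norm (indicator {0..t} r * J r) \<le> norm (indicator {0..t} r * (\<bar>J 0\<bar> + L * t * A'))"
        proof (rule AE_I2)
          fix r
          show "norm (indicator {0..t} r * J r) \<le> norm (indicator {0..t} r * (\<bar>J 0\<bar> + L * t * A'))"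
          proof (cases "r \<in> {0..t}")
            case True
            have "L * \<bar>r\<bar> * A' \<le> L * t * A'" using True L A' by (intro mult_right_mono mult_left_mono) auto
            with J_diff[of r] True show ?thesis by (simp add: indicator_def)
          qed auto
        qed
      qed measurable
      have "t * J 0 = (LBINT r. indicator {0..t} r * J 0)" using t by simp
      then have "t * J 0 - (LBINT r. indicator {0..t} r * J r) = (LBINT r. indicator {0..t} r * J 0 - indicator {0..t} r * J r)"
        using i0 i1 by simp
      also have "\<bar>\<dots>\<bar> \<le> (LBINT r. \<bar>indicator {0..t} r * J 0 - indicator {0..t} r * J r\<bar>)"
        by (rule integral_abs_bound)
      also have "\<dots> \<le> (LBINT r. indicator {0..t} r * (t * (L * A')))"
      proof (rule integral_mono)
        fix r
        show "\<bar>indicator {0..t} r * J 0 - indicator {0..t} r * J r\<bar> \<le> indicator {0..t} r * (t * (L * A'))"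
        proof (cases "r \<in> {0..t}")
          case True
          have "L * \<bar>r\<bar> * A' \<le> L * t * A'" using True L A' by (intro mult_right_mono mult_left_mono) auto
          with J_diff[of r] True show ?thesis by (simp add: indicator_def abs_minus_commute mult_ac)
        qed auto
        show "integrable lborel (\<lambda>r. \<bar>indicator {0..t} r * J 0 - indicator {0..t} r * J r\<bar>)"
          using i0[of "J 0"] i1 by (intro integrable_abs Bochner_Integration.integrable_diff)
        show "integrable lborel (\<lambda>r. indicator {0..t} r * (t * (L * A')))"
          by (rule i0)
      qed
      also have "\<dots> = t * (t * (L * A'))" using t by simp
      finally show ?thesis .
    qed
    ultimately have "\<bar>t * J 0\<bar> \<le> L * t * A + t * (t * (L * A'))" by linarith
    then have "t * \<bar>J 0\<bar> \<le> t * (L * A + t * (L * A'))"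
      using t by (simp add: abs_mult algebra_simps)
    then show ?thesis using t by simp
  qed
  have "\<bar>J 0\<bar> \<le> L * A"
  proof (rule field_le_epsilon)
    fix e :: real assume e: "0 < e"
    have p: "0 < L * A' + 1" using L A' by (simp add: add_nonneg_pos)
    have "\<bar>J 0\<bar> \<le> L * A + (e / (L * A' + 1)) * (L * A')"
      using e p by (intro key divide_pos_pos)
    also have "(e / (L * A' + 1)) * (L * A') \<le> (e / (L * A' + 1)) * (L * A' + 1)"
      using e p by (intro mult_left_mono) auto
    also have "\<dots> = e" using p by simp
    finally show "\<bar>J 0\<bar> \<le> L * A + e" by simp
  qed
  then show ?thesis by (simp add: J_def A_def)
qed

section \<open>Convolution with a signed measure\<close>

lemma fubini_bounded_kernel:
  fixes \<phi> :: "'a::euclidean_space \<Rightarrow> real"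
  assumes M: "finite_measure M" and \<phi>: "integrable lborel \<phi>"
    and k: "(\<lambda>(x, t). k x t) \<in> borel_measurable (lborel \<Otimes>\<^sub>M M)"
    and bnd: "\<And>x t. t \<in> space M \<Longrightarrow> \<bar>k x t\<bar> \<le> B"
  shows "(LBINT x. \<phi> x * (\<integral>t. k x t \<partial>M)) = (\<integral>t. (LBINT x. \<phi> x * k x t) \<partial>M)"
    and "integrable lborel (\<lambda>x. \<phi> x * (\<integral>t. k x t \<partial>M))"
proof -
  interpret finite_measure M by fact
  interpret P: pair_sigma_finite lborel M ..
  have [measurable]: "\<phi> \<in> borel_measurable borel" using \<phi> by auto
  note k[measurable]
  have m: "(\<lambda>p. \<phi> (fst p) * k (fst p) (snd p)) \<in> borel_measurable (lborel \<Otimes>\<^sub>M M)"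
    by measurable
  have bnd': "\<bar>k x t\<bar> \<le> \<bar>B\<bar>" if "t \<in> space M" for x t
    using bnd[OF that, of x] by linarith
  have ki: "integrable M (k x)" for x
    by (rule integrable_const_bound[where B="\<bar>B\<bar>"]) (auto intro!: AE_I2 bnd')
  have i: "integrable (lborel \<Otimes>\<^sub>M M) (\<lambda>p. \<phi> (fst p) * k (fst p) (snd p))"
  proof (rule P.Fubini_integrable[OF m])
    show "integrable lborel (\<lambda>x. \<integral>t. norm (\<phi> (fst (x, t)) * k (fst (x, t)) (snd (x, t))) \<partial>M)"
    proof (rule Bochner_Integration.integrable_bound)
      show "integrable lborel (\<lambda>x. \<bar>\<phi> x\<bar> * (\<bar>B\<bar> * measure M (space M)))"
        using \<phi> by simp
      show "(\<lambda>x. \<integral>t. norm (\<phi> (fst (x, t)) * k (fst (x, t)) (snd (x, t))) \<partial>M) \<in> borel_measurable lborel"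
        by measurable
      show "AE x in lborel. norm (\<integral>t. norm (\<phi> (fst (x, t)) * k (fst (x, t)) (snd (x, t))) \<partial>M)
         \<le> norm (\<bar>\<phi> x\<bar> * (\<bar>B\<bar> * measure M (space M)))"
      proof (rule AE_I2)
        fix x
        have "(\<integral>t. norm (\<phi> x * k x t) \<partial>M) \<le> (\<integral>t. \<bar>\<phi> x\<bar> * \<bar>B\<bar> \<partial>M)"
          using ki by (intro integral_mono) (auto simp: abs_mult intro!: mult_left_mono bnd')
        then show "norm (\<integral>t. norm (\<phi> (fst (x, t)) * k (fst (x, t)) (snd (x, t))) \<partial>M)
         \<le> norm (\<bar>\<phi> x\<bar> * (\<bar>B\<bar> * measure M (space M)))"
          by (simp add: mult_ac)
      qed
    qed
    show "AE x in lborel. integrable M (\<lambda>t. \<phi> (fst (x, t)) * k (fst (x, t)) (snd (x, t)))"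
      using ki by auto
  qed
  have "(\<integral>t. (LBINT x. \<phi> x * k x t) \<partial>M) = (LBINT x. (\<integral>t. \<phi> x * k x t \<partial>M))"
    using P.Fubini_integral[of "\<lambda>x t. \<phi> x * k x t"] i by (simp add: case_prod_beta')
  also have "\<dots> = (LBINT x. \<phi> x * (\<integral>t. k x t \<partial>M))"
    by simp
  finally show "(LBINT x. \<phi> x * (\<integral>t. k x t \<partial>M)) = (\<integral>t. (LBINT x. \<phi> x * k x t) \<partial>M)"
    by simp
  show "integrable lborel (\<lambda>x. \<phi> x * (\<integral>t. k x t \<partial>M))"
    using P.integrable_fst'[OF i] by simp
qed

text \<open>The finite signed measure \<open>\<nu>\<close> is the image under \<open>pos\<close> of a finite measure
  weighted by the bounded function \<open>w\<close>; \<open>conv g\<close> is the convolution \<open>g * \<nu>\<close>.\<close>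

locale charge = finite_measure M for M :: "'b measure" +
  fixes pos :: "'b \<Rightarrow> 'a::euclidean_space" and w :: "'b \<Rightarrow> real" and W :: real
  assumes pos[measurable]: "pos \<in> borel_measurable M"
    and w[measurable]: "w \<in> borel_measurable M"
    and w_bound: "\<And>a. \<bar>w a\<bar> \<le> W"
begin

definition conv :: "('a \<Rightarrow> real) \<Rightarrow> 'a \<Rightarrow> real" where
  "conv g x = (\<integral>a. g (x - pos a) * w a \<partial>M)"

lemma W_nonneg: "0 \<le> W"
  using w_bound[of undefined] by linarith

lemma integrable_bounded_weight:
  assumes [measurable]: "f \<in> borel_measurable M" and b: "\<And>a. \<bar>f a\<bar> \<le> B"
  shows "integrable M (\<lambda>a. f a * w a)"
proof (rule integrable_const_bound[where B="B * W"])
  have "0 \<le> B" using b[of undefined] by linarith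
  then show "AE a in M. norm (f a * w a) \<le> B * W"
    using b w_bound by (auto simp: abs_mult intro!: mult_mono)
qed measurable

lemma integrable_conv_kernel:
  assumes [measurable]: "g \<in> borel_measurable borel" and "\<And>z. \<bar>g z\<bar> \<le> B"
  shows "integrable M (\<lambda>a. g (x - pos a) * w a)"
  using assms by (intro integrable_bounded_weight[where B=B]) auto

lemma measurable_conv [measurable]:
  assumes [measurable]: "g \<in> borel_measurable borel"
  shows "conv g \<in> borel_measurable borel"
  unfolding conv_def by measurable

lemma conv_bounded:
  assumes [measurable]: "g \<in> borel_measurable borel" and g: "\<And>z. \<bar>g z\<bar> \<le> B"
  shows "\<bar>conv g x\<bar> \<le> B * W * measure M (space M)"
proof -
  have B: "0 \<le> B" using g[of 0] by linarith
  have "\<bar>conv g x\<bar> \<le> (\<integral>a. \<bar>g (x - pos a) * w a\<bar> \<partial>M)"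
    unfolding conv_def by (rule integral_abs_bound)
  also have "\<dots> \<le> (\<integral>a. B * W \<partial>M)"
    using integrable_abs[OF integrable_conv_kernel[OF assms, of x]] g w_bound B
    by (intro integral_mono) (auto simp: abs_mult intro!: mult_mono)
  finally show ?thesis by (simp add: mult_ac)
qed

lemma continuous_conv:
  assumes c: "continuous_on UNIV g" and g: "\<And>z. \<bar>g z\<bar> \<le> B"
  shows "continuous_on UNIV (conv g)"
proof -
  have [measurable]: "g \<in> borel_measurable borel" using c by (rule borel_measurable_continuous_onI)
  have B: "0 \<le> B" using g[of 0] by linarith
  show ?thesis
    unfolding continuous_on_sequentially o_def conv_def
  proof (intro allI ballI impI)
    fix X :: "nat \<Rightarrow> 'a" and x assume "(\<forall>n. X n \<in> UNIV) \<and> X \<longlonglongrightarrow> x"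
    then have X: "X \<longlonglongrightarrow> x" by simp
    show "(\<lambda>n. \<integral>a. g (X n - pos a) * w a \<partial>M) \<longlonglongrightarrow> (\<integral>a. g (x - pos a) * w a \<partial>M)"
    proof (rule integral_dominated_convergence[where w="\<lambda>_. B * W"])
      show "AE a in M. (\<lambda>n. g (X n - pos a) * w a) \<longlonglongrightarrow> g (x - pos a) * w a"
        using X c
        by (intro AE_I2 tendsto_mult tendsto_const isCont_tendsto_compose[of _ g] tendsto_diff)
          (auto simp: continuous_on_eq_continuous_at)
      show "AE a in M. norm (g (X n - pos a) * w a) \<le> B * W" for n
        using B g w_bound by (auto simp: abs_mult intro!: mult_mono)
    qed auto
  qed
qed

lemma conv_has_derivative:
  assumes [measurable]: "g \<in> borel_measurable borel" "g' \<in> borel_measurable borel"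
    and g: "\<And>z. \<bar>g z\<bar> \<le> B" and g': "\<And>z. \<bar>g' z\<bar> \<le> B'"
    and der: "\<And>z. ((\<lambda>r. g (z + r *\<^sub>R b)) has_real_derivative g' z) (at 0)"
  shows "((\<lambda>r. conv g (x + r *\<^sub>R b)) has_real_derivative conv g' x) (at 0)"
proof -
  have der': "((\<lambda>r. g (z + r *\<^sub>R b)) has_real_derivative g' (z + r *\<^sub>R b)) (at r)" for z r
  proof -
    have "((\<lambda>h. g ((z + r *\<^sub>R b) + h *\<^sub>R b)) has_real_derivative g' (z + r *\<^sub>R b)) (at (r + - r))"
      using der[of "z + r *\<^sub>R b"] by simp
    then have "((\<lambda>h. g ((z + r *\<^sub>R b) + (h + - r) *\<^sub>R b)) has_real_derivative g' (z + r *\<^sub>R b)) (at r)"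
      by (subst (asm) DERIV_shift)
    then show ?thesis by (simp add: algebra_simps)
  qed
  have B': "0 \<le> B'" using g'[of 0] by linarith
  have "((\<lambda>r. \<integral>a. g ((x - pos a) + r *\<^sub>R b) * w a \<partial>M) has_real_derivative
     (\<integral>a. g' ((x - pos a) + 0 *\<^sub>R b) * w a \<partial>M)) (at 0)"
  proof (rule has_real_derivative_integral[where d=1 and B="B' * W" and f'="\<lambda>r a. g' ((x - pos a) + r *\<^sub>R b) * w a"])
    show "finite_measure M" by (rule finite_measure_axioms)
    show "integrable M (\<lambda>a. g ((x - pos a) + r *\<^sub>R b) * w a)" for r
      using integrable_conv_kernel[OF assms(1) g, of "x + r *\<^sub>R b"] by (simp add: diff_add_eq)
    show "((\<lambda>r. g (x - pos t + r *\<^sub>R b) * w t) has_real_derivative g' (x - pos t + r *\<^sub>R b) * w t) (at r)" for r t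
      by (intro DERIV_cmult_right der')
    show "\<bar>g' (x - pos t + r *\<^sub>R b) * w t\<bar> \<le> B' * W" for r t
      using g' w_bound B' by (auto simp: abs_mult intro!: mult_mono)
  qed auto
  then show ?thesis by (simp add: conv_def algebra_simps)
qed

lemma integrable_conv:
  assumes g: "integrable lborel g"
  shows "integrable lborel (conv g)"
proof -
  interpret P: pair_sigma_finite M lborel ..
  interpret Q: pair_sigma_finite lborel M ..
  have [measurable]: "g \<in> borel_measurable borel" using g by auto
  have "integrable (M \<Otimes>\<^sub>M lborel) (\<lambda>p. g (snd p - pos (fst p)) * w (fst p))"
  proof (rule P.Fubini_integrable)
    have n: "(LBINT x. norm (g (x - c) * y)) = \<bar>y\<bar> * (LBINT x. \<bar>g x\<bar>)" for c y
      using integral_lborel_diff[of "\<lambda>x. \<bar>g x\<bar>" c] by (simp add: abs_mult)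
    have "integrable M (\<lambda>a. \<bar>w a\<bar> * (LBINT x. \<bar>g x\<bar>))"
      using w_bound W_nonneg by (intro integrable_mult_left integrable_const_bound[where B=W]) auto
    then show "integrable M (\<lambda>a. \<integral>x. norm (g (snd (a, x) - pos (fst (a, x))) * w (fst (a, x))) \<partial>lborel)"
      by (simp only: fst_conv snd_conv n)
    show "AE a in M. integrable lborel (\<lambda>x. g (snd (a, x) - pos (fst (a, x))) * w (fst (a, x)))"
      using integrable_lborel_diff[OF g] by auto
  qed measurable
  then have "integrable (lborel \<Otimes>\<^sub>M M) (\<lambda>p. g (fst p - pos (snd p)) * w (snd p))"
    by (subst Q.integrable_product_swap_iff[symmetric]) (simp add: case_prod_beta')
  from Q.integrable_fst'[OF this] show ?thesis by (simp add: conv_def[abs_def])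
qed

text \<open>Moves the convolution onto the test function. When the test function is itself a heat
  kernel, the inner integral is evaluated by the semigroup law.\<close>

lemma integral_mult_conv:
  assumes \<phi>: "integrable lborel \<phi>" and [measurable]: "g \<in> borel_measurable borel" and g: "\<And>z. \<bar>g z\<bar> \<le> B"
  shows "(LBINT x. \<phi> x * conv g x) = (\<integral>a. (LBINT x. \<phi> x * g (x - pos a)) * w a \<partial>M)"
    and "integrable lborel (\<lambda>x. \<phi> x * conv g x)"
proof -
  have B: "0 \<le> B" using g[of 0] by linarith
  have b: "\<bar>g (x - pos a) * w a\<bar> \<le> B * W" for x a
    using g w_bound B by (auto simp: abs_mult intro!: mult_mono)
  have fm: "finite_measure M" by (rule finite_measure_axioms)
  have m: "(\<lambda>(x, a). g (x - pos a) * w a) \<in> borel_measurable (lborel \<Otimes>\<^sub>M M)"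
    by measurable
  show "integrable lborel (\<lambda>x. \<phi> x * conv g x)"
    unfolding conv_def by (rule fubini_bounded_kernel(2)[OF fm \<phi> m b])
  have "(LBINT x. \<phi> x * conv g x) = (\<integral>a. (LBINT x. \<phi> x * (g (x - pos a) * w a)) \<partial>M)"
    unfolding conv_def by (rule fubini_bounded_kernel(1)[OF fm \<phi> m b])
  also have "\<dots> = (\<integral>a. (LBINT x. \<phi> x * g (x - pos a)) * w a \<partial>M)"
    by (simp flip: mult.assoc)
  finally show "(LBINT x. \<phi> x * conv g x) = (\<integral>a. (LBINT x. \<phi> x * g (x - pos a)) * w a \<partial>M)" .
qed

end

section \<open>Mixtures of heat kernels in time\<close>

text \<open>Making the screening weight part of a finite measure turns convergence of every time
  mixture into boundedness of its integrand. The mass bound 1/\<kappa>^2 serves finiteness and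
  \<open>far_zero_le_planar\<close>, where it is multiplied by \<kappa>^2; it never enters a
  constant of the final estimate.\<close>

definition clock :: "real \<Rightarrow> real measure" where
  "clock \<kappa> = density lborel (\<lambda>t. ennreal (indicator {0<..} t * exp (- (\<kappa>\<^sup>2 * t))))"

lemma sets_clock [simp, measurable_cong]: "sets (clock \<kappa>) = sets borel"
  by (simp add: clock_def)

lemma space_clock [simp]: "space (clock \<kappa>) = UNIV"
  by (simp add: clock_def)

lemma measurable_clock_eq [simp]: "borel_measurable (clock \<kappa>) = borel_measurable borel"
  by (intro measurable_cong_sets) auto

lemma nn_integral_clock:
  assumes [measurable]: "f \<in> borel_measurable borel"
  shows "(\<integral>\<^sup>+t. f t \<partial>clock \<kappa>) = (\<integral>\<^sup>+t. ennreal (indicator {0<..} t * exp (- (\<kappa>\<^sup>2 * t))) * f t \<partial>lborel)"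
  unfolding clock_def by (subst nn_integral_density) auto

lemma integral_clock:
  fixes f :: "real \<Rightarrow> real"
  assumes [measurable]: "f \<in> borel_measurable borel"
  shows "(\<integral>t. f t \<partial>clock \<kappa>) = (LBINT t. indicator {0<..} t * exp (- (\<kappa>\<^sup>2 * t)) * f t)"
  unfolding clock_def by (subst integral_density) auto

lemma integrable_clock_iff:
  fixes f :: "real \<Rightarrow> real"
  assumes [measurable]: "f \<in> borel_measurable borel"
  shows "integrable (clock \<kappa>) f \<longleftrightarrow> integrable lborel (\<lambda>t. indicator {0<..} t * exp (- (\<kappa>\<^sup>2 * t)) * f t)"
  unfolding clock_def by (subst integrable_density) auto

lemma emeasure_clock_le:
  assumes \<kappa>: "0 < \<kappa>"
  shows "emeasure (clock \<kappa>) UNIV \<le> ennreal (1 / \<kappa>\<^sup>2)"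
proof -
  interpret prob_space "density lborel (exponential_density (\<kappa>\<^sup>2))"
    using \<kappa> by (intro prob_space_exponential_density) simp
  have "emeasure (clock \<kappa>) UNIV = (\<integral>\<^sup>+t. ennreal (indicator {0<..} t * exp (- (\<kappa>\<^sup>2 * t))) \<partial>lborel)"
    unfolding clock_def by (simp add: emeasure_density)
  also have "\<dots> \<le> (\<integral>\<^sup>+t. ennreal (1 / \<kappa>\<^sup>2) * ennreal (exponential_density (\<kappa>\<^sup>2) t) \<partial>lborel)"
    using \<kappa> by (intro nn_integral_mono)
      (auto simp: exponential_density_def indicator_def mult_ac simp flip: ennreal_mult)
  also have "\<dots> = ennreal (1 / \<kappa>\<^sup>2) * (\<integral>\<^sup>+t. ennreal (exponential_density (\<kappa>\<^sup>2) t) \<partial>lborel)"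
    by (rule nn_integral_cmult) (auto simp: exponential_density_def[abs_def])
  also have "(\<integral>\<^sup>+t. ennreal (exponential_density (\<kappa>\<^sup>2) t) \<partial>lborel) = 1"
    using emeasure_space_1 by (simp add: emeasure_density exponential_density_def[abs_def])
  finally show ?thesis by simp
qed

lemma finite_measure_clock:
  assumes \<kappa>: "0 < \<kappa>"
  shows "finite_measure (clock \<kappa>)"
proof (rule finite_measureI)
  show "emeasure (clock \<kappa>) (space (clock \<kappa>)) \<noteq> \<infinity>"
    using emeasure_clock_le[OF \<kappa>] by (auto simp: top_unique)
qed

section \<open>Heat kernels and their mixtures as functions of the squared radius\<close>

lemma powr_exp_bounded:
  fixes a c :: real
  assumes a: "0 \<le> a" and c: "0 < c"
  obtains C where "\<And>y. 0 < y \<Longrightarrow> y powr a * exp (- (c * y)) \<le> C"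
proof
  fix y :: real assume y: "0 < y"
  \<comment> \<open>The logarithm is bounded by its tangent at (a + 1)/c. The maximum of the
    function lies at a/c; with a + 1 the case a = 0 needs no separate treatment.\<close>
  have z: "0 < c * y / (a + 1)" using y a c by simp
  have "ln (c * y / (a + 1) * ((a + 1) / c)) = ln (c * y / (a + 1)) + ln ((a + 1) / c)"
    using z a c by (intro ln_mult_pos) auto
  then have "ln y = ln (c * y / (a + 1)) + ln ((a + 1) / c)"
    using a c by simp
  also have "\<dots> \<le> c * y / (a + 1) - 1 + ln ((a + 1) / c)"
    using ln_le_minus_one[OF z] by simp
  finally have "a * ln y \<le> a * (c * y / (a + 1) - 1 + ln ((a + 1) / c))"
    using a by (intro mult_left_mono) auto
  also have "\<dots> \<le> c * y + a * ln ((a + 1) / c)"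
  proof -
    have "a * (c * y) / (a + 1) \<le> c * y"
      using a c y by (simp add: field_simps)
    then show ?thesis using a by (simp add: algebra_simps)
  qed
  finally have "a * ln y - c * y \<le> a * ln ((a + 1) / c)" by simp
  then have "exp (a * ln y - c * y) \<le> exp (a * ln ((a + 1) / c))" by simp
  then show "y powr a * exp (- (c * y)) \<le> exp (a * ln ((a + 1) / c))"
    using y by (simp add: powr_def flip: exp_add)
qed

text \<open>The k-th derivative, with respect to q = |x|^2, of the heat kernel in dimension d. In
  the variable q a radial mixture is an ordinary function of one real variable, differentiable also
  at q = 0 when times are bounded away from 0.\<close>

definition rad :: "real \<Rightarrow> nat \<Rightarrow> real \<Rightarrow> real \<Rightarrow> real" where
  "rad d k q t = (4 * pi * t) powr (- (d / 2)) * (- 1 / (4 * t)) ^ k * exp (- (q / (4 * t)))"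

lemma measurable_rad [measurable (raw)]:
  assumes [measurable]: "f \<in> borel_measurable M" "g \<in> borel_measurable M"
  shows "(\<lambda>x. rad d k (f x) (g x)) \<in> borel_measurable M"
  unfolding rad_def by measurable

lemma rad_0_heat: "rad (real DIM('a)) 0 ((norm x)\<^sup>2) t = heat t (x::'a::euclidean_space)"
  by (simp add: rad_def heat_def)

lemma rad_Suc: "rad d (Suc k) q t = rad d k q t * (- 1 / (4 * t))"
  by (simp add: rad_def)

lemma rad_2: "rad d 2 q t = rad d 0 q t * (1 / (4 * t) * (1 / (4 * t)))"
  by (simp add: rad_def power2_eq_square)

lemma rad_has_derivative: "((\<lambda>q. rad d k q t) has_real_derivative rad d (Suc k) q t) (at q)"
proof -
  have "((\<lambda>q. exp (- (q * c))) has_real_derivative exp (- (q * c)) * - c) (at q)" for c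
    by (auto intro!: derivative_eq_intros)
  from DERIV_cmult[OF this[of "1 / (4 * t)"], of "(4 * pi * t) powr (- (d / 2)) * (- 1 / (4 * t)) ^ k"]
  show ?thesis by (simp add: rad_def mult_ac)
qed

text \<open>In the variable y = 1/(4t) the kernel has the form y^(d/2 + k) exp (-q y), to which
  \<open>powr_exp_bounded\<close> applies.\<close>

lemma abs_rad:
  assumes t: "0 < t"
  shows "\<bar>rad d k q t\<bar> = pi powr (- (d / 2)) * ((1 / (4 * t)) powr (d / 2 + real k) * exp (- (q * (1 / (4 * t)))))"
proof -
  have "(4 * pi * t) powr (- (d / 2)) = pi powr (- (d / 2)) * (1 / (4 * t)) powr (d / 2)"
  proof -
    have "4 * pi * t = pi * (4 * t)" by simp
    then have "(4 * pi * t) powr (- (d / 2)) = pi powr (- (d / 2)) * (4 * t) powr (- (d / 2))"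
      using t by (simp only: powr_mult)
    also have "(4 * t) powr (- (d / 2)) = (1 / (4 * t)) powr (d / 2)"
      using t by (simp add: powr_minus powr_divide inverse_eq_divide)
    finally show ?thesis .
  qed
  moreover have "\<bar>(- 1 / (4 * t)) ^ k\<bar> = (1 / (4 * t)) powr (real k)"
  proof -
    have "(1 / (4 * t)) powr real k = (1 / (4 * t)) ^ k"
      using t by (intro powr_realpow) simp
    moreover have "\<bar>- 1 / (4 * t)\<bar> = 1 / (4 * t)" using t by simp
    ultimately show ?thesis by (simp only: power_abs)
  qed
  ultimately show ?thesis
    using t by (simp add: rad_def abs_mult powr_add mult_ac)
qed

text \<open>Time sets for which the mixture is smooth near \<open>q\<close>: every set of times does for
  \<open>q > 0\<close>, and sets bounded away from \<open>0\<close> do for every \<open>q\<close>.\<close>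

definition regular :: "real set \<Rightarrow> real \<Rightarrow> bool" where
  "regular A q \<longleftrightarrow> A \<in> sets borel \<and> A \<subseteq> {0<..} \<and> 0 \<le> q \<and> (0 < q \<or> (\<exists>s>0. A \<subseteq> {s..}))"

text \<open>A bound uniform in the time and in a neighbourhood of q, as differentiation under the
  time integral requires. For q > 0 half of the Gaussian exponent absorbs the negative powers of t;
  otherwise t \<ge> s bounds them directly.\<close>

lemma regular_bounded:
  assumes A: "regular A q" and d: "0 \<le> d"
  obtains e B where "0 < e" "\<And>r t. \<bar>r - q\<bar> < e \<Longrightarrow> \<bar>indicator A t * rad d k r t\<bar> \<le> B"
proof -
  have Apos: "A \<subseteq> {0<..}" using A by (auto simp: regular_def)
  consider "0 < q" | s where "0 < s" "A \<subseteq> {s..}" "0 \<le> q" using A by (auto simp: regular_def)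
  then show thesis
  proof cases
    case 1
    obtain C where C: "\<And>y. 0 < y \<Longrightarrow> y powr (d / 2 + real k) * exp (- (q / 2 * y)) \<le> C"
      using powr_exp_bounded[of "d / 2 + real k" "q / 2"] d 1 by auto
    have C0: "0 \<le> C" using C[of 1] by (smt (verit) exp_ge_zero powr_ge_zero mult_nonneg_nonneg)
    show thesis
    proof (rule that)
      show "0 < q / 2" using 1 by simp
      fix r t assume r: "\<bar>r - q\<bar> < q / 2"
      show "\<bar>indicator A t * rad d k r t\<bar> \<le> pi powr (- (d / 2)) * C"
      proof (cases "t \<in> A")
        case True
        then have t: "0 < t" using Apos by auto
        have "exp (- (r * (1 / (4 * t)))) \<le> exp (- (q / 2 * (1 / (4 * t))))"
        proof -
          have "q / 2 * (1 / (4 * t)) \<le> r * (1 / (4 * t))"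
            using r t by (intro mult_right_mono) (auto simp: abs_if split: if_splits)
          then show ?thesis by simp
        qed
        then have "(1 / (4 * t)) powr (d / 2 + real k) * exp (- (r * (1 / (4 * t)))) \<le>
            (1 / (4 * t)) powr (d / 2 + real k) * exp (- (q / 2 * (1 / (4 * t))))"
          by (intro mult_left_mono) auto
        also have "\<dots> \<le> C" using t by (intro C) auto
        finally show ?thesis
          using True t by (simp add: abs_mult abs_rad[OF t] mult_left_mono)
      qed (use C0 in simp)
    qed
  next
    case (2 s)
    \<comment> \<open>The neighbourhood of q is two-sided, so r may be negative when q = 0; the
      factor exp (1/(4s)) covers r > -1.\<close>
    define B where "B = (1 / (4 * s)) powr (d / 2 + real k) * exp (1 / (4 * s))"
    have B0: "0 \<le> B" by (simp add: B_def)
    show thesis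
    proof (rule that)
      show "0 < (1::real)" by simp
      fix r t assume r: "\<bar>r - q\<bar> < 1"
      show "\<bar>indicator A t * rad d k r t\<bar> \<le> pi powr (- (d / 2)) * B"
      proof (cases "t \<in> A")
        case True
        then have t: "0 < t" and st: "s \<le> t" using Apos 2 by auto
        have y: "1 / (4 * t) \<le> 1 / (4 * s)" using st 2 by (simp add: frac_le)
        have "(- r) * (1 / (4 * t)) \<le> 1 * (1 / (4 * s))"
          using r y t 2 by (intro mult_mono) auto
        then have e: "exp (- (r * (1 / (4 * t)))) \<le> exp (1 / (4 * s))" by simp
        have "(1 / (4 * t)) powr (d / 2 + real k) * exp (- (r * (1 / (4 * t)))) \<le> B"
          unfolding B_def using y t d by (intro mult_mono e powr_mono2) auto
        then show ?thesis
          using True t by (simp add: abs_mult abs_rad[OF t] mult_left_mono)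
      qed (use B0 in simp)
    qed
  qed
qed

definition mix :: "real \<Rightarrow> real \<Rightarrow> real set \<Rightarrow> nat \<Rightarrow> real \<Rightarrow> real" where
  "mix \<kappa> d A k q = (\<integral>t. indicator A t * rad d k q t \<partial>clock \<kappa>)"

lemma measurable_mix [measurable (raw)]:
  assumes \<kappa>: "0 < \<kappa>" and [measurable]: "A \<in> sets borel" "f \<in> borel_measurable M"
  shows "(\<lambda>x. mix \<kappa> d A k (f x)) \<in> borel_measurable M"
proof -
  interpret finite_measure "clock \<kappa>" using \<kappa> by (rule finite_measure_clock)
  show ?thesis unfolding mix_def by measurable
qed

lemma integrable_mix:
  assumes \<kappa>: "0 < \<kappa>" and A: "regular A q" and d: "0 \<le> d"
  shows "integrable (clock \<kappa>) (\<lambda>t. indicator A t * rad d k q t)"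
proof -
  interpret finite_measure "clock \<kappa>" using \<kappa> by (rule finite_measure_clock)
  have [measurable]: "A \<in> sets borel" using A by (simp add: regular_def)
  obtain e B where "0 < e" "\<And>r t. \<bar>r - q\<bar> < e \<Longrightarrow> \<bar>indicator A t * rad d k r t\<bar> \<le> B"
    using regular_bounded[OF A d] by metis
  then show ?thesis
    by (intro integrable_const_bound[where B=B]) auto
qed

lemma mix_has_derivative:
  assumes \<kappa>: "0 < \<kappa>" and A: "regular A q" and d: "0 \<le> d"
  shows "((\<lambda>q. mix \<kappa> d A k q) has_real_derivative mix \<kappa> d A (Suc k) q) (at q)"
proof -
  have [measurable]: "A \<in> sets borel" using A by (simp add: regular_def)
  interpret finite_measure "clock \<kappa>" using \<kappa> by (rule finite_measure_clock)
  obtain e B where e: "0 < e" and B: "\<And>r t. \<bar>r - q\<bar> < e \<Longrightarrow> \<bar>indicator A t * rad d (Suc k) r t\<bar> \<le> B"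
    using regular_bounded[OF A d] by metis
  obtain e' B' where e': "0 < e'" and B': "\<And>r t. \<bar>r - q\<bar> < e' \<Longrightarrow> \<bar>indicator A t * rad d k r t\<bar> \<le> B'"
    using regular_bounded[OF A d] by metis
  show ?thesis
    unfolding mix_def
  proof (rule has_real_derivative_integral[where d="min e e'" and B=B and f'="\<lambda>q t. indicator A t * rad d (Suc k) q t"])
    show "finite_measure (clock \<kappa>)" by (rule finite_measure_axioms)
    show "integrable (clock \<kappa>) (\<lambda>t. indicator A t * rad d k r t)" if "\<bar>r - q\<bar> < min e e'" for r
      using B'[of r] that by (intro integrable_const_bound[where B=B']) auto
    show "((\<lambda>r. indicator A t * rad d k r t) has_real_derivative indicator A t * rad d (Suc k) r t) (at r)" for r t
      by (intro DERIV_cmult rad_has_derivative)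
  qed (use e e' B in auto)
qed

lemma mix_0_nonneg: "0 \<le> mix \<kappa> d A 0 q"
  unfolding mix_def by (intro integral_nonneg_AE AE_I2) (auto simp: rad_def)

lemma mix_disjoint_union:
  assumes \<kappa>: "0 < \<kappa>" and A: "regular A q" and B: "regular B q" and AB: "A \<inter> B = {}" and d: "0 \<le> d"
  shows "mix \<kappa> d (A \<union> B) k q = mix \<kappa> d A k q + mix \<kappa> d B k q"
proof -
  have "indicator (A \<union> B) t = (indicator A t + indicator B t :: real)" for t
    using AB by (auto simp: indicator_def)
  then show ?thesis
    unfolding mix_def using integrable_mix[OF \<kappa> A d] integrable_mix[OF \<kappa> B d]
    by (simp add: distrib_right)
qed

lemma mix_0_mono:
  assumes \<kappa>: "0 < \<kappa>" and B: "regular B q" and A: "A \<in> sets borel" and AB: "A \<subseteq> B" and d: "0 \<le> d"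
  shows "mix \<kappa> d A 0 q \<le> mix \<kappa> d B 0 q"
  unfolding mix_def
proof (rule integral_mono')
  show "integrable (clock \<kappa>) (\<lambda>t. indicator B t * rad d 0 q t)" by (rule integrable_mix[OF \<kappa> B d])
qed (use AB in \<open>auto simp: indicator_def rad_def\<close>)

section \<open>The Yukawa kernel as a mixture of heat kernels\<close>

text \<open>Folding the line at 0 adds exp (-\<nu>\<theta>) and exp (\<nu>\<theta>), which is twice
  the hyperbolic cosine. The full line is the range of the logarithmic substitution in
  \<open>yukawa_eq_mix\<close>.\<close>

lemma bessel_K_eq_line_integral:
  assumes i: "integrable lborel (\<lambda>\<theta>. exp (- r * cosh \<theta>) * exp (- (\<nu> * \<theta>)))"
  shows "(LBINT \<theta>. exp (- r * cosh \<theta>) * exp (- (\<nu> * \<theta>))) = 2 * bessel_K \<nu> r"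
proof -
  define F where "F \<theta> = exp (- r * cosh \<theta>) * exp (- (\<nu> * \<theta>))" for \<theta> :: real
  have [measurable]: "F \<in> borel_measurable borel"
    unfolding F_def by (intro borel_measurable_continuous_onI continuous_intros)
  have F: "integrable lborel F" using i by (simp add: F_def[abs_def])
  have Fm: "integrable lborel (\<lambda>\<theta>. F (- \<theta>))"
    using lborel_integrable_real_affine[OF F, of "-1" 0] by simp
  have i1: "integrable lborel (\<lambda>\<theta>. indicator {0..} \<theta> * F \<theta>)" "integrable lborel (\<lambda>\<theta>. indicator {..<0} \<theta> * F \<theta>)"
    "integrable lborel (\<lambda>\<theta>. indicator {0..} \<theta> * F (- \<theta>))"
    using integrable_mult_indicator[OF _ F, of "{0..}"] integrable_mult_indicator[OF _ F, of "{..<0}"]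
      integrable_mult_indicator[OF _ Fm, of "{0..}"] by auto
  have "(LBINT \<theta>. F \<theta>) = (LBINT \<theta>. indicator {0..} \<theta> * F \<theta> + indicator {..<0} \<theta> * F \<theta>)"
    by (intro Bochner_Integration.integral_cong) (auto simp: indicator_def)
  also have "\<dots> = (LBINT \<theta>. indicator {0..} \<theta> * F \<theta>) + (LBINT \<theta>. indicator {..<0} \<theta> * F \<theta>)"
    using i1 by simp
  also have "(LBINT \<theta>. indicator {..<0} \<theta> * F \<theta>) = (LBINT \<theta>. indicator {..<0} (- \<theta>) * F (- \<theta>))"
    using lborel_integral_real_affine[of "-1" "\<lambda>\<theta>. indicator {..<0} \<theta> * F \<theta>" 0] by simp
  \<comment> \<open>Reflection turns {..<0} into {0<..}, which differs from {0..} only at the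
    origin.\<close>
  also have "\<dots> = (LBINT \<theta>. indicator {0..} \<theta> * F (- \<theta>))"
  proof (rule integral_cong_AE)
    show "AE \<theta> in lborel. indicator {..<0} (- \<theta>) * F (- \<theta>) = indicator {0..} \<theta> * F (- \<theta>)"
      using AE_lborel_singleton[of "0::real"] by eventually_elim (auto simp: indicator_def)
  qed measurable
  also have "(LBINT \<theta>. indicator {0..} \<theta> * F \<theta>) + (LBINT \<theta>. indicator {0..} \<theta> * F (- \<theta>)) =
     (LBINT \<theta>. indicator {0..} \<theta> * F \<theta> + indicator {0..} \<theta> * F (- \<theta>))"
    using i1 by simp
  also have "\<dots> = (LBINT \<theta>. 2 * (indicator {0..} \<theta> *\<^sub>R (exp (- r * cosh \<theta>) * cosh (\<nu> * \<theta>))))"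
    by (intro Bochner_Integration.integral_cong) (auto simp: F_def cosh_def indicator_def field_simps)
  also have "\<dots> = 2 * bessel_K \<nu> r"
    unfolding bessel_K_def set_lebesgue_integral_def by simp
  finally show ?thesis by (simp add: F_def)
qed

text \<open>The substitution is t = c exp \<theta>, where c = |z|/(2\<kappa>) is the time at which
  \<kappa>^2 t and |z|^2/(4t) agree. Their sum then becomes \<kappa>|z| cosh \<theta>, the exponent
  in the Bessel integral, and the powers of t leave exp (-\<nu>\<theta>).\<close>

lemma yukawa_eq_mix:
  fixes z :: "'a::euclidean_space"
  assumes \<kappa>: "0 < \<kappa>" and z: "z \<noteq> 0"
  shows "yukawa \<kappa> z = mix \<kappa> (real DIM('a)) {0<..} 0 ((norm z)\<^sup>2)"
proof -
  define d \<nu> r c q where "d = real DIM('a)" and "\<nu> = d / 2 - 1" and "r = \<kappa> * norm z"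
    and "c = norm z / (2 * \<kappa>)" and "q = (norm z)\<^sup>2"
  have c: "0 < c" and q: "0 < q" and nz: "0 < norm z" using \<kappa> z by (auto simp: c_def q_def)
  define F where "F \<theta> = exp (- r * cosh \<theta>) * exp (- (\<nu> * \<theta>))" for \<theta> :: real
  define K where "K = (4 * pi) powr (- (d / 2)) * c powr (- \<nu>)"
  have K: "0 < K" using c by (simp add: K_def)
  have reg: "regular {0<..} q" using q by (auto simp: regular_def)
  have pt: "exp (- (\<kappa>\<^sup>2 * t)) * rad d 0 q t = K * (F (ln t - ln c) * (1 / t))" if t: "0 < t" for t
  proof -
    have l: "ln t - ln c = ln (t / c)" using t c by (simp add: ln_div)
    have ch: "cosh (ln (t / c)) = (t / c + c / t) / 2"
      using t c by (subst cosh_ln_real) auto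
    have rc: "r * cosh (ln (t / c)) = \<kappa>\<^sup>2 * t + q / (4 * t)"
      unfolding ch unfolding r_def c_def q_def using t \<kappa> nz by (simp add: field_simps power2_eq_square)
    have "exp (- (\<nu> * ln (t / c))) = (t / c) powr (- \<nu>)"
      using t c by (simp add: powr_def)
    also have "\<dots> = t powr (- \<nu>) / c powr (- \<nu>)" using t c by (simp add: powr_divide)
    finally have e: "exp (- (\<nu> * ln (t / c))) = t powr (- \<nu>) / c powr (- \<nu>)" .
    have F: "F (ln t - ln c) = exp (- (\<kappa>\<^sup>2 * t)) * exp (- (q / (4 * t))) * (t powr (- \<nu>) / c powr (- \<nu>))"
      unfolding l F_def e using rc by (simp flip: exp_add)
    have "t powr (- (d / 2)) = t powr (- \<nu>) * t powr (- 1)"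
      unfolding powr_add[symmetric] by (simp add: \<nu>_def)
    also have "\<dots> = t powr (- \<nu>) * (1 / t)" using t by (simp add: powr_minus_divide)
    finally have tp: "t powr (- (d / 2)) = t powr (- \<nu>) * (1 / t)" .
    have "(4 * pi * t) powr (- (d / 2)) = (4 * pi) powr (- (d / 2)) * t powr (- (d / 2))"
      using t by (simp add: powr_mult)
    then show ?thesis
      unfolding F K_def rad_def tp using c by simp
  qed
  have I: "integrable lborel (\<lambda>t. indicator {0<..} t * exp (- (\<kappa>\<^sup>2 * t)) * (indicator {0<..} t * rad d 0 q t))"
  proof -
    have "(\<lambda>t. indicator {0<..} t * rad d 0 q t) \<in> borel_measurable borel" by measurable
    then show ?thesis
      using integrable_mix[OF \<kappa> reg, of d 0] integrable_clock_iff[of "\<lambda>t. indicator {0<..} t * rad d 0 q t" \<kappa>] by (simp add: d_def)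
  qed
  define G where "G t = indicator {0<..} t * (F (ln t - ln c) * (1 / t))" for t
  have eq: "indicator {0<..} t * exp (- (\<kappa>\<^sup>2 * t)) * (indicator {0<..} t * rad d 0 q t) =
     K * G t" for t
    using pt[of t] by (auto simp: indicator_def G_def)
  have I2: "integrable lborel G"
  proof -
    have "integrable lborel (\<lambda>t. 1 / K * (K * G t))"
      by (intro integrable_mult_right I[unfolded eq])
    then show ?thesis using K by simp
  qed
  have lnt: "filterlim (\<lambda>t::real. ln t - ln c) at_bot (at_right 0)"
  proof -
    have "filterlim (\<lambda>t::real. - ln c + ln t) at_bot (at_right 0)"
      by (subst filterlim_tendsto_add_at_bot_iff[OF tendsto_const]) (rule ln_at_0)
    then show ?thesis by simp
  qed
  have lnt': "filterlim (\<lambda>t::real. ln t - ln c) at_top at_top"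
    using filterlim_tendsto_add_at_top[OF tendsto_const[of "- ln c"] ln_at_top] by simp
  have F_cont: "isCont F x" for x
    unfolding F_def by (intro continuous_intros)
  \<comment> \<open>The substitution rule for nonnegative integrands also transports integrability,
    so convergence of the Bessel integral is inherited from the mixture.\<close>
  have sub: "set_integrable lborel (einterval (-\<infinity>) \<infinity>) F"
    "(LBINT x=-\<infinity>..\<infinity>. F x) = (LBINT t=0..\<infinity>. (F (ln t - ln c) * (1 / t)))"
  proof (rule_tac[!] interval_integral_substitution_nonneg[where g="\<lambda>t. ln t - ln c" and g'="\<lambda>t. 1 / t" and a=0 and b=\<infinity>])
    show "set_integrable lborel (einterval 0 \<infinity>) (\<lambda>t. F (ln t - ln c) * (1 / t))"
      using I2 by (simp add: set_integrable_def zero_ereal_def G_def[abs_def])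
    then show "set_integrable lborel (einterval 0 \<infinity>) (\<lambda>t. F (ln t - ln c) * (1 / t))" .
    show "((ereal \<circ> (\<lambda>t. ln t - ln c) \<circ> real_of_ereal) \<longlongrightarrow> - \<infinity>) (at_right 0)"
      using lnt unfolding zero_ereal_def by (simp add: ereal_tendsto_simps)
    then show "((ereal \<circ> (\<lambda>t. ln t - ln c) \<circ> real_of_ereal) \<longlongrightarrow> - \<infinity>) (at_right 0)" .
    show "((ereal \<circ> (\<lambda>t. ln t - ln c) \<circ> real_of_ereal) \<longlongrightarrow> \<infinity>) (at_left \<infinity>)"
      using lnt' by (simp add: ereal_tendsto_simps)
    then show "((ereal \<circ> (\<lambda>t. ln t - ln c) \<circ> real_of_ereal) \<longlongrightarrow> \<infinity>) (at_left \<infinity>)" .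
  qed (auto simp: F_cont F_def intro!: derivative_eq_intros continuous_intros)
  have Fi: "integrable lborel F" using sub(1) by (simp add: set_integrable_def)
  have "mix \<kappa> d {0<..} 0 q = K * (LBINT t. G t)"
    unfolding mix_def by (subst integral_clock, measurable) (simp only: eq, simp)
  also have "(LBINT t. G t) = (LBINT t=0..\<infinity>. (F (ln t - ln c) * (1 / t)))"
    unfolding zero_ereal_def interval_integral_to_infinity_eq by (simp add: set_lebesgue_integral_def G_def)
  also have "\<dots> = (LBINT \<theta>. F \<theta>)"
    unfolding sub(2)[symmetric] by (simp add: interval_lebesgue_integral_def set_lebesgue_integral_def)
  also have "\<dots> = 2 * bessel_K \<nu> r"
    using bessel_K_eq_line_integral[of r \<nu>] Fi by (simp add: F_def[abs_def])
  finally have m: "mix \<kappa> d {0<..} 0 q = K * (2 * bessel_K \<nu> r)" .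
  \<comment> \<open>Once c is inserted, only powers of 2 are left to compare: their exponents -d/2,
    \<nu> and 1 add up to 0.\<close>
  have "K * 2 = (2 * pi) powr (- (d / 2)) * (\<kappa> / norm z) powr \<nu>"
  proof -
    have "c powr (- \<nu>) = (1 / c) powr \<nu>"
      using c by (simp add: powr_minus powr_divide inverse_eq_divide)
    also have "1 / c = 2 * (\<kappa> / norm z)" using \<kappa> nz by (simp add: c_def)
    also have "\<dots> powr \<nu> = 2 powr \<nu> * (\<kappa> / norm z) powr \<nu>" by (rule powr_mult)
    finally have c': "c powr (- \<nu>) = 2 powr \<nu> * (\<kappa> / norm z) powr \<nu>" .
    have "(4 * pi) powr (- (d / 2)) = (2 * (2 * pi)) powr (- (d / 2))" by simp
    also have "\<dots> = 2 powr (- (d / 2)) * (2 * pi) powr (- (d / 2))" by (rule powr_mult)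
    finally have p: "(4 * pi) powr (- (d / 2)) = 2 powr (- (d / 2)) * (2 * pi) powr (- (d / 2))" .
    have "2 powr (- (d / 2)) * 2 powr \<nu> * 2 = (2::real) powr (- (d / 2) + \<nu> + 1)"
      unfolding powr_add by simp
    also have "\<dots> = 1" by (simp add: \<nu>_def)
    finally have two: "2 powr (- (d / 2)) * 2 powr \<nu> * 2 = (1::real)" .
    have "K * 2 = (2 powr (- (d / 2)) * 2 powr \<nu> * 2) * ((2 * pi) powr (- (d / 2)) * (\<kappa> / norm z) powr \<nu>)"
      unfolding K_def c' p by (simp only: mult_ac)
    then show ?thesis unfolding two by simp
  qed
  then have "mix \<kappa> d {0<..} 0 q = (2 * pi) powr (- (d / 2)) * (\<kappa> / norm z) powr \<nu> * bessel_K \<nu> r"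
    unfolding m by (metis mult.assoc)
  then show ?thesis
    by (simp add: yukawa_def Let_def d_def \<nu>_def r_def q_def)
qed

text \<open>Division by zero makes the middle factor \<open>0 powr \<nu>\<close>, which is 0 even in
  the plane, where \<nu> = 0.\<close>

lemma yukawa_zero: "yukawa \<kappa> (0::'a::euclidean_space) = 0"
  by (simp add: yukawa_def Let_def)

lemma has_derivative_radial:
  fixes z :: "'a::euclidean_space"
  assumes \<phi>: "(\<phi> has_real_derivative D) (at ((norm z)\<^sup>2))"
  shows "((\<lambda>x. \<phi> ((norm x)\<^sup>2)) has_derivative (\<lambda>h. 2 * D * (z \<bullet> h))) (at z)"
proof -
  have n: "((\<lambda>x::'a. (norm x)\<^sup>2) has_derivative (\<lambda>h. 2 * (z \<bullet> h))) (at z)"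
    unfolding power2_norm_eq_inner
    by (auto intro!: derivative_eq_intros simp: inner_commute)
  have "((\<lambda>x. \<phi> ((norm x)\<^sup>2)) has_derivative (\<lambda>h. D * (2 * (z \<bullet> h)))) (at z)"
    using has_derivative_compose[OF n \<phi>[unfolded has_field_derivative_def]] by simp
  then show ?thesis by (simp add: mult_ac)
qed

text \<open>Differentiating the mixture in the squared radius avoids recurrences for derivatives of
  Bessel functions. The Yukawa kernel agrees with the mixture on the open complement of the origin,
  which is enough for its derivative there.\<close>

lemma gradient_yukawa:
  fixes z :: "'a::euclidean_space"
  assumes \<kappa>: "0 < \<kappa>" and z: "z \<noteq> 0"
  shows "gradient (yukawa \<kappa>) z = (2 * mix \<kappa> (real DIM('a)) {0<..} 1 ((norm z)\<^sup>2)) *\<^sub>R z"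
proof -
  let ?D = "mix \<kappa> (real DIM('a)) {0<..} 1 ((norm z)\<^sup>2)"
  have reg: "regular {0<..} ((norm z)\<^sup>2)" using z by (auto simp: regular_def)
  have "((\<lambda>x. mix \<kappa> (real DIM('a)) {0<..} 0 ((norm x)\<^sup>2)) has_derivative (\<lambda>h. 2 * ?D * (z \<bullet> h))) (at z)"
    using mix_has_derivative[OF \<kappa> reg, of "real DIM('a)" 0] by (intro has_derivative_radial) simp
  then have "(yukawa \<kappa> has_derivative (\<lambda>h. 2 * ?D * (z \<bullet> h))) (at z)"
    by (rule has_derivative_transform_within_open[of _ _ _ _ "- {0}"]) (use z in \<open>auto simp: yukawa_eq_mix[OF \<kappa>]\<close>)
  then have "frechet_derivative (yukawa \<kappa>) (at z) = (\<lambda>h. 2 * ?D * (z \<bullet> h))"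
    by (rule frechet_derivative_at[symmetric])
  then have "gradient (yukawa \<kappa>) z = (\<Sum>b\<in>Basis. (2 * ?D) *\<^sub>R ((z \<bullet> b) *\<^sub>R b))"
    by (simp add: gradient_def)
  also have "\<dots> = (2 * ?D) *\<^sub>R z"
    by (simp only: scaleR_sum_right[symmetric] euclidean_representation)
  finally show ?thesis .
qed

section \<open>Truncation away from time zero\<close>

definition far :: "real \<Rightarrow> real \<Rightarrow> 'a::euclidean_space \<Rightarrow> real" where
  "far \<kappa> s z = mix \<kappa> (real DIM('a)) {s<..} 0 ((norm z)\<^sup>2)"

text \<open>The directional derivatives of \<open>far\<close>, written out by the chain rule for the
  squared norm: \<open>far1\<close> along b, and \<open>far2\<close> along b and then c.\<close>

definition far1 :: "real \<Rightarrow> real \<Rightarrow> 'a::euclidean_space \<Rightarrow> 'a \<Rightarrow> real" where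
  "far1 \<kappa> s b z = 2 * (z \<bullet> b) * mix \<kappa> (real DIM('a)) {s<..} 1 ((norm z)\<^sup>2)"

definition far2 :: "real \<Rightarrow> real \<Rightarrow> 'a::euclidean_space \<Rightarrow> 'a \<Rightarrow> 'a \<Rightarrow> real" where
  "far2 \<kappa> s b c z = 2 * (b \<bullet> c) * mix \<kappa> (real DIM('a)) {s<..} 1 ((norm z)\<^sup>2)
     + 4 * (z \<bullet> b) * (z \<bullet> c) * mix \<kappa> (real DIM('a)) {s<..} 2 ((norm z)\<^sup>2)"

lemma regular_greaterThan: "0 < s \<Longrightarrow> regular {s<..} ((norm z)\<^sup>2)"
  by (auto simp: regular_def intro!: exI[of _ s])

lemma far_nonneg [simp]: "0 \<le> far \<kappa> s z"
  by (simp add: far_def mix_0_nonneg)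

lemma far_minus [simp]: "far \<kappa> s (- z) = far \<kappa> s z"
  by (simp add: far_def)

lemma far1_minus [simp]: "far1 \<kappa> s b (- z) = - far1 \<kappa> s b z"
  by (simp add: far1_def)

lemma far2_commute: "far2 \<kappa> s b c z = far2 \<kappa> s c b z"
  by (simp add: far2_def inner_commute mult_ac)

lemma has_real_derivative_norm_power2_line:
  fixes z b :: "'a::real_inner"
  shows "((\<lambda>r. (norm (z + r *\<^sub>R b))\<^sup>2) has_real_derivative 2 * (z \<bullet> b)) (at 0)"
proof -
  have eq: "(norm (z + r *\<^sub>R b))\<^sup>2 = (norm z)\<^sup>2 + 2 * (z \<bullet> b) * r + (norm b)\<^sup>2 * (r * r)" for r
    unfolding power2_norm_eq_inner
    apply (simp only: inner_add_left inner_add_right inner_scaleR_left inner_scaleR_right inner_commute[of b z])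
    by algebra
  have d: "((\<lambda>r. (norm z)\<^sup>2 + 2 * (z \<bullet> b) * r + (norm b)\<^sup>2 * (r * r)) has_real_derivative
      2 * (z \<bullet> b)) (at 0)"
   apply (rule derivative_eq_intros refl)+
   apply simp
   done
  show ?thesis unfolding eq by (rule d)
qed

context
  fixes \<kappa> s :: real
  assumes \<kappa>: "0 < \<kappa>" and s: "0 < s"
begin

lemma mix_far_line_derivative:
  fixes z b :: "'a::euclidean_space"
  shows "((\<lambda>r. mix \<kappa> (real DIM('a)) {s<..} k ((norm (z + r *\<^sub>R b))\<^sup>2)) has_real_derivative
    2 * (z \<bullet> b) * mix \<kappa> (real DIM('a)) {s<..} (Suc k) ((norm z)\<^sup>2)) (at 0)"
proof -
  have "(mix \<kappa> (real DIM('a)) {s<..} k has_real_derivative mix \<kappa> (real DIM('a)) {s<..} (Suc k) ((norm z)\<^sup>2))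
     (at ((norm (z + 0 *\<^sub>R b))\<^sup>2))"
    using mix_has_derivative[OF \<kappa> regular_greaterThan[OF s, of z], of "real DIM('a)" k] by simp
  from DERIV_chain2[OF this has_real_derivative_norm_power2_line[of z b]]
  show ?thesis by (simp add: mult_ac)
qed

lemma far_line_derivative:
  fixes z b :: "'a::euclidean_space"
  shows "((\<lambda>r. far \<kappa> s (z + r *\<^sub>R b)) has_real_derivative far1 \<kappa> s b z) (at 0)"
  using mix_far_line_derivative[of 0 z b] by (simp add: far_def far1_def)

lemma far1_line_derivative:
  fixes z b c :: "'a::euclidean_space"
  shows "((\<lambda>r. far1 \<kappa> s b (z + r *\<^sub>R c)) has_real_derivative far2 \<kappa> s b c z) (at 0)"
proof -
  have i: "(z + r *\<^sub>R c) \<bullet> b = z \<bullet> b + r * (b \<bullet> c)" for r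
    by (simp add: inner_add_left inner_commute[of c b])
  have d: "((\<lambda>r. 2 * (z \<bullet> b + r * (b \<bullet> c))) has_real_derivative 2 * (b \<bullet> c)) (at 0)"
    by (rule derivative_eq_intros refl)+ simp
  have m: "((\<lambda>r. mix \<kappa> (real DIM('a)) {s<..} 1 ((norm (z + r *\<^sub>R c))\<^sup>2)) has_real_derivative
    2 * (z \<bullet> c) * mix \<kappa> (real DIM('a)) {s<..} 2 ((norm z)\<^sup>2)) (at 0)"
    using mix_far_line_derivative[of 1 z c] by (simp only: Suc_1)
  show ?thesis
    unfolding far1_def far2_def i
    by (rule DERIV_cong[OF DERIV_mult[OF d m]]) simp
qed

lemma continuous_mix_far: "continuous_on UNIV (\<lambda>z::'a::euclidean_space. mix \<kappa> (real DIM('a)) {s<..} k ((norm z)\<^sup>2))"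
proof -
  have c: "continuous_on {0..} (mix \<kappa> (real DIM('a)) {s<..} k)"
  proof (intro continuous_at_imp_continuous_on ballI)
    fix q :: real assume "q \<in> {0..}"
    then have "regular {s<..} q" using s by (auto simp: regular_def)
    then show "isCont (mix \<kappa> (real DIM('a)) {s<..} k) q"
      by (intro DERIV_isCont[OF mix_has_derivative[OF \<kappa>]]) auto
  qed
  show ?thesis
    by (rule continuous_on_compose2[OF c]) (auto intro!: continuous_intros)
qed

lemma continuous_far: "continuous_on UNIV (far \<kappa> s :: 'a::euclidean_space \<Rightarrow> real)"
  unfolding far_def[abs_def] by (rule continuous_mix_far)

lemma continuous_far1: "continuous_on UNIV (far1 \<kappa> s b :: 'a::euclidean_space \<Rightarrow> real)"
  unfolding far1_def[abs_def] by (intro continuous_intros continuous_mix_far)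

lemma continuous_far2: "continuous_on UNIV (far2 \<kappa> s b c :: 'a::euclidean_space \<Rightarrow> real)"
  unfolding far2_def[abs_def] by (intro continuous_intros continuous_mix_far)

lemma measurable_far: "(far \<kappa> s :: 'a::euclidean_space \<Rightarrow> real) \<in> borel_measurable borel"
  by (intro borel_measurable_continuous_onI continuous_far)

lemma measurable_far1: "(far1 \<kappa> s b :: 'a::euclidean_space \<Rightarrow> real) \<in> borel_measurable borel"
  by (intro borel_measurable_continuous_onI continuous_far1)

lemma measurable_far2: "(far2 \<kappa> s b c :: 'a::euclidean_space \<Rightarrow> real) \<in> borel_measurable borel"
  by (intro borel_measurable_continuous_onI continuous_far2)

section \<open>Integrable envelopes of the far kernel and its derivatives\<close>

lemma heat_le_heat_zero:
  assumes "s \<le> t"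
  shows "heat t (z::'a::euclidean_space) \<le> heat s (0::'a)"
proof -
  have "heat t z \<le> heat t (0::'a)" using s assms by (intro heat_le_zero) simp
  also have "\<dots> \<le> heat s (0::'a)"
    unfolding heat_zero using s assms by (intro powr_mono2') auto
  finally show ?thesis .
qed

text \<open>The far mixture with every heat time stretched by the factor m. It is the far kernel for
  m = 1; m = 2 dominates the derivatives, since absorbing powers of z doubles the time.\<close>

definition env :: "real \<Rightarrow> 'a::euclidean_space \<Rightarrow> real" where
  "env m z = (\<integral>t. indicator {s<..} t * heat (m * t) z \<partial>clock \<kappa>)"

lemma far_eq_env: "far \<kappa> s z = env 1 z"
  by (simp add: far_def env_def mix_def rad_0_heat)

lemma env_integrand_bound:
  assumes m: "1 \<le> m"
  shows "\<bar>indicator {s<..} t * heat (m * t) (z::'a::euclidean_space)\<bar> \<le> heat s (0::'a)"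
proof (cases "s < t")
  case True
  have "1 * t \<le> m * t" using m True s by (intro mult_right_mono) auto
  then show ?thesis using True by (auto intro!: heat_le_heat_zero)
qed simp

lemma integrable_env:
  assumes m: "1 \<le> m"
  shows "integrable (clock \<kappa>) (\<lambda>t. indicator {s<..} t * heat (m * t) (z::'a::euclidean_space))"
proof -
  interpret finite_measure "clock \<kappa>" using \<kappa> by (rule finite_measure_clock)
  show ?thesis
    using env_integrand_bound[OF m] by (intro integrable_const_bound[where B="heat s (0::'a)"]) auto
qed

lemma env_bounded:
  assumes m: "1 \<le> m"
  obtains B where "\<And>z::'a::euclidean_space. \<bar>env m z\<bar> \<le> B"
proof
  interpret finite_measure "clock \<kappa>" using \<kappa> by (rule finite_measure_clock)
  fix z :: 'a
  have "\<bar>env m z\<bar> \<le> (\<integral>t. \<bar>indicator {s<..} t * heat (m * t) z\<bar> \<partial>clock \<kappa>)"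
    unfolding env_def by (rule integral_abs_bound)
  also have "\<dots> \<le> (\<integral>t. heat s (0::'a) \<partial>clock \<kappa>)"
    using env_integrand_bound[OF m] integrable_abs[OF integrable_env[OF m, of z]]
    by (intro integral_mono) (auto simp del: abs_mult)
  finally show "\<bar>env m z\<bar> \<le> (\<integral>t. heat s (0::'a) \<partial>clock \<kappa>)" .
qed

lemma measurable_env [measurable]: "env m \<in> borel_measurable (borel :: 'a::euclidean_space measure)"
proof -
  interpret finite_measure "clock \<kappa>" using \<kappa> by (rule finite_measure_clock)
  show ?thesis unfolding env_def by measurable
qed

lemma env_nonneg: "0 \<le> env m z"
  unfolding env_def by (intro integral_nonneg_AE AE_I2) simp

text \<open>By Tonelli, since each heat kernel has mass one, the integral is at most the mass of
  \<open>clock\<close>.\<close>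

lemma integrable_lborel_env:
  assumes m: "1 \<le> m"
  shows "integrable lborel (env m :: 'a::euclidean_space \<Rightarrow> real)"
proof -
  interpret finite_measure "clock \<kappa>" using \<kappa> by (rule finite_measure_clock)
  interpret P: pair_sigma_finite lborel "clock \<kappa>" ..
  have *: "(\<integral>\<^sup>+z. ennreal (indicator {s<..} t * heat (m * t) (z::'a)) \<partial>lborel) \<le> 1" for t
    using m s by (cases "s < t") (auto simp: nn_integral_heat)
  have "(\<integral>\<^sup>+z. ennreal (norm (env m (z::'a))) \<partial>lborel) =
      (\<integral>\<^sup>+z. \<integral>\<^sup>+t. ennreal (indicator {s<..} t * heat (m * t) (z::'a)) \<partial>clock \<kappa> \<partial>lborel)"
  proof (intro nn_integral_cong)
    fix z :: 'a
    have "(\<integral>\<^sup>+t. ennreal (indicator {s<..} t * heat (m * t) z) \<partial>clock \<kappa>) = ennreal (env m z)"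
      unfolding env_def by (intro nn_integral_eq_integral integrable_env m AE_I2) simp
    then show "ennreal (norm (env m z)) = (\<integral>\<^sup>+t. ennreal (indicator {s<..} t * heat (m * t) z) \<partial>clock \<kappa>)"
      by (simp add: env_nonneg)
  qed
  also have "\<dots> = (\<integral>\<^sup>+t. \<integral>\<^sup>+z. ennreal (indicator {s<..} t * heat (m * t) (z::'a)) \<partial>lborel \<partial>clock \<kappa>)"
    by (rule P.Fubini'[symmetric]) measurable
  also have "\<dots> \<le> (\<integral>\<^sup>+t. 1 \<partial>clock \<kappa>)"
    by (intro nn_integral_mono *)
  also have "\<dots> < \<infinity>"
    using le_less_trans[OF emeasure_clock_le[OF \<kappa>] ennreal_less_top] by simp
  finally show ?thesis by (auto simp: integrable_iff_bounded)
qed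

text \<open>The time integrand of \<open>far1\<close>: on times beyond s it is the derivative of
  \<open>heat t\<close> along b. Exposing it allows a convolution to be computed under the time
  integral.\<close>

definition slope :: "'a::euclidean_space \<Rightarrow> 'a \<Rightarrow> real \<Rightarrow> real" where
  "slope b z t = indicator {s<..} t * (- (1 / 2) * ((z \<bullet> b) / t * heat t z))"

lemma measurable_slope [measurable (raw)]:
  assumes [measurable]: "f \<in> borel_measurable M" "g \<in> borel_measurable M"
  shows "(\<lambda>x. slope b (f x) (g x)) \<in> borel_measurable M"
  unfolding slope_def by measurable

lemma far1_eq_slope: "far1 \<kappa> s b z = (\<integral>t. slope b z t \<partial>clock \<kappa>)" for z :: "'a::euclidean_space"
proof -
  have "far1 \<kappa> s b z = (\<integral>t. 2 * (z \<bullet> b) * (indicator {s<..} t * rad (real DIM('a)) 1 ((norm z)\<^sup>2) t) \<partial>clock \<kappa>)"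
    by (simp add: far1_def mix_def)
  also have "\<dots> = (\<integral>t. slope b z t \<partial>clock \<kappa>)"
    by (intro Bochner_Integration.integral_cong)
      (simp_all add: slope_def rad_Suc rad_0_heat)
  finally show ?thesis .
qed

lemma slope_le:
  fixes z b :: "'a::euclidean_space"
  assumes b: "norm b = 1"
  shows "\<bar>slope b z t\<bar> \<le> 2 powr (real DIM('a) / 2) / sqrt s * (indicator {s<..} t * heat (2 * t) z)"
proof (cases "s < t")
  case True
  then have t: "0 < t" using s by simp
  have "\<bar>slope b z t\<bar> = 1 / (2 * t) * (\<bar>z \<bullet> b\<bar> * heat t z)"
    using True t by (simp add: slope_def abs_mult)
  also have "\<dots> \<le> 1 / (2 * t) * (norm z * heat t z)"
    using t Cauchy_Schwarz_ineq2[of z b] b by (intro mult_left_mono mult_right_mono) auto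
  also have "\<dots> \<le> 1 / (2 * t) * (2 * sqrt t * 2 powr (real DIM('a) / 2) * heat (2 * t) z)"
    using t by (intro mult_left_mono inner_le_norm_heat) auto
  also have "\<dots> = 2 powr (real DIM('a) / 2) / sqrt t * heat (2 * t) z"
    using t real_sqrt_mult_self[of t] by (simp add: field_simps)
  also have "\<dots> \<le> 2 powr (real DIM('a) / 2) / sqrt s * heat (2 * t) z"
    using True s by (intro mult_right_mono divide_left_mono) auto
  finally show ?thesis using True by simp
qed (simp add: slope_def)

lemma slope_bounded:
  fixes b :: "'a::euclidean_space"
  assumes b: "norm b = 1"
  obtains B where "\<And>z t. \<bar>slope b z t\<bar> \<le> B"
proof
  fix z :: 'a and t
  have "indicator {s<..} t * heat (2 * t) z \<le> heat s (0::'a)"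
    using env_integrand_bound[of 2 t z] by simp
  then show "\<bar>slope b z t\<bar> \<le> 2 powr (real DIM('a) / 2) / sqrt s * heat s (0::'a)"
    using s by (intro order_trans[OF slope_le[OF b]] mult_left_mono) auto
qed

lemma abs_far1_le:
  fixes z b :: "'a::euclidean_space"
  assumes b: "norm b = 1"
  shows "\<bar>far1 \<kappa> s b z\<bar> \<le> 2 powr (real DIM('a) / 2) / sqrt s * env 2 z"
proof -
  have "\<bar>far1 \<kappa> s b z\<bar> \<le> (\<integral>t. \<bar>slope b z t\<bar> \<partial>clock \<kappa>)"
    unfolding far1_eq_slope by (rule integral_abs_bound)
  also have "\<dots> \<le> (\<integral>t. 2 powr (real DIM('a) / 2) / sqrt s * (indicator {s<..} t * heat (2 * t) z) \<partial>clock \<kappa>)"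
    using slope_le[OF b] s by (intro integral_mono' integrable_mult_right integrable_env) auto
  finally show ?thesis by (simp add: env_def)
qed

text \<open>Two derivatives cost a factor 1/t \<le> 1/s. The term containing z twice is absorbed by
  doubling the time, the other one keeps its time; hence the two envelopes.\<close>

lemma abs_far2_le:
  fixes z b c :: "'a::euclidean_space"
  assumes b: "norm b = 1" and c: "norm c = 1"
  shows "\<bar>far2 \<kappa> s b c z\<bar> \<le> 1 / (2 * s) * env 1 z + 2 powr (real DIM('a) / 2) / s * env 2 z"
proof -
  let ?i = "\<lambda>t. indicator {s<..} t :: real" and ?D = "2 powr (real DIM('a) / 2)"
  have reg: "regular {s<..} ((norm z)\<^sup>2)" by (rule regular_greaterThan[OF s])
  have i: "integrable (clock \<kappa>) (\<lambda>t. x * (?i t * rad (real DIM('a)) k ((norm z)\<^sup>2) t))" for x k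
    by (rule integrable_mult_right, rule integrable_mix[OF \<kappa> reg]) simp
  have e: "far2 \<kappa> s b c z = (\<integral>t. 2 * (b \<bullet> c) * (?i t * rad (real DIM('a)) 1 ((norm z)\<^sup>2) t)
      + 4 * (z \<bullet> b) * (z \<bullet> c) * (?i t * rad (real DIM('a)) 2 ((norm z)\<^sup>2) t) \<partial>clock \<kappa>)"
    unfolding far2_def mix_def Bochner_Integration.integral_add[OF i i] integral_mult_right_zero by (rule refl)
  have "\<bar>far2 \<kappa> s b c z\<bar> \<le> (\<integral>t. \<bar>2 * (b \<bullet> c) * (?i t * rad (real DIM('a)) 1 ((norm z)\<^sup>2) t)
      + 4 * (z \<bullet> b) * (z \<bullet> c) * (?i t * rad (real DIM('a)) 2 ((norm z)\<^sup>2) t)\<bar> \<partial>clock \<kappa>)"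
    unfolding e by (rule integral_abs_bound)
  also have "\<dots> \<le> (\<integral>t. 1 / (2 * s) * (?i t * heat (1 * t) z) + ?D / s * (?i t * heat (2 * t) z) \<partial>clock \<kappa>)"
  proof (rule integral_mono')
    show "integrable (clock \<kappa>) (\<lambda>t. 1 / (2 * s) * (?i t * heat (1 * t) z) + ?D / s * (?i t * heat (2 * t) z))"
      by (intro Bochner_Integration.integrable_add integrable_mult_right integrable_env) auto
    show "0 \<le> 1 / (2 * s) * (?i t * heat (1 * t) z) + ?D / s * (?i t * heat (2 * t) z)" for t
      using s by simp
    fix t
    show "\<bar>2 * (b \<bullet> c) * (?i t * rad (real DIM('a)) 1 ((norm z)\<^sup>2) t)
      + 4 * (z \<bullet> b) * (z \<bullet> c) * (?i t * rad (real DIM('a)) 2 ((norm z)\<^sup>2) t)\<bar>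
      \<le> 1 / (2 * s) * (?i t * heat (1 * t) z) + ?D / s * (?i t * heat (2 * t) z)"
    proof (cases "s < t")
      case True
      then have t: "0 < t" using s by simp
      have bc: "\<bar>b \<bullet> c\<bar> \<le> 1" using Cauchy_Schwarz_ineq2[of b c] b c by simp
      have zz: "\<bar>(z \<bullet> b) * (z \<bullet> c)\<bar> \<le> (norm z)\<^sup>2"
        using Cauchy_Schwarz_ineq2[of z b] Cauchy_Schwarz_ineq2[of z c] b c
        by (auto simp: abs_mult power2_eq_square intro!: mult_mono)
      have r1: "2 * (b \<bullet> c) * rad (real DIM('a)) 1 ((norm z)\<^sup>2) t = - (b \<bullet> c) * (1 / (2 * t)) * heat t z"
        using t by (simp add: rad_Suc rad_0_heat)
      have r2: "4 * (z \<bullet> b) * (z \<bullet> c) * rad (real DIM('a)) 2 ((norm z)\<^sup>2) t = ((z \<bullet> b) * (z \<bullet> c)) * (1 / (2 * t)) * (1 / (2 * t) * heat t z)"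
        using t by (simp add: rad_2 rad_0_heat)
      have "\<bar>- (b \<bullet> c) * (1 / (2 * t)) * heat t z\<bar> \<le> 1 / (2 * s) * heat t z"
      proof -
        have "\<bar>- (b \<bullet> c) * (1 / (2 * t))\<bar> \<le> 1 * (1 / (2 * s))"
          unfolding abs_mult using bc t s True by (intro mult_mono) (auto intro!: divide_left_mono)
        then have "\<bar>- (b \<bullet> c) * (1 / (2 * t))\<bar> * heat t z \<le> 1 * (1 / (2 * s)) * heat t z"
          by (rule mult_right_mono) simp
        then show ?thesis by (simp add: abs_mult)
      qed
      moreover have "\<bar>((z \<bullet> b) * (z \<bullet> c)) * (1 / (2 * t)) * (1 / (2 * t) * heat t z)\<bar> \<le> ?D / s * heat (2 * t) z"
      proof -
        have "\<bar>((z \<bullet> b) * (z \<bullet> c)) * (1 / (2 * t)) * (1 / (2 * t) * heat t z)\<bar> =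
          \<bar>(z \<bullet> b) * (z \<bullet> c)\<bar> * (1 / (2 * t) * (1 / (2 * t) * heat t z))"
          using t by (simp add: abs_mult)
        also have "\<dots> \<le> (norm z)\<^sup>2 * (1 / (2 * t) * (1 / (2 * t) * heat t z))"
          using t by (intro mult_right_mono zz) auto
        also have "\<dots> = 1 / (2 * t) * ((norm z)\<^sup>2 / (2 * t) * heat t z)"
          by simp
        also have "\<dots> \<le> 1 / (2 * t) * (2 * ?D * heat (2 * t) z)"
          using t by (intro mult_left_mono inner_le_norm_heat) auto
        also have "\<dots> = ?D / t * heat (2 * t) z" by simp
        also have "\<dots> \<le> ?D / s * heat (2 * t) z"
          using True s by (intro mult_right_mono divide_left_mono) auto
        finally show ?thesis .
      qed
      ultimately have "\<bar>- (b \<bullet> c) * (1 / (2 * t)) * heat t z + ((z \<bullet> b) * (z \<bullet> c)) * (1 / (2 * t)) * (1 / (2 * t) * heat t z)\<bar>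
          \<le> 1 / (2 * s) * heat t z + ?D / s * heat (2 * t) z"
        by (intro order_trans[OF abs_triangle_ineq] add_mono)
      then show ?thesis using True unfolding r1[symmetric] r2[symmetric] by simp
    qed simp
  qed
  also have "\<dots> = 1 / (2 * s) * env 1 z + ?D / s * env 2 z"
    unfolding env_def using integrable_env[of 1 z] integrable_env[of 2 z] by simp
  finally show ?thesis .
qed

lemma far_bounded: obtains B where "\<And>z::'a::euclidean_space. \<bar>far \<kappa> s z\<bar> \<le> B"
  using env_bounded[of 1] unfolding far_eq_env by auto

lemma far1_bounded:
  assumes b: "norm (b::'a::euclidean_space) = 1"
  obtains B where "\<And>z. \<bar>far1 \<kappa> s b z\<bar> \<le> B"
proof -
  obtain B where B: "\<And>z::'a. \<bar>env 2 z\<bar> \<le> B" using env_bounded[of 2] by auto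
  have "\<bar>far1 \<kappa> s b z\<bar> \<le> 2 powr (real DIM('a) / 2) / sqrt s * B" for z
    using B[of z] s by (intro order_trans[OF abs_far1_le[OF b]] mult_left_mono) auto
  then show thesis by (rule that)
qed

lemma far2_bounded:
  assumes b: "norm (b::'a::euclidean_space) = 1" and c: "norm c = 1"
  obtains B where "\<And>z. \<bar>far2 \<kappa> s b c z\<bar> \<le> B"
proof -
  obtain B where B: "\<And>z::'a. \<bar>env 2 z\<bar> \<le> B" using env_bounded[of 2] by auto
  obtain B' where B': "\<And>z::'a. \<bar>env 1 z\<bar> \<le> B'" using env_bounded[of 1] by auto
  have "\<bar>far2 \<kappa> s b c z\<bar> \<le> 1 / (2 * s) * B' + 2 powr (real DIM('a) / 2) / s * B" for z
    using B[of z] B'[of z] s by (intro order_trans[OF abs_far2_le[OF b c]] add_mono mult_left_mono) auto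
  then show thesis by (rule that)
qed

lemma integrable_far: "integrable lborel (far \<kappa> s :: 'a::euclidean_space \<Rightarrow> real)"
  unfolding far_eq_env[abs_def] by (rule integrable_lborel_env) simp

lemma integrable_far1:
  assumes b: "norm (b::'a::euclidean_space) = 1"
  shows "integrable lborel (far1 \<kappa> s b)"
proof (rule Bochner_Integration.integrable_bound)
  show "integrable lborel (\<lambda>z::'a. 2 powr (real DIM('a) / 2) / sqrt s * env 2 z)"
    by (intro integrable_mult_right integrable_lborel_env) auto
  show "AE z in lborel. norm (far1 \<kappa> s b z) \<le> norm (2 powr (real DIM('a) / 2) / sqrt s * env 2 z)"
    using abs_far1_le[OF b] by (intro AE_I2) (metis real_norm_def abs_ge_self order_trans)
qed (simp add: measurable_far1)

lemma integrable_far2: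
  assumes b: "norm (b::'a::euclidean_space) = 1" and c: "norm c = 1"
  shows "integrable lborel (far2 \<kappa> s b c)"
proof (rule Bochner_Integration.integrable_bound)
  show "integrable lborel (\<lambda>z::'a. 1 / (2 * s) * env 1 z + 2 powr (real DIM('a) / 2) / s * env 2 z)"
    by (intro Bochner_Integration.integrable_add integrable_mult_right integrable_lborel_env) auto
  show "AE z in lborel. norm (far2 \<kappa> s b c z) \<le> norm (1 / (2 * s) * env 1 z + 2 powr (real DIM('a) / 2) / s * env 2 z)"
    using abs_far2_le[OF b c] by (intro AE_I2) (metis real_norm_def abs_ge_self order_trans)
qed (simp add: measurable_far2)

end

section \<open>Semigroup and Helmholtz identities of the far kernel\<close>

lemma clock_shift:
  fixes F :: "real \<Rightarrow> real"
  assumes s: "0 < s" and [measurable]: "F \<in> borel_measurable borel"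
  shows "(\<integral>t. indicator {s<..} t * F (s + t) \<partial>clock \<kappa>) =
    exp (\<kappa>\<^sup>2 * s) * (\<integral>t. indicator {2 * s<..} t * F t \<partial>clock \<kappa>)"
proof -
  let ?g = "\<lambda>t. indicator {0<..} t * exp (- (\<kappa>\<^sup>2 * t)) * (indicator {2 * s<..} t * F t)"
  have "exp (\<kappa>\<^sup>2 * s) * (\<integral>t. indicator {2 * s<..} t * F t \<partial>clock \<kappa>) = exp (\<kappa>\<^sup>2 * s) * (LBINT t. ?g t)"
    by (subst integral_clock) auto
  \<comment> \<open>The mixture is re-indexed by the total time s + t. Times beyond s become times
    beyond 2s, and the weight exp (-\<kappa>^2 t) exceeds the weight at the total time by the factor
    exp (\<kappa>^2 s).\<close>
  also have "(LBINT t. ?g t) = (LBINT t. ?g (s + t))"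
    using lborel_integral_real_affine[of 1 ?g s] by simp
  also have "exp (\<kappa>\<^sup>2 * s) * (LBINT t. ?g (s + t)) = (LBINT t. exp (\<kappa>\<^sup>2 * s) * ?g (s + t))"
    by (rule integral_mult_right_zero[symmetric])
  also have "\<dots> = (LBINT t. indicator {0<..} t * exp (- (\<kappa>\<^sup>2 * t)) * (indicator {s<..} t * F (s + t)))"
  proof (rule Bochner_Integration.integral_cong[OF refl])
    fix t
    have "exp (\<kappa>\<^sup>2 * s) * exp (- (\<kappa>\<^sup>2 * (s + t))) = exp (- (\<kappa>\<^sup>2 * t))"
      by (simp add: distrib_left flip: exp_add)
    then show "exp (\<kappa>\<^sup>2 * s) * ?g (s + t) = indicator {0<..} t * exp (- (\<kappa>\<^sup>2 * t)) * (indicator {s<..} t * F (s + t))"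
      using s by (auto simp: indicator_def)
  qed
  also have "\<dots> = (\<integral>t. indicator {s<..} t * F (s + t) \<partial>clock \<kappa>)"
    by (subst integral_clock) auto
  finally show ?thesis by simp
qed

text \<open>For a function \<phi> of q = |x|^2 the Laplacian is 2d \<phi>' + 4q \<phi>''. So this is
  the heat equation for exp (-\<kappa>^2 t) p_t, with \<kappa>^2 as killing rate.\<close>

lemma rad_heat_equation:
  fixes d q :: real
  assumes t: "0 < t"
  shows "((\<lambda>t. exp (- (\<kappa>\<^sup>2 * t)) * rad d 0 q t) has_real_derivative
    exp (- (\<kappa>\<^sup>2 * t)) * (2 * d * rad d 1 q t + 4 * q * rad d 2 q t - \<kappa>\<^sup>2 * rad d 0 q t)) (at t)"
proof -
  \<comment> \<open>Written as a single exponential, the function has an elementary logarithmic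
    derivative in t.\<close>
  let ?P = "\<lambda>t. exp (- (\<kappa>\<^sup>2 * t) - d / 2 * ln (4 * pi * t) - q / (4 * t))"
  have P: "exp (- (\<kappa>\<^sup>2 * t)) * rad d 0 q t = ?P t" if "0 < t" for t
    using that by (simp add: rad_def powr_def mult_exp_exp algebra_simps)
  have "(?P has_real_derivative ?P t * (- \<kappa>\<^sup>2 - d / 2 * (1 / t) + q / (4 * t\<^sup>2))) (at t)"
  proof (rule DERIV_fun_exp)
    show "((\<lambda>t. - (\<kappa>\<^sup>2 * t) - d / 2 * ln (4 * pi * t) - q / (4 * t)) has_real_derivative
      - \<kappa>\<^sup>2 - d / 2 * (1 / t) + q / (4 * t\<^sup>2)) (at t)"
      using t by (auto intro!: derivative_eq_intros simp: power2_eq_square field_simps)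
  qed
  then have D: "((\<lambda>t. exp (- (\<kappa>\<^sup>2 * t)) * rad d 0 q t) has_real_derivative
     ?P t * (- \<kappa>\<^sup>2 - d / 2 * (1 / t) + q / (4 * t\<^sup>2))) (at t)"
    by (rule has_field_derivative_transform_within_open[where S="{0<..}"]) (use t P in auto)
  have "?P t * (- \<kappa>\<^sup>2 - d / 2 * (1 / t) + q / (4 * t\<^sup>2)) =
     exp (- (\<kappa>\<^sup>2 * t)) * (2 * d * rad d 1 q t + 4 * q * rad d 2 q t - \<kappa>\<^sup>2 * rad d 0 q t)"
    unfolding P[OF t, symmetric] using t by (simp add: rad_2 rad_Suc power2_eq_square field_simps)
  with D show ?thesis by simp
qed

text \<open>The heat equation integrated over t > s. The boundary term at infinity vanishes because
  of the screening, and the one at s remains as a Gaussian.\<close>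

lemma mix_helmholtz:
  fixes d q :: real
  assumes \<kappa>: "0 < \<kappa>" and s: "0 < s" and d: "0 \<le> d" and q: "0 \<le> q"
  shows "2 * d * mix \<kappa> d {s<..} 1 q + 4 * q * mix \<kappa> d {s<..} 2 q =
    \<kappa>\<^sup>2 * mix \<kappa> d {s<..} 0 q - exp (- (\<kappa>\<^sup>2 * s)) * rad d 0 q s"
proof -
  have reg: "regular {s<..} q" using s q by (auto simp: regular_def intro!: exI[of _ s])
  let ?i = "\<lambda>t. indicator {s<..} t :: real"
  let ?P = "\<lambda>t. exp (- (\<kappa>\<^sup>2 * t)) * rad d 0 q t"
  let ?P' = "\<lambda>t. exp (- (\<kappa>\<^sup>2 * t)) * (2 * d * rad d 1 q t + 4 * q * rad d 2 q t - \<kappa>\<^sup>2 * rad d 0 q t)"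
  let ?Q = "\<lambda>t. 2 * d * (?i t * rad d 1 q t) + 4 * q * (?i t * rad d 2 q t) - \<kappa>\<^sup>2 * (?i t * rad d 0 q t)"
  have i: "integrable (clock \<kappa>) (\<lambda>t. x * (?i t * rad d k q t))" for x k
    by (rule integrable_mult_right, rule integrable_mix[OF \<kappa> reg d])
  have iQ: "integrable (clock \<kappa>) ?Q"
    by (intro Bochner_Integration.integrable_add Bochner_Integration.integrable_diff i)
  have Q: "(\<integral>t. ?Q t \<partial>clock \<kappa>) = 2 * d * mix \<kappa> d {s<..} 1 q + 4 * q * mix \<kappa> d {s<..} 2 q - \<kappa>\<^sup>2 * mix \<kappa> d {s<..} 0 q"
    unfolding Bochner_Integration.integral_diff[OF Bochner_Integration.integrable_add[OF i i] i]
      Bochner_Integration.integral_add[OF i i] integral_mult_right_zero mix_def by (rule refl)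
  have Qm: "?Q \<in> borel_measurable borel" by measurable
  have QP: "indicator {0<..} t * exp (- (\<kappa>\<^sup>2 * t)) * ?Q t = indicator {s<..} t *\<^sub>R ?P' t" for t
    using s by (auto simp: indicator_def)
  have iP: "set_integrable lborel (einterval (ereal s) \<infinity>) ?P'"
    using iQ unfolding integrable_clock_iff[OF Qm] QP by (simp add: set_integrable_def)
  have cont: "isCont (\<lambda>t. rad d k q t) t" if "0 < t" for t k
    unfolding rad_def using that by (intro continuous_intros) auto
  have "(LBINT t=ereal s..\<infinity>. ?P' t) = 0 - ?P s"
  proof (rule interval_integral_FTC_integrable[where F="?P"])
    show "ereal s < \<infinity>" by simp
    show "(?P has_vector_derivative ?P' t) (at t)" if "ereal s < ereal t" for t
      using rad_heat_equation[of t \<kappa> d q] that s by (simp add: has_real_derivative_iff_has_vector_derivative)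
    show "isCont ?P' t" if "ereal s < ereal t" for t
      using that s by (intro continuous_intros cont) auto
    show "set_integrable lborel (einterval (ereal s) \<infinity>) ?P'" by (rule iP)
    have "isCont ?P s" using s by (intro continuous_intros cont) auto
    then have "(?P \<longlongrightarrow> ?P s) (at_right s)"
      unfolding isCont_def by (rule filterlim_mono) (auto intro: at_le)
    then show "((?P \<circ> real_of_ereal) \<longlongrightarrow> ?P s) (at_right (ereal s))"
      by (simp add: ereal_tendsto_simps)
    have "(?P \<longlongrightarrow> 0) at_top"
    proof (rule Lim_null_comparison)
      have e: "((\<lambda>t. exp (- (\<kappa>\<^sup>2 * t))) \<longlongrightarrow> 0) at_top"
        using \<kappa> by (intro filterlim_compose[OF exp_at_bot] filterlim_uminus_at_bot_at_top[THEN filterlim_compose]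
          filterlim_tendsto_pos_mult_at_top[OF tendsto_const] filterlim_ident) auto
      show "((\<lambda>t. exp (- (\<kappa>\<^sup>2 * t)) * (4 * pi * s) powr (- (d / 2))) \<longlongrightarrow> 0) at_top"
        using tendsto_mult_right[OF e] by simp
      show "\<forall>\<^sub>F t in at_top. norm (?P t) \<le> exp (- (\<kappa>\<^sup>2 * t)) * (4 * pi * s) powr (- (d / 2))"
        using eventually_gt_at_top[of s]
      proof eventually_elim
        case (elim t)
        have "(4 * pi * t) powr (- (d / 2)) \<le> (4 * pi * s) powr (- (d / 2))"
          using elim s d by (intro powr_mono2') auto
        moreover have "exp (- (q / (4 * t))) \<le> 1" using q elim s by simp
        ultimately have "(4 * pi * t) powr (- (d / 2)) * exp (- (q / (4 * t))) \<le> (4 * pi * s) powr (- (d / 2)) * 1"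
          by (intro mult_mono) auto
        then have "rad d 0 q t \<le> (4 * pi * s) powr (- (d / 2)) * 1"
          by (simp add: rad_def)
        then show ?case by (simp add: rad_def abs_mult mult_left_mono)
      qed
    qed
    then show "((?P \<circ> real_of_ereal) \<longlongrightarrow> 0) (at_left \<infinity>)"
      by (simp add: ereal_tendsto_simps)
  qed
  also have "(LBINT t=ereal s..\<infinity>. ?P' t) = (\<integral>t. ?Q t \<partial>clock \<kappa>)"
    unfolding integral_clock[OF Qm] QP interval_integral_to_infinity_eq set_lebesgue_integral_def by (rule refl)
  finally show ?thesis unfolding Q by simp
qed

text \<open>The sum on the left is the Laplacian. Truncation thus replaces the point source of the
  Yukawa kernel by the Gaussian exp (-\<kappa>^2 s) p_s.\<close>

lemma far_helmholtz:
  fixes z :: "'a::euclidean_space"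
  assumes \<kappa>: "0 < \<kappa>" and s: "0 < s"
  shows "(\<Sum>b\<in>Basis. far2 \<kappa> s b b z) = \<kappa>\<^sup>2 * far \<kappa> s z - exp (- (\<kappa>\<^sup>2 * s)) * heat s z"
proof -
  let ?m = "\<lambda>k. mix \<kappa> (real DIM('a)) {s<..} k ((norm z)\<^sup>2)"
  have n: "(\<Sum>b\<in>Basis. (z \<bullet> b) * (z \<bullet> b)) = (norm z)\<^sup>2"
    by (simp only: euclidean_inner[of z z, symmetric] power2_norm_eq_inner)
  have "(\<Sum>b\<in>Basis. far2 \<kappa> s b b z) = (\<Sum>b\<in>(Basis::'a set). 2 * ?m 1 + (z \<bullet> b) * (z \<bullet> b) * (4 * ?m 2))"
    by (intro sum.cong) (auto simp: far2_def inner_same_Basis)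
  also have "\<dots> = 2 * real DIM('a) * ?m 1 + 4 * (norm z)\<^sup>2 * ?m 2"
    unfolding sum.distrib sum_distrib_right[symmetric] n by simp
  also have "\<dots> = \<kappa>\<^sup>2 * far \<kappa> s z - exp (- (\<kappa>\<^sup>2 * s)) * heat s z"
    unfolding far_def rad_0_heat[symmetric] by (rule mix_helmholtz[OF \<kappa> s]) auto
  finally show ?thesis .
qed

text \<open>Convolution with \<open>heat s\<close> adds s to every time of the mixture, and
  \<open>clock_shift\<close> re-indexes it. The factor exp (\<kappa>^2 s) later cancels the one in
  the source \<open>f\<close>.\<close>

lemma heat_convolution_far:
  fixes a b :: "'a::euclidean_space"
  assumes \<kappa>: "0 < \<kappa>" and s: "0 < s"
  shows "(LBINT x. heat s (x - a) * far \<kappa> s (x - b)) = exp (\<kappa>\<^sup>2 * s) * far \<kappa> (2 * s) (a - b)"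
proof -
  have i: "integrable lborel (\<lambda>x. heat s (x - a))"
    using integrable_lborel_diff[OF integrable_heat[OF s, where ?'a='a], of a] .
  have "(LBINT x. heat s (x - a) * far \<kappa> s (x - b)) =
     (LBINT x. heat s (x - a) * (\<integral>t. indicator {s<..} t * heat (1 * t) (x - b) \<partial>clock \<kappa>))"
    by (simp add: far_eq_env[OF \<kappa> s] env_def[OF \<kappa> s])
  also have "\<dots> = (\<integral>t. (LBINT x. heat s (x - a) * (indicator {s<..} t * heat (1 * t) (x - b))) \<partial>clock \<kappa>)"
    by (rule fubini_bounded_kernel(1)[OF finite_measure_clock[OF \<kappa>] i _ env_integrand_bound[OF \<kappa> s]]) auto
  also have "\<dots> = (\<integral>t. indicator {s<..} t * heat (s + t) (a - b) \<partial>clock \<kappa>)"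
  proof (rule Bochner_Integration.integral_cong[OF refl])
    fix t
    show "(LBINT x. heat s (x - a) * (indicator {s<..} t * heat (1 * t) (x - b))) = indicator {s<..} t * heat (s + t) (a - b)"
      using heat_convolution[OF s, of t a b] s by (cases "s < t") auto
  qed
  also have "\<dots> = exp (\<kappa>\<^sup>2 * s) * (\<integral>t. indicator {2 * s<..} t * heat t (a - b) \<partial>clock \<kappa>)"
    by (rule clock_shift[OF s]) measurable
  finally show ?thesis
    using s by (simp add: far_eq_env[OF \<kappa>] env_def[OF \<kappa>])
qed

lemma heat_convolution_far1:
  fixes a b e :: "'a::euclidean_space"
  assumes \<kappa>: "0 < \<kappa>" and s: "0 < s" and e: "norm e = 1"
  shows "(LBINT x. heat s (x - a) * far1 \<kappa> s e (x - b)) = exp (\<kappa>\<^sup>2 * s) * far1 \<kappa> (2 * s) e (a - b)"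
proof -
  have s2: "0 < 2 * s" using s by simp
  have i: "integrable lborel (\<lambda>x. heat s (x - a))"
    using integrable_lborel_diff[OF integrable_heat[OF s, where ?'a='a], of a] .
  obtain B where B: "\<And>z t. \<bar>slope s e z t\<bar> \<le> B" using slope_bounded[OF \<kappa> s e] by auto
  have "(LBINT x. heat s (x - a) * far1 \<kappa> s e (x - b)) =
     (LBINT x. heat s (x - a) * (\<integral>t. slope s e (x - b) t \<partial>clock \<kappa>))"
    by (simp add: far1_eq_slope[OF \<kappa> s])
  also have "\<dots> = (\<integral>t. (LBINT x. heat s (x - a) * slope s e (x - b) t) \<partial>clock \<kappa>)"
    by (rule fubini_bounded_kernel(1)[OF finite_measure_clock[OF \<kappa>] i _ B]) (use measurable_slope[OF \<kappa> s] in measurable)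
  also have "\<dots> = (\<integral>t. indicator {s<..} t * (- (1 / 2) * (((a - b) \<bullet> e) / (s + t) * heat (s + t) (a - b))) \<partial>clock \<kappa>)"
  proof (rule Bochner_Integration.integral_cong[OF refl])
    fix t
    show "(LBINT x. heat s (x - a) * slope s e (x - b) t) =
      indicator {s<..} t * (- (1 / 2) * (((a - b) \<bullet> e) / (s + t) * heat (s + t) (a - b)))"
    proof (cases "s < t")
      case True
      then have "(LBINT x. heat s (x - a) * slope s e (x - b) t) =
         (LBINT x. - (1 / 2) * (heat s (x - a) * (((x - b) \<bullet> e) / t * heat t (x - b))))"
        by (intro Bochner_Integration.integral_cong) (auto simp: slope_def[OF \<kappa> s])
      also have "\<dots> = - (1 / 2) * (((a - b) \<bullet> e) / (s + t) * heat (s + t) (a - b))"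
        unfolding integral_mult_right_zero using True s by (subst heat_convolution_inner) auto
      finally show ?thesis using True by simp
    qed (simp add: slope_def[OF \<kappa> s])
  qed
  also have "\<dots> = exp (\<kappa>\<^sup>2 * s) * (\<integral>t. indicator {2 * s<..} t * (- (1 / 2) * (((a - b) \<bullet> e) / t * heat t (a - b))) \<partial>clock \<kappa>)"
    by (rule clock_shift[OF s]) measurable
  finally show ?thesis
    by (simp add: far1_eq_slope[OF \<kappa> s2] slope_def[OF \<kappa> s2])
qed

section \<open>The stress tensor of a regularized potential\<close>

lemma lipschitz_borel_measurable:
  fixes v :: "'a::euclidean_space \<Rightarrow> real"
  assumes lip: "\<And>x y. \<bar>v x - v y\<bar> \<le> L * norm (x - y)"
  shows "v \<in> borel_measurable borel"
proof -
  have "0 \<le> L" using lip[of "SOME b. b \<in> Basis" 0] by (simp add: order_trans[OF abs_ge_zero])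
  then have "L-lipschitz_on UNIV v"
    using lip by (intro lipschitz_onI) (auto simp: dist_real_def dist_norm)
  then show ?thesis
    by (intro borel_measurable_continuous_onI lipschitz_on_continuous_on)
qed

lemma integrable_mult_bounded:
  fixes f g :: "'b \<Rightarrow> real"
  assumes g: "integrable M g" and [measurable]: "f \<in> borel_measurable M" and B: "\<And>x. \<bar>f x\<bar> \<le> B"
  shows "integrable M (\<lambda>x. f x * g x)"
proof (rule Bochner_Integration.integrable_bound)
  show "integrable M (\<lambda>x. B * g x)" using g by simp
  show "(\<lambda>x. f x * g x) \<in> borel_measurable M" using g by measurable
  have "0 \<le> B" using B[of undefined] by linarith
  then show "AE x in M. norm (f x * g x) \<le> norm (B * g x)"
    using B by (auto simp: abs_mult intro!: mult_right_mono)
qed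

text \<open>The algebra in which all integrations by parts below take place.\<close>

definition nice :: "('a::euclidean_space \<Rightarrow> real) \<Rightarrow> bool" where
  "nice f \<longleftrightarrow> continuous_on UNIV f \<and> (\<exists>B. \<forall>x. \<bar>f x\<bar> \<le> B) \<and> integrable lborel f"

lemma nice_mult:
  assumes "nice f" "nice g"
  shows "nice (\<lambda>x. f x * g x)"
proof -
  obtain B B' where B: "\<And>x. \<bar>f x\<bar> \<le> B" and B': "\<And>x. \<bar>g x\<bar> \<le> B'"
    using assms by (auto simp: nice_def)
  have "\<bar>f x * g x\<bar> \<le> B * B'" for x
    unfolding abs_mult using B[of x] B'[of x] by (intro mult_mono) auto
  moreover have "integrable lborel (\<lambda>x. f x * g x)"
    using assms B by (intro integrable_mult_bounded[where B=B]) (auto simp: nice_def)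
  ultimately show ?thesis using assms by (auto simp: nice_def intro!: continuous_on_mult)
qed

lemma nice_add: "nice f \<Longrightarrow> nice g \<Longrightarrow> nice (\<lambda>x. f x + g x)"
  unfolding nice_def
proof (safe intro!: continuous_on_add)
  fix B B' :: real assume "\<forall>x. \<bar>f x\<bar> \<le> B" "\<forall>x. \<bar>g x\<bar> \<le> B'"
  then have "\<bar>f x + g x\<bar> \<le> B + B'" for x by (intro order_trans[OF abs_triangle_ineq add_mono]) auto
  then show "\<exists>B. \<forall>x. \<bar>f x + g x\<bar> \<le> B" by blast
qed auto

lemma nice_integrable: "nice f \<Longrightarrow> integrable lborel f"
  by (simp add: nice_def)

lemma nice_measurable: "nice f \<Longrightarrow> f \<in> borel_measurable borel"
  by (simp add: nice_def borel_measurable_continuous_onI)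

text \<open>The form in which each entry of the stress tensor is treated: the derivative of a
  product is tested against v. With v = 1 and L = 0 the right side vanishes and exact integration by
  parts results.\<close>

lemma nice_integral_by_parts:
  fixes F G F' G' v :: "'a::euclidean_space \<Rightarrow> real"
  assumes "nice F" "nice G" "nice F'" "nice G'"
    and F: "\<And>x. ((\<lambda>r. F (x + r *\<^sub>R b)) has_real_derivative F' x) (at 0)"
    and G: "\<And>x. ((\<lambda>r. G (x + r *\<^sub>R b)) has_real_derivative G' x) (at 0)"
    and v: "\<And>x. \<bar>v x\<bar> \<le> V" "\<And>x y. \<bar>v x - v y\<bar> \<le> L * norm (x - y)" and b: "norm b = 1"
  shows "\<bar>\<integral>x. v x * (F' x * G x + F x * G' x) \<partial>lborel\<bar> \<le> L * (LBINT x. \<bar>F x * G x\<bar>)"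
proof (rule lipschitz_integral_by_parts[OF _ _ _ _ _ v b])
  have n: "nice (\<lambda>x. F' x * G x + F x * G' x)"
    by (intro nice_add nice_mult assms)
  then show "continuous_on UNIV (\<lambda>x. F' x * G x + F x * G' x)" "integrable lborel (\<lambda>x. F' x * G x + F x * G' x)"
    by (auto simp: nice_def)
  show "integrable lborel (\<lambda>x. F x * G x)" by (intro nice_integrable nice_mult assms)
  show "v \<in> borel_measurable borel" by (rule lipschitz_borel_measurable[OF v(2)])
  show "((\<lambda>r. F (x + r *\<^sub>R b) * G (x + r *\<^sub>R b)) has_real_derivative F' x * G x + F x * G' x) (at 0)" for x
    using DERIV_mult[OF F[of x] G[of x]] by (simp add: mult.commute add.commute)
qed

section \<open>Pairings of a charge and its regularized potential\<close>

context charge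
begin

text \<open>Unlike \<open>offdiag_square\<close>, this includes the diagonal. It is applied to
  kernels that are finite there, and it is the form in which positive definiteness can be
  used.\<close>

definition pairing :: "('a \<Rightarrow> 'a \<Rightarrow> real) \<Rightarrow> real" where
  "pairing k = (\<integral>a. (\<integral>b. k (pos a) (pos b) * w b \<partial>M) * w a \<partial>M)"

definition total_variation_pairing :: "('a \<Rightarrow> 'a \<Rightarrow> real) \<Rightarrow> real" where
  "total_variation_pairing k = (\<integral>a. (\<integral>b. k (pos a) (pos b) * \<bar>w b\<bar> \<partial>M) * \<bar>w a\<bar> \<partial>M)"

lemma nice_conv:
  assumes "nice g"
  shows "nice (conv g)"
proof -
  obtain B where B: "\<And>x. \<bar>g x\<bar> \<le> B" using assms by (auto simp: nice_def)
  have [measurable]: "g \<in> borel_measurable borel" using assms by (rule nice_measurable)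
  show ?thesis
    unfolding nice_def
  proof (intro conjI exI allI)
    show "continuous_on UNIV (conv g)" using assms by (intro continuous_conv[OF _ B]) (simp add: nice_def)
    show "\<bar>conv g x\<bar> \<le> B * W * measure M (space M)" for x by (rule conv_bounded[OF _ B]) measurable
    show "integrable lborel (conv g)" using assms by (intro integrable_conv) (simp add: nice_def)
  qed
qed

lemma nice_conv_derivative:
  assumes "nice g" "nice g'" "\<And>z. ((\<lambda>r. g (z + r *\<^sub>R b)) has_real_derivative g' z) (at 0)"
  shows "((\<lambda>r. conv g (x + r *\<^sub>R b)) has_real_derivative conv g' x) (at 0)"
proof -
  obtain B B' where B: "\<And>x. \<bar>g x\<bar> \<le> B" and B': "\<And>x. \<bar>g' x\<bar> \<le> B'" using assms(1,2) by (auto simp: nice_def)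
  show ?thesis
    by (rule conv_has_derivative[OF _ _ B B' assms(3)]) (intro nice_measurable assms)+
qed

end

context
  fixes \<kappa> s :: real
  assumes \<kappa>: "0 < \<kappa>" and s: "0 < s"
begin

lemma nice_far: "nice (far \<kappa> s :: 'a::euclidean_space \<Rightarrow> real)"
proof -
  obtain B where "\<And>z::'a. \<bar>far \<kappa> s z\<bar> \<le> B" by (rule far_bounded[OF \<kappa> s]) blast
  then show ?thesis
    unfolding nice_def by (intro conjI exI[of _ B] allI continuous_far integrable_far \<kappa> s)
qed

lemma nice_far1:
  assumes b: "norm (b::'a::euclidean_space) = 1"
  shows "nice (far1 \<kappa> s b)"
proof -
  obtain B where "\<And>z. \<bar>far1 \<kappa> s b z\<bar> \<le> B" by (rule far1_bounded[OF \<kappa> s b]) blast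
  then show ?thesis
    unfolding nice_def by (intro conjI exI[of _ B] allI continuous_far1 integrable_far1 \<kappa> s b)
qed

lemma nice_far2:
  assumes b: "norm (b::'a::euclidean_space) = 1" and c: "norm c = 1"
  shows "nice (far2 \<kappa> s b c)"
proof -
  obtain B where "\<And>z. \<bar>far2 \<kappa> s b c z\<bar> \<le> B" by (rule far2_bounded[OF \<kappa> s b c]) blast
  then show ?thesis
    unfolding nice_def by (intro conjI exI[of _ B] allI continuous_far2 integrable_far2 \<kappa> s b c)
qed

end

locale screened_charge = charge M pos w W for M :: "'b measure" and pos :: "'b \<Rightarrow> 'a::euclidean_space" and w W +
  fixes \<kappa> s :: real
  assumes \<kappa>: "0 < \<kappa>" and s: "0 < s"
begin

text \<open>\<open>h\<close> is the potential of the charge under the kernel truncated at s, and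
  \<open>h1\<close>, \<open>h2\<close> are its first and second derivatives. \<open>f\<close> is the
  charge smoothed by \<open>heat s\<close>, normalized so that it is the source of \<open>h\<close>
  in the screened Poisson equation.\<close>

definition h where "h = conv (far \<kappa> s)"
definition h1 where "h1 b = conv (far1 \<kappa> s b)"
definition h2 where "h2 b c = conv (far2 \<kappa> s b c)"
definition f where "f x = exp (- (\<kappa>\<^sup>2 * s)) * conv (heat s) x"

lemma nice_h: "nice h" unfolding h_def by (intro nice_conv nice_far \<kappa> s)
lemma nice_h1: "b \<in> Basis \<Longrightarrow> nice (h1 b)" unfolding h1_def by (intro nice_conv nice_far1 \<kappa> s) auto
lemma nice_h2: "b \<in> Basis \<Longrightarrow> c \<in> Basis \<Longrightarrow> nice (h2 b c)"
  unfolding h2_def by (intro nice_conv nice_far2 \<kappa> s) auto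

lemma h_derivative: "b \<in> Basis \<Longrightarrow> ((\<lambda>r. h (x + r *\<^sub>R b)) has_real_derivative h1 b x) (at 0)"
  unfolding h_def h1_def
  by (intro nice_conv_derivative nice_far nice_far1 far_line_derivative \<kappa> s) auto

lemma h1_derivative:
  "b \<in> Basis \<Longrightarrow> c \<in> Basis \<Longrightarrow> ((\<lambda>r. h1 b (x + r *\<^sub>R c)) has_real_derivative h2 b c x) (at 0)"
  unfolding h1_def h2_def
  by (intro nice_conv_derivative nice_far1 nice_far2 far1_line_derivative \<kappa> s) auto

lemma h2_commute: "h2 b c = h2 c b"
proof -
  have "far2 \<kappa> s b c = far2 \<kappa> s c b" by (rule ext) (rule far2_commute)
  then show ?thesis by (simp only: h2_def)
qed

lemma heat_bounded: "0 < t \<Longrightarrow> \<bar>heat t (z::'a)\<bar> \<le> heat t (0::'a)"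
  using heat_le_zero[of t z] by simp

lemma helmholtz: "f x = \<kappa>\<^sup>2 * h x - (\<Sum>b\<in>Basis. h2 b b x)"
proof -
  obtain B where B: "\<And>z::'a. \<bar>far \<kappa> s z\<bar> \<le> B" using far_bounded[OF \<kappa> s] by auto
  have i: "integrable M (\<lambda>a. far \<kappa> s (x - pos a) * w a)"
    by (rule integrable_conv_kernel[OF measurable_far[OF \<kappa> s] B])
  have i2: "integrable M (\<lambda>a. far2 \<kappa> s b b (x - pos a) * w a)" if b: "b \<in> Basis" for b
  proof -
    obtain B where "\<And>z. \<bar>far2 \<kappa> s b b z\<bar> \<le> B" using far2_bounded[OF \<kappa> s, of b b] b by auto
    then show ?thesis by (rule integrable_conv_kernel[OF measurable_far2[OF \<kappa> s]])
  qed
  have "(\<Sum>b\<in>Basis. h2 b b x) = (\<integral>a. (\<Sum>b\<in>Basis. far2 \<kappa> s b b (x - pos a) * w a) \<partial>M)"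
    unfolding h2_def conv_def using i2 by simp
  also have "\<dots> = (\<integral>a. \<kappa>\<^sup>2 * (far \<kappa> s (x - pos a) * w a) - exp (- (\<kappa>\<^sup>2 * s)) * (heat s (x - pos a) * w a) \<partial>M)"
    by (intro Bochner_Integration.integral_cong refl)
      (simp add: sum_distrib_right[symmetric] far_helmholtz[OF \<kappa> s] left_diff_distrib)
  also have "\<dots> = \<kappa>\<^sup>2 * h x - f x"
  proof -
    have "integrable M (\<lambda>a. heat s (x - pos a) * w a)"
      by (rule integrable_conv_kernel[OF _ heat_bounded[OF s]]) measurable
    then show ?thesis
      using i unfolding h_def f_def conv_def by simp
  qed
  finally show ?thesis by simp
qed

definition energy :: real where
  "energy = \<kappa>\<^sup>2 * (LBINT x. h x * h x) + (\<Sum>b\<in>Basis. (LBINT x. h1 b x * h1 b x))"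

lemma energy_nonneg: "0 \<le> energy"
  unfolding energy_def by (intro add_nonneg_nonneg mult_nonneg_nonneg sum_nonneg) auto

lemma h1_square_le_energy:
  assumes b: "b \<in> Basis"
  shows "(LBINT x. h1 b x * h1 b x) \<le> energy"
proof -
  have "(LBINT x. h1 b x * h1 b x) \<le> (\<Sum>b\<in>Basis. (LBINT x. h1 b x * h1 b x))"
    by (intro member_le_sum b) auto
  also have "\<dots> \<le> energy" unfolding energy_def by simp
  finally show ?thesis .
qed

lemma integral_h_f: "(LBINT x. h x * f x) = energy"
proof -
  have ibp: "(LBINT x. h x * h2 b b x) = - (LBINT x. h1 b x * h1 b x)" if b: "b \<in> Basis" for b
  proof -
    \<comment> \<open>The constant test function has Lipschitz constant 0, so the inequality becomes
      an identity.\<close>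
    have "\<bar>\<integral>x. 1 * (h1 b x * h1 b x + h x * h2 b b x) \<partial>lborel\<bar> \<le> 0 * (LBINT x. \<bar>h x * h1 b x\<bar>)"
      by (rule nice_integral_by_parts[where b=b and V=1, OF nice_h nice_h1[OF b] nice_h1[OF b] nice_h2[OF b b]
          h_derivative[OF b] h1_derivative[OF b b]]) (use b in auto)
    then have "(LBINT x. h1 b x * h1 b x + h x * h2 b b x) = 0" by simp
    moreover have "(LBINT x. h1 b x * h1 b x + h x * h2 b b x) =
       (LBINT x. h1 b x * h1 b x) + (LBINT x. h x * h2 b b x)"
      using b by (intro Bochner_Integration.integral_add nice_integrable nice_mult nice_h1 nice_h nice_h2)
    ultimately show ?thesis by simp
  qed
  have "(LBINT x. h x * f x) = (LBINT x. \<kappa>\<^sup>2 * (h x * h x) - (\<Sum>b\<in>Basis. h x * h2 b b x))"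
    unfolding helmholtz by (simp add: right_diff_distrib sum_distrib_left mult.left_commute)
  also have "\<dots> = \<kappa>\<^sup>2 * (LBINT x. h x * h x) - (\<Sum>b\<in>Basis. \<integral>x. h x * h2 b b x \<partial>lborel)"
  proof -
    have "integrable lborel (\<lambda>x. h x * h x)" "\<And>b. b \<in> Basis \<Longrightarrow> integrable lborel (\<lambda>x. h x * h2 b b x)"
      by (intro nice_integrable nice_mult nice_h nice_h2; assumption)+
    then show ?thesis by simp
  qed
  also have "(\<Sum>b\<in>Basis. \<integral>x. h x * h2 b b x \<partial>lborel) = - (\<Sum>b\<in>Basis. (LBINT x. h1 b x * h1 b x))"
    by (simp add: ibp sum_negf)
  finally show ?thesis by (simp add: energy_def)
qed

text \<open>The density \<open>2 (\<partial>\<^sub>b h) f\<close> is the divergence of the \<open>b\<close>-th row of the stress tensor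
  \<open>(|\<nabla>h|\<^sup>2 + \<kappa>\<^sup>2h\<^sup>2) \<delta> - 2 \<nabla>h \<otimes> \<nabla>h\<close>, whose entries are bounded by the energy density.\<close>

lemma stress_tensor_bound:
  assumes b: "b \<in> Basis" and v: "\<And>x. \<bar>v x\<bar> \<le> V" "\<And>x y. \<bar>v x - v y\<bar> \<le> L * norm (x - y)"
  shows "\<bar>2 * (LBINT x. v x * (h1 b x * f x))\<bar> \<le> L * ((real DIM('a) + 2) * energy)"
proof -
  have L: "0 \<le> L" using v(2)[of b 0] b by (simp add: order_trans[OF abs_ge_zero])
  have vm: "v \<in> borel_measurable lborel" using lipschitz_borel_measurable[OF v(2)] by simp
  have vi: "integrable lborel (\<lambda>x. v x * g x)" if "nice g" for g
    by (rule integrable_mult_bounded[OF nice_integrable[OF that] vm v(1)])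
  \<comment> \<open>The divergence terms: H is the derivative along b of h^2, U c that of the
    squared c-derivative of h, and T c is the derivative along c of the product of the b- and
    c-derivatives.\<close>
  define H where "H = (\<lambda>x. h1 b x * h x + h x * h1 b x)"
  define U where "U c = (\<lambda>x. h2 c b x * h1 c x + h1 c x * h2 c b x)" for c
  define T where "T c = (\<lambda>x. h2 b c x * h1 c x + h1 b x * h2 c c x)" for c
  have nH: "nice H" unfolding H_def using b by (intro nice_add nice_mult nice_h nice_h1)
  have nU: "nice (U c)" if "c \<in> Basis" for c unfolding U_def using that b by (intro nice_add nice_mult nice_h2 nice_h1)
  have nT: "nice (T c)" if "c \<in> Basis" for c unfolding T_def using that b by (intro nice_add nice_mult nice_h2 nice_h1)
  let ?I = "\<lambda>g. \<integral>x. v x * g x \<partial>lborel"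
  let ?S = "\<lambda>c. \<integral>x. h1 c x * h1 c x \<partial>lborel"
  have dens: "v x * (2 * (h1 b x * f x)) = \<kappa>\<^sup>2 * (v x * H x) + (\<Sum>c\<in>Basis. v x * U c x - 2 * (v x * T c x))" for x
  proof -
    have "2 * (h1 b x * f x) = \<kappa>\<^sup>2 * H x + (\<Sum>c\<in>Basis. U c x - 2 * T c x)"
    proof -
      \<comment> \<open>The mixed second derivatives in U c and 2 T c cancel by symmetry; summing
        over c leaves the Laplacian of h.\<close>
      have "U c x - 2 * T c x = - (2 * h1 b x) * h2 c c x" for c
        unfolding U_def T_def h2_commute[of c b] by (simp add: algebra_simps)
      then have "(\<Sum>c\<in>Basis. U c x - 2 * T c x) = - (2 * h1 b x) * (\<Sum>c\<in>Basis. h2 c c x)"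
        by (simp only: sum_distrib_left)
      then show ?thesis unfolding helmholtz H_def by (simp add: algebra_simps)
    qed
    then have "v x * (2 * (h1 b x * f x)) = v x * (\<kappa>\<^sup>2 * H x + (\<Sum>c\<in>Basis. U c x - 2 * T c x))" by simp
    then show ?thesis by (simp add: distrib_left sum_distrib_left right_diff_distrib mult.left_commute)
  qed
  have "2 * (LBINT x. v x * (h1 b x * f x)) = (LBINT x. v x * (2 * (h1 b x * f x)))"
    by (simp flip: integral_mult_right_zero add: mult.left_commute)
  also have "\<dots> = \<kappa>\<^sup>2 * ?I H + (\<Sum>c\<in>Basis. ?I (U c) - 2 * ?I (T c))"
    unfolding dens using vi[OF nH] vi[OF nU] vi[OF nT] by simp
  finally have eq: "2 * (LBINT x. v x * (h1 b x * f x)) = \<kappa>\<^sup>2 * ?I H + (\<Sum>c\<in>Basis. ?I (U c) - 2 * ?I (T c))" .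
  have bH: "\<bar>?I H\<bar> \<le> L * (LBINT x. h x * h x)"
    using nice_integral_by_parts[where b=b, OF nice_h nice_h nice_h1[OF b] nice_h1[OF b] h_derivative[OF b] h_derivative[OF b] v] b
    by (simp add: H_def)
  have bU: "\<bar>?I (U c)\<bar> \<le> L * ?S c" if c: "c \<in> Basis" for c
    using nice_integral_by_parts[where b=b, OF nice_h1[OF c] nice_h1[OF c] nice_h2[OF c b] nice_h2[OF c b] h1_derivative[OF c b] h1_derivative[OF c b] v] b
    by (simp add: U_def)
  have bT: "2 * \<bar>?I (T c)\<bar> \<le> L * (?S b + ?S c)" if c: "c \<in> Basis" for c
  proof -
    have "\<bar>?I (T c)\<bar> \<le> L * (LBINT x. \<bar>h1 b x * h1 c x\<bar>)"
      using nice_integral_by_parts[where b=c, OF nice_h1[OF b] nice_h1[OF c] nice_h2[OF b c] nice_h2[OF c c] h1_derivative[OF b c] h1_derivative[OF c c] v] c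
      by (simp add: T_def)
    moreover have "2 * (LBINT x. \<bar>h1 b x * h1 c x\<bar>) \<le> ?S b + ?S c"
    proof -
      have i: "integrable lborel (\<lambda>x. \<bar>h1 b x * h1 c x\<bar>)" "integrable lborel (\<lambda>x. h1 b x * h1 b x)" "integrable lborel (\<lambda>x. h1 c x * h1 c x)"
        using nice_integrable[OF nice_mult[OF nice_h1[OF b] nice_h1[OF c]]]
          nice_integrable[OF nice_mult[OF nice_h1[OF b] nice_h1[OF b]]]
          nice_integrable[OF nice_mult[OF nice_h1[OF c] nice_h1[OF c]]] by simp_all
      have "2 * (LBINT x. \<bar>h1 b x * h1 c x\<bar>) = (LBINT x. 2 * \<bar>h1 b x * h1 c x\<bar>)" by simp
      also have "\<dots> \<le> (LBINT x. h1 b x * h1 b x + h1 c x * h1 c x)"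
      proof (rule integral_mono)
        fix x
        have "0 \<le> (\<bar>h1 b x\<bar> - \<bar>h1 c x\<bar>)\<^sup>2" by simp
        then show "2 * \<bar>h1 b x * h1 c x\<bar> \<le> h1 b x * h1 b x + h1 c x * h1 c x"
          by (simp add: power2_diff abs_mult) (simp add: power2_eq_square)
      qed (use i in simp_all)
      also have "\<dots> = ?S b + ?S c" using i by simp
      finally show ?thesis .
    qed
    then have "L * (2 * (LBINT x. \<bar>h1 b x * h1 c x\<bar>)) \<le> L * (?S b + ?S c)"
      using L by (rule mult_left_mono)
    ultimately show ?thesis by linarith
  qed
  have "\<bar>2 * (LBINT x. v x * (h1 b x * f x))\<bar> \<le> \<kappa>\<^sup>2 * \<bar>?I H\<bar> + (\<Sum>c\<in>Basis. \<bar>?I (U c)\<bar> + 2 * \<bar>?I (T c)\<bar>)"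
  proof -
    have "\<bar>\<Sum>c\<in>Basis. ?I (U c) - 2 * ?I (T c)\<bar> \<le> (\<Sum>c\<in>Basis. \<bar>?I (U c)\<bar> + 2 * \<bar>?I (T c)\<bar>)"
      by (rule order_trans[OF sum_abs], rule sum_mono) linarith
    moreover have "\<bar>\<kappa>\<^sup>2 * ?I H\<bar> = \<kappa>\<^sup>2 * \<bar>?I H\<bar>" by (simp add: abs_mult)
    ultimately show ?thesis unfolding eq by linarith
  qed
  also have "\<dots> \<le> \<kappa>\<^sup>2 * (L * (LBINT x. h x * h x)) + (\<Sum>c\<in>Basis. L * ?S c + L * (?S b + ?S c))"
    by (intro add_mono mult_left_mono sum_mono bH bU bT) auto
  \<comment> \<open>The terms in h and the sums over c are at most twice the energy. The mixed
    entries contribute the b-derivative once for each c, which gives d further energies.\<close>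
  also have "\<dots> = L * (\<kappa>\<^sup>2 * (LBINT x. h x * h x) + 2 * (\<Sum>c\<in>Basis. ?S c) + real DIM('a) * ?S b)"
    by (simp add: sum.distrib sum_distrib_left distrib_left mult.left_commute)
  also have "\<dots> \<le> L * ((real DIM('a) + 2) * energy)"
  proof (rule mult_left_mono[OF _ L])
    have "real DIM('a) * ?S b \<le> real DIM('a) * energy"
      by (intro mult_left_mono h1_square_le_energy b) auto
    moreover have "\<kappa>\<^sup>2 * (LBINT x. h x * h x) + 2 * (\<Sum>c\<in>Basis. ?S c) \<le> 2 * energy"
      unfolding energy_def by simp
    ultimately show "\<kappa>\<^sup>2 * (LBINT x. h x * h x) + 2 * (\<Sum>c\<in>Basis. ?S c) + real DIM('a) * ?S b \<le> (real DIM('a) + 2) * energy"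
      unfolding distrib_right by linarith
  qed
  finally show ?thesis .
qed

end

section \<open>The commutator of the regularized kernel\<close>

text \<open>The increment of a Lipschitz field supplies the factor |z|. Together with it the
  gradient of the far kernel is bounded, so the commutator kernel is bounded even when the field is
  not.\<close>

lemma norm_mult_far1_le:
  fixes z b :: "'a::euclidean_space"
  assumes \<kappa>: "0 < \<kappa>" and s: "0 < s" and b: "norm b = 1"
  shows "norm z * \<bar>far1 \<kappa> s b z\<bar> \<le> 2 * 2 powr (real DIM('a) / 2) * env \<kappa> s 2 z"
proof -
  have sl: "norm z * \<bar>slope s b z t\<bar> \<le> 2 * 2 powr (real DIM('a) / 2) * (indicator {s<..} t * heat (2 * t) z)" for t
  proof (cases "s < t")
    case True
    then have t: "0 < t" using s by simp
    have "norm z * \<bar>slope s b z t\<bar> = (norm z * \<bar>z \<bullet> b\<bar>) / (2 * t) * heat t z"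
      using True t by (simp add: slope_def[OF \<kappa> s] abs_mult)
    also have "\<dots> \<le> (norm z * norm z) / (2 * t) * heat t z"
      using t Cauchy_Schwarz_ineq2[of z b] b by (intro mult_right_mono divide_right_mono mult_left_mono) auto
    also have "\<dots> \<le> 2 * 2 powr (real DIM('a) / 2) * heat (2 * t) z"
      using inner_le_norm_heat(2)[OF t, of z] by (simp add: power2_eq_square)
    finally show ?thesis using True by simp
  qed (simp add: slope_def[OF \<kappa> s])
  have "norm z * \<bar>far1 \<kappa> s b z\<bar> \<le> norm z * (\<integral>t. \<bar>slope s b z t\<bar> \<partial>clock \<kappa>)"
    unfolding far1_eq_slope[OF \<kappa> s] by (intro mult_left_mono integral_abs_bound) auto
  also have "\<dots> = (\<integral>t. norm z * \<bar>slope s b z t\<bar> \<partial>clock \<kappa>)"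
    by simp
  also have "\<dots> \<le> (\<integral>t. 2 * 2 powr (real DIM('a) / 2) * (indicator {s<..} t * heat (2 * t) z) \<partial>clock \<kappa>)"
    using sl by (intro integral_mono' integrable_mult_right integrable_env[OF \<kappa> s]) auto
  also have "\<dots> = 2 * 2 powr (real DIM('a) / 2) * env \<kappa> s 2 z"
    by (simp add: env_def[OF \<kappa> s])
  finally show ?thesis .
qed

lemma norm_mult_far1_bounded:
  assumes \<kappa>: "0 < \<kappa>" and s: "0 < s" and b: "norm (b::'a::euclidean_space) = 1"
  obtains B where "\<And>z. norm z * \<bar>far1 \<kappa> s b z\<bar> \<le> B"
proof -
  obtain B where B: "\<And>z::'a. \<bar>env \<kappa> s 2 z\<bar> \<le> B" by (rule env_bounded[OF \<kappa> s, of 2]) auto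
  have "norm z * \<bar>far1 \<kappa> s b z\<bar> \<le> 2 * 2 powr (real DIM('a) / 2) * B" for z
    using B[of z] by (intro order_trans[OF norm_mult_far1_le[OF \<kappa> s b]] mult_left_mono) auto
  then show thesis by (rule that)
qed

context charge
begin

lemma pairing_eq_product:
  assumes k[measurable]: "(\<lambda>(x, y). k x y) \<in> borel_measurable (borel \<Otimes>\<^sub>M borel)" and B: "\<And>x y. \<bar>k x y\<bar> \<le> B"
  shows "pairing k = (\<integral>p. k (pos (fst p)) (pos (snd p)) * w (snd p) * w (fst p) \<partial>(M \<Otimes>\<^sub>M M))"
    and "integrable (M \<Otimes>\<^sub>M M) (\<lambda>p. k (pos (fst p)) (pos (snd p)) * w (snd p) * w (fst p))"
proof -
  interpret P: pair_sigma_finite M M ..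
  have B0: "0 \<le> B" using B[of undefined undefined] by linarith
  have m: "(\<lambda>p. k (pos (fst p)) (pos (snd p)) * w (snd p) * w (fst p)) \<in> borel_measurable (M \<Otimes>\<^sub>M M)"
    by measurable
  have fin: "finite_measure (M \<Otimes>\<^sub>M M)"
    by (rule finite_measure_pair_measure) (rule finite_measure_axioms)+
  show i: "integrable (M \<Otimes>\<^sub>M M) (\<lambda>p. k (pos (fst p)) (pos (snd p)) * w (snd p) * w (fst p))"
  proof (rule finite_measure.integrable_const_bound[OF fin, where B="B * W * W"])
    show "AE p in M \<Otimes>\<^sub>M M. norm (k (pos (fst p)) (pos (snd p)) * w (snd p) * w (fst p)) \<le> B * W * W"
      using B w_bound B0 W_nonneg by (intro AE_I2) (auto simp: abs_mult intro!: mult_mono)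
  qed (rule m)
  show "pairing k = (\<integral>p. k (pos (fst p)) (pos (snd p)) * w (snd p) * w (fst p) \<partial>(M \<Otimes>\<^sub>M M))"
    unfolding P.integral_fst'[OF i, symmetric] pairing_def by simp
qed

lemma pairing_swap:
  assumes k[measurable]: "(\<lambda>(x, y). k x y) \<in> borel_measurable (borel \<Otimes>\<^sub>M borel)" and B: "\<And>x y. \<bar>k x y\<bar> \<le> B"
  shows "pairing (\<lambda>x y. k y x) = pairing k"
proof -
  interpret P: pair_sigma_finite M M ..
  have m: "(\<lambda>p. k (pos (fst p)) (pos (snd p)) * w (snd p) * w (fst p)) \<in> borel_measurable (M \<Otimes>\<^sub>M M)"
    by measurable
  have "pairing (\<lambda>x y. k y x) = (\<integral>p. k (pos (snd p)) (pos (fst p)) * w (snd p) * w (fst p) \<partial>(M \<Otimes>\<^sub>M M))"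
    by (rule pairing_eq_product(1)[OF _ B]) measurable
  also have "\<dots> = (\<integral>p. k (pos (fst p)) (pos (snd p)) * w (snd p) * w (fst p) \<partial>(M \<Otimes>\<^sub>M M))"
    using P.integral_product_swap[OF m] by (simp add: case_prod_beta' mult_ac)
  also have "\<dots> = pairing k" by (rule pairing_eq_product(1)[OF k B, symmetric])
  finally show ?thesis .
qed

lemma pairing_diff:
  assumes k: "(\<lambda>(x, y). k x y) \<in> borel_measurable (borel \<Otimes>\<^sub>M borel)" "\<And>x y. \<bar>k x y\<bar> \<le> B"
    and k': "(\<lambda>(x, y). k' x y) \<in> borel_measurable (borel \<Otimes>\<^sub>M borel)" "\<And>x y. \<bar>k' x y\<bar> \<le> B'"
  shows "pairing (\<lambda>x y. k x y - k' x y) = pairing k - pairing k'"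
proof -
  note [measurable] = k(1) k'(1)
  have "\<bar>k x y - k' x y\<bar> \<le> B + B'" for x y using k(2)[of x y] k'(2)[of x y] by linarith
  then have "pairing (\<lambda>x y. k x y - k' x y) =
     (\<integral>p. (k (pos (fst p)) (pos (snd p)) - k' (pos (fst p)) (pos (snd p))) * w (snd p) * w (fst p) \<partial>(M \<Otimes>\<^sub>M M))"
    by (intro pairing_eq_product(1)) measurable
  also have "\<dots> = pairing k - pairing k'"
    unfolding pairing_eq_product(1)[OF k] pairing_eq_product(1)[OF k']
      Bochner_Integration.integral_diff[OF pairing_eq_product(2)[OF k] pairing_eq_product(2)[OF k'], symmetric]
    by (simp only: left_diff_distrib)
  finally show ?thesis .
qed

end

context screened_charge
begin

text \<open>The kernel truncated at 2s is a multiple of \<open>heat s\<close> convolved with the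
  kernel truncated at s. Attaching one factor to each copy of the charge turns the pairing into the
  integral of h f. This is the positive definiteness of the far kernel.\<close>

lemma pairing_far: "pairing (\<lambda>x y. far \<kappa> (2 * s) (x - y)) = energy"
proof -
  obtain B where B: "\<And>z::'a. \<bar>far \<kappa> s z\<bar> \<le> B" by (rule far_bounded[OF \<kappa> s]) blast
  have hs: "integrable lborel (\<lambda>x. heat s (x - c))" for c :: 'a
    by (rule integrable_lborel_diff[OF integrable_heat[OF s]])
  have inner: "(LBINT x. h x * heat s (x - pos a)) = exp (\<kappa>\<^sup>2 * s) * (\<integral>b. far \<kappa> (2 * s) (pos a - pos b) * w b \<partial>M)" for a
  proof -
    have "(LBINT x. h x * heat s (x - pos a)) = (LBINT x. heat s (x - pos a) * conv (far \<kappa> s) x)"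
      by (simp add: h_def mult.commute)
    also have "\<dots> = (\<integral>b. (LBINT x. heat s (x - pos a) * far \<kappa> s (x - pos b)) * w b \<partial>M)"
      by (rule integral_mult_conv(1)[OF hs measurable_far[OF \<kappa> s] B])
    finally show ?thesis
      by (simp add: heat_convolution_far[OF \<kappa> s] mult.assoc)
  qed
  have "energy = (LBINT x. exp (- (\<kappa>\<^sup>2 * s)) * (h x * conv (heat s) x))"
    unfolding integral_h_f[symmetric] f_def by (simp only: mult.left_commute)
  also have "\<dots> = exp (- (\<kappa>\<^sup>2 * s)) * (\<integral>a. (LBINT x. h x * heat s (x - pos a)) * w a \<partial>M)"
    unfolding integral_mult_right_zero
    by (subst integral_mult_conv(1)[OF nice_integrable[OF nice_h] _ heat_bounded[OF s]]) simp_all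
  also have "\<dots> = (exp (- (\<kappa>\<^sup>2 * s)) * exp (\<kappa>\<^sup>2 * s)) * pairing (\<lambda>x y. far \<kappa> (2 * s) (x - y))"
    unfolding inner pairing_def mult.assoc integral_mult_right_zero by (rule refl)
  finally show ?thesis by (simp flip: exp_add)
qed

text \<open>The commutator of multiplication by v and convolution with \<open>heat s\<close>,
  applied to the charge.\<close>

definition remainder :: "('a \<Rightarrow> real) \<Rightarrow> 'a \<Rightarrow> real" where
  "remainder v x = (\<integral>a. (v (pos a) - v x) * heat s (x - pos a) * w a \<partial>M)"

lemma integrable_weighted_heat:
  assumes [measurable]: "v \<in> borel_measurable borel" and v: "\<And>x. \<bar>v x\<bar> \<le> V"
  shows "integrable M (\<lambda>a. v (pos a) * heat s (x - pos a) * w a)"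
proof (rule integrable_bounded_weight[where B="V * heat s (0::'a)"])
  have "0 \<le> V" using v[of 0] by linarith
  then show "\<bar>v (pos a) * heat s (x - pos a)\<bar> \<le> V * heat s (0::'a)" for a
    unfolding abs_mult by (intro mult_mono v heat_bounded s) auto
qed measurable

text \<open>The factor \<open>heat s\<close> of the kernel falls on the charge already multiplied by
  v, whereas the stress tensor calls for v times the smoothed charge. The difference is
  \<open>remainder\<close>.\<close>

lemma pairing_far1:
  assumes e: "e \<in> Basis" and [measurable]: "v \<in> borel_measurable borel" and v: "\<And>x. \<bar>v x\<bar> \<le> V"
  shows "pairing (\<lambda>x y. v x * far1 \<kappa> (2 * s) e (x - y)) =
    (LBINT x. v x * (h1 e x * f x)) + exp (- (\<kappa>\<^sup>2 * s)) * (LBINT x. h1 e x * remainder v x)"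
    and "integrable lborel (\<lambda>x. h1 e x * remainder v x)"
proof -
  have e1: "norm e = 1" using e by simp
  have V: "0 \<le> V" using v[of 0] by linarith
  obtain B where B: "\<And>z::'a. \<bar>far1 \<kappa> s e z\<bar> \<le> B" by (rule far1_bounded[OF \<kappa> s e1]) blast
  have hs: "integrable lborel (\<lambda>x. heat s (x - c))" for c :: 'a
    by (rule integrable_lborel_diff[OF integrable_heat[OF s]])
  let ?E = "exp (- (\<kappa>\<^sup>2 * s))"
  define k where "k x a = v (pos a) * heat s (x - pos a) * w a" for x a
  have km: "(\<lambda>(x, a). k x a) \<in> borel_measurable (lborel \<Otimes>\<^sub>M M)"
    unfolding k_def by measurable
  have kb: "\<bar>k x a\<bar> \<le> V * heat s (0::'a) * W" for x a
    unfolding k_def abs_mult using V w_bound by (intro mult_mono v heat_bounded s) auto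
  note fub = fubini_bounded_kernel[OF finite_measure_axioms nice_integrable[OF nice_h1[OF e]] km kb]
  have inner: "(LBINT x. h1 e x * k x a) = exp (\<kappa>\<^sup>2 * s) * ((\<integral>b. v (pos a) * far1 \<kappa> (2 * s) e (pos a - pos b) * w b \<partial>M) * w a)" for a
  proof -
    have "(LBINT x. h1 e x * k x a) = (LBINT x. (v (pos a) * w a) * (heat s (x - pos a) * conv (far1 \<kappa> s e) x))"
      by (simp only: h1_def k_def mult_ac)
    also have "\<dots> = (v (pos a) * w a) * (\<integral>b. (LBINT x. heat s (x - pos a) * far1 \<kappa> s e (x - pos b)) * w b \<partial>M)"
      unfolding integral_mult_right_zero by (subst integral_mult_conv(1)[OF hs measurable_far1[OF \<kappa> s] B]) (rule refl)
    also have "\<dots> = (v (pos a) * w a) * (exp (\<kappa>\<^sup>2 * s) * (\<integral>b. far1 \<kappa> (2 * s) e (pos a - pos b) * w b \<partial>M))"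
      by (simp add: heat_convolution_far1[OF \<kappa> s e1] mult.assoc)
    finally have x: "(LBINT x. h1 e x * k x a) = (v (pos a) * w a) * (exp (\<kappa>\<^sup>2 * s) * (\<integral>b. far1 \<kappa> (2 * s) e (pos a - pos b) * w b \<partial>M))" .
    have y: "(\<integral>b. v (pos a) * far1 \<kappa> (2 * s) e (pos a - pos b) * w b \<partial>M) = v (pos a) * (\<integral>b. far1 \<kappa> (2 * s) e (pos a - pos b) * w b \<partial>M)"
      unfolding mult.assoc by (rule integral_mult_right_zero)
    show ?thesis unfolding x y by (simp only: mult_ac)
  qed
  have "(LBINT x. h1 e x * (\<integral>a. k x a \<partial>M)) = exp (\<kappa>\<^sup>2 * s) * pairing (\<lambda>x y. v x * far1 \<kappa> (2 * s) e (x - y))"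
    unfolding fub(1) inner pairing_def integral_mult_right_zero by (rule refl)
  then have p: "pairing (\<lambda>x y. v x * far1 \<kappa> (2 * s) e (x - y)) = ?E * (LBINT x. h1 e x * (\<integral>a. k x a \<partial>M))"
    by (simp flip: exp_add mult.assoc)
  have split: "h1 e x * (\<integral>a. k x a \<partial>M) = v x * (h1 e x * conv (heat s) x) + h1 e x * remainder v x" for x
  proof -
    have i1: "integrable M (\<lambda>a. v (pos a) * heat s (x - pos a) * w a)"
      by (rule integrable_weighted_heat[OF _ v]) measurable
    have i2: "integrable M (\<lambda>a. v x * (heat s (x - pos a) * w a))"
      by (intro integrable_mult_right integrable_conv_kernel[OF _ heat_bounded[OF s]]) measurable
    have "remainder v x = (\<integral>a. v (pos a) * heat s (x - pos a) * w a - v x * (heat s (x - pos a) * w a) \<partial>M)"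
      unfolding remainder_def by (simp only: left_diff_distrib mult.assoc)
    also have "\<dots> = (\<integral>a. k x a \<partial>M) - v x * conv (heat s) x"
      unfolding Bochner_Integration.integral_diff[OF i1 i2] integral_mult_right_zero conv_def k_def by (rule refl)
    finally have "(\<integral>a. k x a \<partial>M) = v x * conv (heat s) x + remainder v x" by simp
    then show ?thesis by (simp add: distrib_left mult.left_commute)
  qed
  have ic: "integrable lborel (\<lambda>x. v x * (h1 e x * conv (heat s) x))"
    by (rule integrable_mult_bounded[OF integral_mult_conv(2)[OF nice_integrable[OF nice_h1[OF e]] _ heat_bounded[OF s]] _ v]) auto
  have "integrable lborel (\<lambda>x. h1 e x * (\<integral>a. k x a \<partial>M) - v x * (h1 e x * conv (heat s) x))"
    by (intro Bochner_Integration.integrable_diff fub(2) ic)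
  then show ir: "integrable lborel (\<lambda>x. h1 e x * remainder v x)"
    unfolding split by simp
  have "(LBINT x. v x * (h1 e x * f x)) = (LBINT x. ?E * (v x * (h1 e x * conv (heat s) x)))"
    unfolding f_def by (simp only: mult_ac)
  also have "\<dots> = ?E * (LBINT x. v x * (h1 e x * conv (heat s) x))"
    by (rule integral_mult_right_zero)
  finally have vf: "(LBINT x. v x * (h1 e x * f x)) = ?E * (LBINT x. v x * (h1 e x * conv (heat s) x))" .
  show "pairing (\<lambda>x y. v x * far1 \<kappa> (2 * s) e (x - y)) =
    (LBINT x. v x * (h1 e x * f x)) + ?E * (LBINT x. h1 e x * remainder v x)"
    unfolding p split Bochner_Integration.integral_add[OF ic ir] vf by (rule distrib_left)
qed

text \<open>The increment of v is absorbed by \<open>heat s\<close>, which leaves C = 2 sqrt s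
  2^(d/2) times the smoothed total variation m. Young's inequality separates the gradient of h from
  C m, and the integral of m^2 is a heat pairing at time 4s.\<close>

lemma remainder_bound:
  assumes e: "e \<in> Basis" and v: "\<And>x. \<bar>v x\<bar> \<le> V" "\<And>x y. \<bar>v x - v y\<bar> \<le> L * norm (x - y)"
  shows "\<bar>2 * (LBINT x. h1 e x * remainder v x)\<bar> \<le>
    L * (energy + 4 * 2 ^ DIM('a) * s * total_variation_pairing (\<lambda>x y. heat (4 * s) (x - y)))"
proof -
  \<comment> \<open>The total variation of the charge is a charge on the same space, so all facts
    about \<open>conv\<close> apply to it.\<close>
  interpret tv: charge M pos "\<lambda>a. \<bar>w a\<bar>" W
    by unfold_locales (auto simp: w_bound)
  have L: "0 \<le> L" using v(2)[of e 0] e by (simp add: order_trans[OF abs_ge_zero])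
  have vm[measurable]: "v \<in> borel_measurable borel" by (rule lipschitz_borel_measurable[OF v(2)])
  have s2: "0 < 2 * s" using s by simp
  define m where "m = tv.conv (heat (2 * s))"
  define D where "D = 2 powr (real DIM('a) / 2)"
  define C where "C = 2 * sqrt s * D"
  have C2: "C * C = 4 * 2 ^ DIM('a) * s"
  proof -
    have "D * D = 2 powr real DIM('a)" unfolding D_def powr_add[symmetric] by simp
    also have "\<dots> = 2 ^ DIM('a)" by (rule powr_realpow) simp
    finally have "D * D = 2 ^ DIM('a)" .
    moreover have "sqrt s * sqrt s = s" using s by simp
    moreover have "C * C = 4 * (D * D) * (sqrt s * sqrt s)" unfolding C_def by simp
    ultimately show ?thesis by simp
  qed
  have mi: "integrable lborel m" unfolding m_def by (rule tv.integrable_conv[OF integrable_heat[OF s2]])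
  have mb: "\<bar>m x\<bar> \<le> heat (2 * s) (0::'a) * W * measure M (space M)" for x
    unfolding m_def by (rule tv.conv_bounded[OF _ heat_bounded[OF s2]]) measurable
  have mm[measurable]: "m \<in> borel_measurable borel" using mi by auto
  have R: "\<bar>remainder v x\<bar> \<le> L * C * m x" for x
  proof -
    have "\<bar>remainder v x\<bar> \<le> (\<integral>a. \<bar>(v (pos a) - v x) * heat s (x - pos a) * w a\<bar> \<partial>M)"
      unfolding remainder_def by (rule integral_abs_bound)
    also have "\<dots> \<le> (\<integral>a. L * C * (heat (2 * s) (x - pos a) * \<bar>w a\<bar>) \<partial>M)"
    proof (rule integral_mono')
      show "integrable M (\<lambda>a. L * C * (heat (2 * s) (x - pos a) * \<bar>w a\<bar>))"
        by (intro integrable_mult_right tv.integrable_conv_kernel[OF _ heat_bounded[OF s2]]) measurable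
      show "0 \<le> L * C * (heat (2 * s) (x - pos a) * \<bar>w a\<bar>)" for a
        using L s by (simp add: C_def D_def)
      fix a
      have "\<bar>v (pos a) - v x\<bar> * heat s (x - pos a) \<le> L * norm (pos a - x) * heat s (x - pos a)"
        by (intro mult_right_mono v) simp
      also have "\<dots> = L * (norm (x - pos a) * heat s (x - pos a))" by (simp add: norm_minus_commute)
      also have "\<dots> \<le> L * (C * heat (2 * s) (x - pos a))"
        unfolding C_def D_def by (intro mult_left_mono inner_le_norm_heat L s)
      finally have "\<bar>v (pos a) - v x\<bar> * heat s (x - pos a) * \<bar>w a\<bar> \<le> L * (C * heat (2 * s) (x - pos a)) * \<bar>w a\<bar>"
        by (rule mult_right_mono) simp
      then show "\<bar>(v (pos a) - v x) * heat s (x - pos a) * w a\<bar> \<le> L * C * (heat (2 * s) (x - pos a) * \<bar>w a\<bar>)"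
        by (simp add: abs_mult mult.assoc)
    qed
    also have "\<dots> = L * C * m x" unfolding m_def tv.conv_def by (rule integral_mult_right_zero)
    finally show ?thesis .
  qed
  have hi: "integrable lborel (\<lambda>x. h1 e x * h1 e x)" by (rule nice_integrable[OF nice_mult[OF nice_h1[OF e] nice_h1[OF e]]])
  have mmi: "integrable lborel (\<lambda>x. m x * m x)" by (rule integrable_mult_bounded[OF mi _ mb]) measurable
  have tot: "(LBINT x. m x * m x) = total_variation_pairing (\<lambda>x y. heat (4 * s) (x - y))"
  proof -
    have hs: "integrable lborel (\<lambda>x. heat (2 * s) (x - c))" for c :: 'a
      by (rule integrable_lborel_diff[OF integrable_heat[OF s2]])
    have inner: "(LBINT x. m x * heat (2 * s) (x - pos a)) = (\<integral>b. heat (4 * s) (pos a - pos b) * \<bar>w b\<bar> \<partial>M)" for a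
    proof -
      have "(LBINT x. m x * heat (2 * s) (x - pos a)) = (LBINT x. heat (2 * s) (x - pos a) * tv.conv (heat (2 * s)) x)"
        by (simp add: m_def mult.commute)
      also have "\<dots> = (\<integral>b. (LBINT x. heat (2 * s) (x - pos a) * heat (2 * s) (x - pos b)) * \<bar>w b\<bar> \<partial>M)"
        by (rule tv.integral_mult_conv(1)[OF hs _ heat_bounded[OF s2]]) measurable
      finally show ?thesis by (simp add: heat_convolution[OF s2 s2])
    qed
    have "(LBINT x. m x * m x) = (LBINT x. m x * tv.conv (heat (2 * s)) x)" by (simp only: m_def)
    also have "\<dots> = (\<integral>a. (LBINT x. m x * heat (2 * s) (x - pos a)) * \<bar>w a\<bar> \<partial>M)"
      by (rule tv.integral_mult_conv(1)[OF mi _ heat_bounded[OF s2]]) measurable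
    finally show ?thesis unfolding inner total_variation_pairing_def .
  qed
  have "\<bar>2 * (LBINT x. h1 e x * remainder v x)\<bar> = 2 * \<bar>\<integral>x. h1 e x * remainder v x \<partial>lborel\<bar>"
    by (simp add: abs_mult)
  also have "\<dots> \<le> 2 * (LBINT x. \<bar>h1 e x * remainder v x\<bar>)"
    by (intro mult_left_mono integral_abs_bound) simp
  also have "\<dots> = (LBINT x. 2 * \<bar>h1 e x * remainder v x\<bar>)" by simp
  also have "\<dots> \<le> (LBINT x. L * (h1 e x * h1 e x + (C * C) * (m x * m x)))"
  proof (rule integral_mono)
    show "integrable lborel (\<lambda>x. 2 * \<bar>h1 e x * remainder v x\<bar>)"
      by (intro integrable_mult_right integrable_abs pairing_far1(2)[OF e vm v(1)])
    show "integrable lborel (\<lambda>x. L * (h1 e x * h1 e x + (C * C) * (m x * m x)))"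
      by (intro integrable_mult_right Bochner_Integration.integrable_add hi mmi)
    fix x
    have "2 * \<bar>h1 e x * remainder v x\<bar> \<le> 2 * (\<bar>h1 e x\<bar> * (L * C * m x))"
      unfolding abs_mult by (intro mult_left_mono R) auto
    also have "\<dots> = L * (2 * \<bar>h1 e x\<bar> * (C * m x))" by simp
    also have "\<dots> \<le> L * (h1 e x * h1 e x + (C * C) * (m x * m x))"
    proof (rule mult_left_mono[OF _ L])
      have "0 \<le> (\<bar>h1 e x\<bar> - C * m x)\<^sup>2" by simp
      also have "\<dots> = h1 e x * h1 e x - 2 * \<bar>h1 e x\<bar> * (C * m x) + (C * C) * (m x * m x)"
        unfolding power2_diff by (simp add: power2_eq_square)
      finally show "2 * \<bar>h1 e x\<bar> * (C * m x) \<le> h1 e x * h1 e x + (C * C) * (m x * m x)" by simp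
    qed
    finally show "2 * \<bar>h1 e x * remainder v x\<bar> \<le> L * (h1 e x * h1 e x + (C * C) * (m x * m x))" .
  qed
  also have "\<dots> = L * ((LBINT x. h1 e x * h1 e x) + (C * C) * (LBINT x. m x * m x))"
    unfolding integral_mult_right_zero Bochner_Integration.integral_add[OF hi integrable_mult_right[OF mmi]] by (rule refl)
  also have "\<dots> \<le> L * (energy + 4 * 2 ^ DIM('a) * s * total_variation_pairing (\<lambda>x y. heat (4 * s) (x - y)))"
    unfolding C2 tot by (intro mult_left_mono[OF _ L] add_right_mono h1_square_le_energy e)
  finally show ?thesis .
qed

lemma measurable_commutator_kernel:
  assumes [measurable]: "v \<in> borel_measurable borel" and t: "0 < t"
  shows "(\<lambda>(x, y). (v x - v y) * far1 \<kappa> t e (x - y :: 'a)) \<in> borel_measurable (borel \<Otimes>\<^sub>M borel)"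
proof -
  note [measurable] = measurable_far1[OF \<kappa> t, where ?'a='a]
  show ?thesis by measurable
qed

text \<open>Since \<open>far1\<close> is odd, the terms in v x and v y contribute equally, and one
  of them is computed by \<open>pairing_far1\<close>. Boundedness of v makes the two terms
  separately meaningful. The factor d + 3 is d + 2 from the stress tensor and 1 from the
  remainder.\<close>

lemma far_commutator_bounded:
  assumes e: "e \<in> Basis" and v: "\<And>x. \<bar>v x\<bar> \<le> V" "\<And>x y. \<bar>v x - v y\<bar> \<le> L * norm (x - y)"
  shows "\<bar>pairing (\<lambda>x y. (v x - v y) * far1 \<kappa> (2 * s) e (x - y))\<bar> \<le>
    L * ((real DIM('a) + 3) * energy + 4 * 2 ^ DIM('a) * s * total_variation_pairing (\<lambda>x y. heat (4 * s) (x - y)))"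
proof -
  have e1: "norm e = 1" using e by simp
  have s2: "0 < 2 * s" using s by simp
  have vm[measurable]: "v \<in> borel_measurable borel" by (rule lipschitz_borel_measurable[OF v(2)])
  note [measurable] = measurable_far1[OF \<kappa> s2, where ?'a='a]
  obtain B where B: "\<And>z::'a. \<bar>far1 \<kappa> (2 * s) e z\<bar> \<le> B" by (rule far1_bounded[OF \<kappa> s2 e1]) blast
  have B0: "0 \<le> B" using B[of 0] by linarith
  have V: "0 \<le> V" using v(1)[of 0] by linarith
  define k where "k x y = v x * far1 \<kappa> (2 * s) e (x - y)" for x y
  have km: "(\<lambda>(x, y). k x y) \<in> borel_measurable (borel \<Otimes>\<^sub>M borel)" unfolding k_def by measurable
  have km': "(\<lambda>(x, y). k y x) \<in> borel_measurable (borel \<Otimes>\<^sub>M borel)" unfolding k_def by measurable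
  have kb: "\<bar>k x y\<bar> \<le> V * B" for x y
    unfolding k_def abs_mult using V by (intro mult_mono v B) auto
  have anti: "far1 \<kappa> (2 * s) e (y - x) = - far1 \<kappa> (2 * s) e (x - y)" for x y :: 'a
    by (metis far1_minus minus_diff_eq)
  have "(v x - v y) * far1 \<kappa> (2 * s) e (x - y) = k x y - (- 1) * k y x" for x y
    using anti[of x y] by (simp add: k_def left_diff_distrib)
  then have "pairing (\<lambda>x y. (v x - v y) * far1 \<kappa> (2 * s) e (x - y)) = pairing (\<lambda>x y. k x y - (- 1) * k y x)"
    by (simp only:)
  also have "\<dots> = pairing k - pairing (\<lambda>x y. (- 1) * k y x)"
    by (rule pairing_diff[OF km kb]) (use kb km' in auto)
  also have "pairing (\<lambda>x y. (- 1) * k y x) = - pairing (\<lambda>x y. k y x)"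
    unfolding pairing_def by simp
  also have "pairing (\<lambda>x y. k y x) = pairing k" by (rule pairing_swap[OF km kb])
  finally have "pairing (\<lambda>x y. (v x - v y) * far1 \<kappa> (2 * s) e (x - y)) = 2 * pairing k" by simp
  also have "\<dots> = 2 * (LBINT x. v x * (h1 e x * f x)) + exp (- (\<kappa>\<^sup>2 * s)) * (2 * (LBINT x. h1 e x * remainder v x))"
    unfolding k_def pairing_far1(1)[OF e vm v(1)] by simp
  finally have eq: "pairing (\<lambda>x y. (v x - v y) * far1 \<kappa> (2 * s) e (x - y)) =
     2 * (LBINT x. v x * (h1 e x * f x)) + exp (- (\<kappa>\<^sup>2 * s)) * (2 * (LBINT x. h1 e x * remainder v x))" .
  let ?R = "2 * (LBINT x. h1 e x * remainder v x)"
  have "\<bar>exp (- (\<kappa>\<^sup>2 * s)) * ?R\<bar> = exp (- (\<kappa>\<^sup>2 * s)) * \<bar>?R\<bar>" by (simp only: abs_mult abs_exp_cancel)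
  also have "\<dots> \<le> 1 * \<bar>?R\<bar>" using s by (intro mult_right_mono) auto
  finally have E: "\<bar>exp (- (\<kappa>\<^sup>2 * s)) * ?R\<bar> \<le> \<bar>?R\<bar>" by simp
  have "\<bar>pairing (\<lambda>x y. (v x - v y) * far1 \<kappa> (2 * s) e (x - y))\<bar> \<le> L * ((real DIM('a) + 2) * energy) +
    L * (energy + 4 * 2 ^ DIM('a) * s * total_variation_pairing (\<lambda>x y. heat (4 * s) (x - y)))"
    unfolding eq
    by (intro order_trans[OF abs_triangle_ineq] add_mono stress_tensor_bound[OF e v] order_trans[OF E] remainder_bound[OF e v])
  then show ?thesis by (simp add: algebra_simps)
qed

text \<open>Clipping v to [-n, n] keeps its Lipschitz constant, and the bound for clipped fields
  does not depend on n. The kernels are bounded uniformly in n by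
  \<open>norm_mult_far1_bounded\<close>, so dominated convergence reaches an unbounded v.\<close>

lemma far_commutator:
  assumes e: "e \<in> Basis" and v: "\<And>x y. \<bar>v x - v y\<bar> \<le> L * norm (x - y)"
  shows "\<bar>pairing (\<lambda>x y. (v x - v y) * far1 \<kappa> (2 * s) e (x - y))\<bar> \<le>
    L * ((real DIM('a) + 3) * energy + 4 * 2 ^ DIM('a) * s * total_variation_pairing (\<lambda>x y. heat (4 * s) (x - y)))"
proof -
  have e1: "norm e = 1" using e by simp
  have s2: "0 < 2 * s" using s by simp
  have L: "0 \<le> L" using v[of e 0] e by (simp add: order_trans[OF abs_ge_zero])
  have vm[measurable]: "v \<in> borel_measurable borel" by (rule lipschitz_borel_measurable[OF v])
  note [measurable] = measurable_far1[OF \<kappa> s2, where ?'a='a]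
  obtain B where B: "\<And>z::'a. norm z * \<bar>far1 \<kappa> (2 * s) e z\<bar> \<le> B" by (rule norm_mult_far1_bounded[OF \<kappa> s2 e1]) blast
  define c where "c n x = max (- real n) (min (real n) (v x))" for n x
  have cb: "\<bar>c n x\<bar> \<le> real n" for n x unfolding c_def by (auto simp: max_def min_def)
  have cL: "\<bar>c n x - c n y\<bar> \<le> L * norm (x - y)" for n x y
    using v[of x y] unfolding c_def by (auto simp: max_def min_def abs_if split: if_splits)
  have kb: "\<bar>(c x - c y) * far1 \<kappa> (2 * s) e (x - y)\<bar> \<le> L * B" if "\<And>x y. \<bar>c x - c y\<bar> \<le> L * norm (x - y)" for c x y
  proof -
    have "\<bar>(c x - c y) * far1 \<kappa> (2 * s) e (x - y)\<bar> \<le> L * norm (x - y) * \<bar>far1 \<kappa> (2 * s) e (x - y)\<bar>"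
      unfolding abs_mult by (intro mult_right_mono that) auto
    also have "\<dots> \<le> L * B" unfolding mult.assoc by (intro mult_left_mono B L)
    finally show ?thesis .
  qed
  let ?K = "\<lambda>c p. (c (pos (fst p)) - c (pos (snd p))) * far1 \<kappa> (2 * s) e (pos (fst p) - pos (snd p)) * w (snd p) * w (fst p)"
  have fin: "finite_measure (M \<Otimes>\<^sub>M M)"
    by (rule finite_measure_pair_measure) (rule finite_measure_axioms)+
  have pe: "pairing (\<lambda>x y. (c x - c y) * far1 \<kappa> (2 * s) e (x - y)) = (\<integral>p. ?K c p \<partial>(M \<Otimes>\<^sub>M M))"
    if "\<And>x y. \<bar>c x - c y\<bar> \<le> L * norm (x - y)" for c
    by (rule pairing_eq_product(1)[OF measurable_commutator_kernel[OF lipschitz_borel_measurable[OF that] s2] kb[OF that]])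
  have "(\<lambda>n. \<integral>p. ?K (c n) p \<partial>(M \<Otimes>\<^sub>M M)) \<longlonglongrightarrow> (\<integral>p. ?K v p \<partial>(M \<Otimes>\<^sub>M M))"
  proof (rule integral_dominated_convergence[where w="\<lambda>_. L * B * W * W"])
    show "?K v \<in> borel_measurable (M \<Otimes>\<^sub>M M)" by measurable
    show "?K (c n) \<in> borel_measurable (M \<Otimes>\<^sub>M M)" for n unfolding c_def by measurable
    show "integrable (M \<Otimes>\<^sub>M M) (\<lambda>_. L * B * W * W)" using finite_measure.integrable_const[OF fin] .
    show "AE p in M \<Otimes>\<^sub>M M. (\<lambda>n. ?K (c n) p) \<longlonglongrightarrow> ?K v p"
    proof (rule AE_I2)
      fix p
      have lim: "(\<lambda>n. c n x) \<longlonglongrightarrow> v x" for x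
      proof (rule tendsto_eventually)
        obtain N :: nat where "\<bar>v x\<bar> \<le> real N" using real_arch_simple by blast
        then show "\<forall>\<^sub>F n in sequentially. c n x = v x"
          by (intro eventually_sequentiallyI[of N]) (auto simp: c_def max_def min_def)
      qed
      show "(\<lambda>n. ?K (c n) p) \<longlonglongrightarrow> ?K v p"
        by (intro tendsto_intros lim)
    qed
    show "AE p in M \<Otimes>\<^sub>M M. norm (?K (c n) p) \<le> L * B * W * W" for n
    proof (rule AE_I2)
      fix p
      have LB: "0 \<le> L * B" using L B[of 0] by simp
      have "norm (?K (c n) p) = \<bar>(c n (pos (fst p)) - c n (pos (snd p))) * far1 \<kappa> (2 * s) e (pos (fst p) - pos (snd p))\<bar> * \<bar>w (snd p)\<bar> * \<bar>w (fst p)\<bar>"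
        by (simp add: abs_mult)
      also have "\<dots> \<le> L * B * W * W"
        using LB W_nonneg by (intro mult_mono kb cL w_bound) auto
      finally show "norm (?K (c n) p) \<le> L * B * W * W" .
    qed
  qed
  then have "(\<lambda>n. pairing (\<lambda>x y. (c n x - c n y) * far1 \<kappa> (2 * s) e (x - y))) \<longlonglongrightarrow>
     pairing (\<lambda>x y. (v x - v y) * far1 \<kappa> (2 * s) e (x - y))"
    unfolding pe[OF cL] pe[OF v] .
  from tendsto_rabs[OF this] show ?thesis
    by (rule tendsto_upperbound) (auto intro!: always_eventually far_commutator_bounded[OF e cb cL])
qed

end

section \<open>Truncation near time zero\<close>

definition near :: "real \<Rightarrow> real \<Rightarrow> 'a::euclidean_space \<Rightarrow> real" where
  "near \<kappa> T z = mix \<kappa> (real DIM('a)) {0<..T} 0 ((norm z)\<^sup>2)"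

text \<open>The scalar by which z is multiplied in the gradient of the near kernel; in contrast to
  \<open>far1\<close>, the direction is left out.\<close>

definition near1 :: "real \<Rightarrow> real \<Rightarrow> 'a::euclidean_space \<Rightarrow> real" where
  "near1 \<kappa> T z = 2 * mix \<kappa> (real DIM('a)) {0<..T} 1 ((norm z)\<^sup>2)"

lemma near_nonneg [simp]: "0 \<le> near \<kappa> T z"
  by (simp add: near_def mix_0_nonneg)

lemma near_minus [simp]: "near \<kappa> T (- z) = near \<kappa> T z"
  by (simp add: near_def)

lemma near_eq_heat: "near \<kappa> T z = (\<integral>t. indicator {0<..T} t * heat t z \<partial>clock \<kappa>)"
  by (simp add: near_def mix_def rad_0_heat)

context
  fixes \<kappa> :: real
  assumes \<kappa>: "0 < \<kappa>"
begin

lemma measurable_near: "(near \<kappa> T :: 'a::euclidean_space \<Rightarrow> real) \<in> borel_measurable borel"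
  unfolding near_def[abs_def] by (intro measurable_mix \<kappa>) measurable

lemma measurable_near1: "(near1 \<kappa> T :: 'a::euclidean_space \<Rightarrow> real) \<in> borel_measurable borel"
  unfolding near1_def[abs_def] by (intro borel_measurable_times borel_measurable_const measurable_mix \<kappa>) measurable

lemma regular_near:
  assumes "z \<noteq> 0"
  shows "regular {0<..T} ((norm z)\<^sup>2)"
  using assms by (auto simp: regular_def)

lemma near_add_far:
  fixes z :: "'a::euclidean_space"
  assumes T: "0 < T" and z: "z \<noteq> 0"
  shows "yukawa \<kappa> z = near \<kappa> T z + far \<kappa> T z"
    and "gradient (yukawa \<kappa>) z \<bullet> e = near1 \<kappa> T z * (z \<bullet> e) + far1 \<kappa> T e z"
proof -
  have U: "{0<..T} \<union> {T<..} = {0<..}" using T by auto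
  have m: "mix \<kappa> (real DIM('a)) {0<..} k ((norm z)\<^sup>2) =
     mix \<kappa> (real DIM('a)) {0<..T} k ((norm z)\<^sup>2) + mix \<kappa> (real DIM('a)) {T<..} k ((norm z)\<^sup>2)" for k
    unfolding U[symmetric]
    by (intro mix_disjoint_union \<kappa> regular_near z regular_greaterThan T) auto
  show "yukawa \<kappa> z = near \<kappa> T z + far \<kappa> T z"
    unfolding yukawa_eq_mix[OF \<kappa> z] m near_def far_def ..
  show "gradient (yukawa \<kappa>) z \<bullet> e = near1 \<kappa> T z * (z \<bullet> e) + far1 \<kappa> T e z"
    unfolding gradient_yukawa[OF \<kappa> z] m near1_def far1_def by (simp add: algebra_simps)
qed

lemma near_mono:
  fixes z :: "'a::euclidean_space"
  assumes z: "z \<noteq> 0" and "S \<le> T"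
  shows "near \<kappa> S z \<le> near \<kappa> T z"
  unfolding near_def using assms(2) by (intro mix_0_mono \<kappa> regular_near z) auto

text \<open>Each heat kernel has mass one and the screening weight is at most one, so the mass is at
  most the length of the time interval. This bound carries no negative power of \<kappa>.\<close>

lemma nn_integral_near_le:
  assumes T: "0 < T"
  shows "(\<integral>\<^sup>+z. ennreal (near \<kappa> T (z::'a::euclidean_space)) \<partial>lborel) \<le> ennreal T"
proof -
  interpret finite_measure "clock \<kappa>" using \<kappa> by (rule finite_measure_clock)
  interpret P: pair_sigma_finite lborel "clock \<kappa>" ..
  \<comment> \<open>The time integrand may fail to be integrable at z = 0. The Bochner integral is
    then 0, so only an inequality holds at every point.\<close>
  have le: "ennreal (near \<kappa> T z) \<le> (\<integral>\<^sup>+t. ennreal (indicator {0<..T} t * heat t (z::'a)) \<partial>clock \<kappa>)" for z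
  proof (cases "integrable (clock \<kappa>) (\<lambda>t. indicator {0<..T} t * heat t z)")
    case True
    then show ?thesis
      unfolding near_eq_heat by (subst nn_integral_eq_integral) auto
  next
    case False
    then show ?thesis unfolding near_eq_heat by (simp add: not_integrable_integral_eq)
  qed
  have inner: "(\<integral>\<^sup>+z. ennreal (indicator {0<..T} t * heat t (z::'a)) \<partial>lborel) = indicator {0<..T} t" for t
    by (cases "t \<in> {0<..T}") (auto simp: nn_integral_heat)
  have "(\<integral>\<^sup>+z. ennreal (near \<kappa> T (z::'a)) \<partial>lborel) \<le>
      (\<integral>\<^sup>+z. \<integral>\<^sup>+t. ennreal (indicator {0<..T} t * heat t (z::'a)) \<partial>clock \<kappa> \<partial>lborel)"
    by (intro nn_integral_mono le)
  also have "\<dots> = (\<integral>\<^sup>+t. \<integral>\<^sup>+z. ennreal (indicator {0<..T} t * heat t (z::'a)) \<partial>lborel \<partial>clock \<kappa>)"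
    by (rule P.Fubini'[symmetric]) measurable
  also have "\<dots> = (\<integral>\<^sup>+t. ennreal (indicator {0<..} t * exp (- (\<kappa>\<^sup>2 * t))) * indicator {0<..T} t \<partial>lborel)"
    unfolding inner by (subst nn_integral_clock) auto
  also have "\<dots> \<le> (\<integral>\<^sup>+t. indicator {0..T} t \<partial>lborel)"
    using \<kappa> by (intro nn_integral_mono) (auto simp: indicator_def)
  also have "\<dots> = ennreal T" using T by simp
  finally show ?thesis .
qed

lemma integrable_near:
  assumes T: "0 < T"
  shows "integrable lborel (near \<kappa> T :: 'a::euclidean_space \<Rightarrow> real)"
    and "(LBINT z. near \<kappa> T (z::'a)) \<le> T"
proof -
  show i: "integrable lborel (near \<kappa> T :: 'a::euclidean_space \<Rightarrow> real)"
    using le_less_trans[OF nn_integral_near_le[OF T, where ?'a='a] ennreal_less_top]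
    by (simp add: integrable_iff_bounded measurable_near)
  have "ennreal (LBINT z. near \<kappa> T (z::'a)) = (\<integral>\<^sup>+z. ennreal (near \<kappa> T (z::'a)) \<partial>lborel)"
    by (rule nn_integral_eq_integral[symmetric, OF i]) simp
  also have "\<dots> \<le> ennreal T" by (rule nn_integral_near_le[OF T])
  finally show "(LBINT z. near \<kappa> T (z::'a)) \<le> T"
    using T by (simp add: ennreal_le_iff)
qed

text \<open>Inside the time integral |z|^2/(2t) is absorbed at the price of doubling t; substituting
  r = 2t yields the near kernel up to 2T. The Jacobian cancels the factor 2 of
  \<open>inner_le_norm_heat\<close>.\<close>

lemma near1_le_near:
  fixes z :: "'a::euclidean_space"
  assumes z: "z \<noteq> 0" and T: "0 < T"
  shows "(norm z)\<^sup>2 * \<bar>near1 \<kappa> T z\<bar> \<le> 2 powr (real DIM('a) / 2) * exp (\<kappa>\<^sup>2 * T) * near \<kappa> (2 * T) z"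
proof -
  let ?D = "2 powr (real DIM('a) / 2)"
  let ?i = "\<lambda>t. indicator {0<..} t * exp (- (\<kappa>\<^sup>2 * t)) :: real"
  define g where "g r = ?i r * (indicator {0<..2 * T} r * heat r z)" for r
  have ig: "integrable lborel g"
  proof -
    have "(\<lambda>r. indicator {0<..2 * T} r * heat r z) \<in> borel_measurable borel" by measurable
    from integrable_clock_iff[OF this, of \<kappa>] show ?thesis
      using integrable_mix[OF \<kappa> regular_near[OF z], of "real DIM('a)" "2 * T" 0] by (simp add: g_def[abs_def] rad_0_heat)
  qed
  have ig2: "integrable lborel (\<lambda>t. g (2 * t))"
    using lborel_integrable_real_affine[OF ig, of 2 0] by simp
  have near2: "near \<kappa> (2 * T) z = 2 * (LBINT t. g (2 * t))"
  proof -
    have "near \<kappa> (2 * T) z = (LBINT r. g r)"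
      unfolding near_eq_heat g_def by (rule integral_clock) measurable
    also have "\<dots> = 2 * (LBINT t. g (2 * t))"
      using lborel_integral_real_affine[of 2 g 0] by simp
    finally show ?thesis .
  qed
  define G where "G t = ?i t * ((norm z)\<^sup>2 * (2 * (indicator {0<..T} t * rad (real DIM('a)) 1 ((norm z)\<^sup>2) t)))" for t
  have Gm: "(norm z)\<^sup>2 * near1 \<kappa> T z = (LBINT t. G t)"
  proof -
    have "(norm z)\<^sup>2 * near1 \<kappa> T z = (\<integral>t. (norm z)\<^sup>2 * (2 * (indicator {0<..T} t * rad (real DIM('a)) 1 ((norm z)\<^sup>2) t)) \<partial>clock \<kappa>)"
      unfolding near1_def mix_def by (simp only: integral_mult_right_zero)
    also have "\<dots> = (LBINT t. G t)"
      unfolding G_def by (rule integral_clock) measurable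
    finally show ?thesis .
  qed
  have pt: "\<bar>G t\<bar> \<le> 2 * ?D * exp (\<kappa>\<^sup>2 * T) * g (2 * t)" for t
  proof (cases "0 < t \<and> t \<le> T")
    case True
    then have t: "0 < t" "t \<le> T" by auto
    have r: "(norm z)\<^sup>2 * (2 * rad (real DIM('a)) 1 ((norm z)\<^sup>2) t) = - ((norm z)\<^sup>2 / (2 * t) * heat t z)"
      using t by (simp add: rad_Suc rad_0_heat)
    have "\<bar>G t\<bar> = exp (- (\<kappa>\<^sup>2 * t)) * ((norm z)\<^sup>2 / (2 * t) * heat t z)"
    proof -
      have "G t = exp (- (\<kappa>\<^sup>2 * t)) * ((norm z)\<^sup>2 * (2 * rad (real DIM('a)) 1 ((norm z)\<^sup>2) t))"
        using t by (simp add: G_def)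
      then show ?thesis unfolding r using t by (simp add: abs_mult)
    qed
    also have "\<dots> \<le> exp (- (\<kappa>\<^sup>2 * t)) * (2 * ?D * heat (2 * t) z)"
      by (intro mult_left_mono inner_le_norm_heat t) auto
    \<comment> \<open>The screening weight has to be evaluated at the doubled time 2t; on t \<le> T
      this costs at most exp (\<kappa>^2 T).\<close>
    also have "\<dots> \<le> (exp (\<kappa>\<^sup>2 * T) * exp (- (\<kappa>\<^sup>2 * (2 * t)))) * (2 * ?D * heat (2 * t) z)"
    proof (intro mult_right_mono)
      have "\<kappa>\<^sup>2 * t \<le> \<kappa>\<^sup>2 * T" using t by (intro mult_left_mono) auto
      then show "exp (- (\<kappa>\<^sup>2 * t)) \<le> exp (\<kappa>\<^sup>2 * T) * exp (- (\<kappa>\<^sup>2 * (2 * t)))"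
        unfolding exp_add[symmetric] exp_le_cancel_iff by linarith
    qed simp
    also have "\<dots> = 2 * ?D * exp (\<kappa>\<^sup>2 * T) * g (2 * t)"
      using t by (simp add: g_def)
    finally show ?thesis .
  qed (auto simp: G_def g_def)
  have "(norm z)\<^sup>2 * \<bar>near1 \<kappa> T z\<bar> = \<bar>\<integral>t. G t \<partial>lborel\<bar>"
    unfolding Gm[symmetric] abs_mult by simp
  moreover have "\<bar>\<integral>t. G t \<partial>lborel\<bar> \<le> (LBINT t. \<bar>G t\<bar>)" by (rule integral_abs_bound)
  moreover have "(LBINT t. \<bar>G t\<bar>) \<le> (LBINT t. 2 * ?D * exp (\<kappa>\<^sup>2 * T) * g (2 * t))"
    using pt by (intro integral_mono' integrable_mult_right ig2) (auto simp: g_def)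
  moreover have "(LBINT t. 2 * ?D * exp (\<kappa>\<^sup>2 * T) * g (2 * t)) = 2 * ?D * exp (\<kappa>\<^sup>2 * T) * (LBINT t. g (2 * t))"
    by (rule integral_mult_right_zero)
  moreover have "\<dots> = ?D * exp (\<kappa>\<^sup>2 * T) * near \<kappa> (2 * T) z"
    unfolding near2 by simp
  ultimately show ?thesis by linarith
qed

text \<open>The near kernel up to 2T contains the times in [T, 2T], an interval of length T. There
  each heat kernel is at least 2^(-d/2) times the one at T, and the weight is at least exp
  (-2\<kappa>^2 T).\<close>

lemma heat_le_near:
  fixes z :: "'a::euclidean_space"
  assumes z: "z \<noteq> 0" and T: "0 < T"
  shows "T * heat T z \<le> 2 powr (real DIM('a) / 2) * exp (2 * \<kappa>\<^sup>2 * T) * near \<kappa> (2 * T) z"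
proof -
  let ?D = "2 powr (real DIM('a) / 2)"
  let ?i = "\<lambda>t. indicator {0<..} t * exp (- (\<kappa>\<^sup>2 * t)) :: real"
  let ?g = "\<lambda>r. ?i r * (indicator {0<..2 * T} r * heat r z)"
  have m: "(\<lambda>r. indicator {0<..2 * T} r * heat r z) \<in> borel_measurable borel" by measurable
  have ig: "integrable lborel ?g"
    using integrable_clock_iff[OF m, of \<kappa>]
      integrable_mix[OF \<kappa> regular_near[OF z], of "real DIM('a)" "2 * T" 0] by (simp add: rad_0_heat)
  define c where "c = exp (- (2 * \<kappa>\<^sup>2 * T)) * (heat T z / ?D)"
  have c: "0 \<le> c" by (simp add: c_def)
  have pt: "indicator {T..2 * T} t * c \<le> ?g t" for t
  proof (cases "t \<in> {T..2 * T}")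
    case True
    then have t: "T \<le> t" "t \<le> 2 * T" "0 < t" using T by auto
    have "heat T z / ?D = (4 * pi * (2 * T)) powr (- (real DIM('a) / 2)) * exp (- ((norm z)\<^sup>2 / (4 * T)))"
    proof -
      have "4 * pi * (2 * T) = 2 * (4 * pi * T)" by simp
      then have "(4 * pi * (2 * T)) powr (- (real DIM('a) / 2)) = 2 powr (- (real DIM('a) / 2)) * (4 * pi * T) powr (- (real DIM('a) / 2))"
        by (simp only: powr_mult)
      moreover have "2 powr (- (real DIM('a) / 2)) = 1 / ?D"
        by (rule powr_minus_divide)
      ultimately show ?thesis unfolding heat_def by simp
    qed
    also have "\<dots> \<le> heat t z"
      unfolding heat_def
    proof (rule mult_mono)
      show "(4 * pi * (2 * T)) powr (- (real DIM('a) / 2)) \<le> (4 * pi * t) powr (- (real DIM('a) / 2))"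
        using t by (intro powr_mono2') auto
      show "exp (- ((norm z)\<^sup>2 / (4 * T))) \<le> exp (- ((norm z)\<^sup>2 / (4 * t)))"
        using t T by (simp add: frac_le)
    qed auto
    finally have h: "heat T z / ?D \<le> heat t z" .
    have "\<kappa>\<^sup>2 * t \<le> 2 * \<kappa>\<^sup>2 * T" using mult_left_mono[OF t(2), of "\<kappa>\<^sup>2"] by simp
    then have "c \<le> exp (- (\<kappa>\<^sup>2 * t)) * heat t z"
      unfolding c_def by (intro mult_mono h) auto
    then show ?thesis using True t by simp
  qed simp
  have "T * c = (LBINT t. indicator {T..2 * T} t * c)" using T by simp
  also have "\<dots> \<le> (LBINT t. ?g t)"
    using pt by (intro integral_mono' ig) auto
  also have "\<dots> = near \<kappa> (2 * T) z"
    unfolding near_eq_heat by (rule integral_clock[OF m, symmetric])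
  finally have "T * c * (?D * exp (2 * \<kappa>\<^sup>2 * T)) \<le> near \<kappa> (2 * T) z * (?D * exp (2 * \<kappa>\<^sup>2 * T))"
    by (intro mult_right_mono) auto
  moreover have "T * c * (?D * exp (2 * \<kappa>\<^sup>2 * T)) = T * heat T z"
  proof -
    have "exp (- (2 * \<kappa>\<^sup>2 * T)) * exp (2 * \<kappa>\<^sup>2 * T) = 1" by (simp flip: exp_add)
    moreover have "T * c * (?D * exp (2 * \<kappa>\<^sup>2 * T)) =
        T * (exp (- (2 * \<kappa>\<^sup>2 * T)) * exp (2 * \<kappa>\<^sup>2 * T)) * (heat T z / ?D * ?D)"
      unfolding c_def by (simp only: mult_ac)
    ultimately show ?thesis by simp
  qed
  ultimately show ?thesis by (simp only: mult_ac)
qed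

end

section \<open>Self-interaction: the far kernel at the origin\<close>

lemma far_zero_antimono:
  assumes \<kappa>: "0 < \<kappa>" and S: "0 < S" and ST: "S \<le> T"
  shows "far \<kappa> T (0::'a::euclidean_space) \<le> far \<kappa> S (0::'a)"
  unfolding far_def using ST by (intro mix_0_mono \<kappa> regular_greaterThan S) auto

text \<open>The time integral of exp (-\<kappa>^2 t)/(4 pi t) is cut at 1/\<kappa>^2. Below, the
  weight is bounded by 1 and the integral is logarithmic; above, 1/t \<le> \<kappa>^2 and the mass
  of \<open>clock\<close> is at most 1/\<kappa>^2. The coefficient of ln \<kappa> must be exact,
  since \<open>c_norm\<close> has to cancel it.\<close>

lemma far_zero_le_planar:
  assumes \<kappa>: "0 < \<kappa>" and \<eta>: "0 < \<eta>" "\<kappa> * \<eta> \<le> 1" and d: "DIM('a::euclidean_space) = 2"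
  shows "far \<kappa> (\<eta>\<^sup>2) (0::'a) \<le> (1 - 2 * ln \<kappa> - 2 * ln \<eta>) / (4 * pi)"
proof -
  define T S where "T = \<eta>\<^sup>2" and "S = 1 / \<kappa>\<^sup>2"
  have T: "0 < T" using \<eta> by (simp add: T_def)
  have "(\<kappa> * \<eta>)\<^sup>2 \<le> 1" using \<kappa> \<eta> by (simp add: power_le_one)
  then have TS: "T \<le> S" unfolding T_def S_def using \<kappa> by (simp add: power_mult_distrib field_simps)
  interpret finite_measure "clock \<kappa>" using \<kappa> by (rule finite_measure_clock)
  let ?i = "\<lambda>t. indicator {0<..} t * exp (- (\<kappa>\<^sup>2 * t)) :: real"
  have e: "integrable lborel (\<lambda>t. ?i t * 1)"
    by (subst integrable_clock_iff[symmetric]) auto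
  have total: "(LBINT t. ?i t * 1) \<le> 1 / \<kappa>\<^sup>2"
  proof -
    have "(LBINT t. ?i t * 1) = measure (clock \<kappa>) UNIV"
      by (subst integral_clock[symmetric]) auto
    also have "\<dots> \<le> 1 / \<kappa>\<^sup>2"
      unfolding measure_def using emeasure_clock_le[OF \<kappa>] by (intro enn2real_leI) auto
    finally show ?thesis .
  qed
  have l: "integrable lborel (\<lambda>t. indicator {T..S} t *\<^sub>R (1 / t))"
  proof -
    have "continuous_on {T..S} (\<lambda>t. 1 / t)" using T by (intro continuous_intros) auto
    from borel_integrable_atLeastAtMost'[OF this] show ?thesis by (simp only: set_integrable_def)
  qed
  have lnint: "(LBINT t. indicator {T..S} t *\<^sub>R (1 / t)) = ln S - ln T"
  proof (rule integral_FTC_atLeastAtMost[OF TS])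
    fix t assume "T \<le> t"
    then have "0 < t" using T by simp
    then have "(ln has_real_derivative 1 / t) (at t)" by (rule DERIV_ln_divide)
    then show "(ln has_vector_derivative 1 / t) (at t within {T..S})"
      unfolding has_real_derivative_iff_has_vector_derivative by (rule has_vector_derivative_at_within)
  next
    show "continuous_on {T..S} (\<lambda>t. 1 / t)" using T by (intro continuous_intros) auto
  qed
  have "far \<kappa> T (0::'a) = (\<integral>t. indicator {T<..} t * heat t (0::'a) \<partial>clock \<kappa>)"
    using far_eq_env[OF \<kappa> T, of "0::'a"] env_def[OF \<kappa> T, of 1 "0::'a"] by simp
  also have "\<dots> = (LBINT t. ?i t * (indicator {T<..} t * heat t (0::'a)))"
    by (rule integral_clock) measurable
  also have "\<dots> \<le> (LBINT t. (1 / (4 * pi)) * (indicator {T..S} t *\<^sub>R (1 / t) + \<kappa>\<^sup>2 * (?i t * 1)))"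
  proof (rule integral_mono')
    show "integrable lborel (\<lambda>t. (1 / (4 * pi)) * (indicator {T..S} t *\<^sub>R (1 / t) + \<kappa>\<^sup>2 * (?i t * 1)))"
      by (intro integrable_mult_right Bochner_Integration.integrable_add l e)
    fix t :: real
    have b0: "0 \<le> indicator {T..S} t *\<^sub>R (1 / t)" using T by (auto simp: indicator_def)
    then show nn: "0 \<le> (1 / (4 * pi)) * (indicator {T..S} t *\<^sub>R (1 / t) + \<kappa>\<^sup>2 * (?i t * 1))"
      by (intro mult_nonneg_nonneg add_nonneg_nonneg) auto
    show "?i t * (indicator {T<..} t * heat t (0::'a)) \<le> (1 / (4 * pi)) * (indicator {T..S} t *\<^sub>R (1 / t) + \<kappa>\<^sup>2 * (?i t * 1))"
    proof (cases "T < t")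
      case True
      then have t: "0 < t" using T by simp
      have h: "heat t (0::'a) = (1 / (4 * pi)) * (1 / t)"
        using t d by (simp add: heat_zero powr_minus_divide)
      have "exp (- (\<kappa>\<^sup>2 * t)) * (1 / t) \<le> indicator {T..S} t *\<^sub>R (1 / t) + \<kappa>\<^sup>2 * exp (- (\<kappa>\<^sup>2 * t))"
      proof (cases "t \<le> S")
        case True
        have "exp (- (\<kappa>\<^sup>2 * t)) * (1 / t) \<le> 1 * (1 / t)" using t by (intro mult_right_mono) auto
        moreover have "0 \<le> \<kappa>\<^sup>2 * exp (- (\<kappa>\<^sup>2 * t))" by simp
        moreover have "indicator {T..S} t *\<^sub>R (1 / t) = 1 / t" using True \<open>T < t\<close> by simp
        ultimately show ?thesis by linarith
      next
        case False
        then have "1 / t \<le> \<kappa>\<^sup>2" using t \<kappa> by (simp add: S_def field_simps)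
        then have "exp (- (\<kappa>\<^sup>2 * t)) * (1 / t) \<le> exp (- (\<kappa>\<^sup>2 * t)) * \<kappa>\<^sup>2" by (intro mult_left_mono) auto
        then show ?thesis using False by (simp add: mult.commute)
      qed
      then have "(1 / (4 * pi)) * (exp (- (\<kappa>\<^sup>2 * t)) * (1 / t)) \<le> (1 / (4 * pi)) * (indicator {T..S} t *\<^sub>R (1 / t) + \<kappa>\<^sup>2 * exp (- (\<kappa>\<^sup>2 * t)))"
        by (intro mult_left_mono) auto
      moreover have "?i t * (indicator {T<..} t * heat t (0::'a)) = (1 / (4 * pi)) * (exp (- (\<kappa>\<^sup>2 * t)) * (1 / t))"
        unfolding h using True t by simp
      moreover have "?i t = exp (- (\<kappa>\<^sup>2 * t))" using t by simp
      ultimately show ?thesis by (simp only: mult_1_right)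
    qed (use nn in simp)
  qed
  also have "\<dots> = (1 / (4 * pi)) * ((ln S - ln T) + \<kappa>\<^sup>2 * (LBINT t. ?i t * 1))"
    unfolding integral_mult_right_zero Bochner_Integration.integral_add[OF l integrable_mult_right[OF e]] lnint by (rule refl)
  also have "\<dots> \<le> (1 / (4 * pi)) * ((ln S - ln T) + \<kappa>\<^sup>2 * (1 / \<kappa>\<^sup>2))"
    by (intro mult_left_mono add_left_mono total) auto
  also have "\<dots> = (1 - 2 * ln \<kappa> - 2 * ln \<eta>) / (4 * pi)"
  proof -
    have "ln S = - (2 * ln \<kappa>)" "ln T = 2 * ln \<eta>"
      unfolding S_def T_def using \<kappa> \<eta> by (auto simp: ln_div ln_realpow)
    then show ?thesis using \<kappa> by simp
  qed
  finally show ?thesis unfolding T_def .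
qed

text \<open>For a = d/2 \<ge> 3/2 the power t^(-a) is integrable at infinity, so bounding the
  screening weight by 1 is affordable. The constant 2 bounds 1/(a - 1).\<close>

lemma far_zero_le_spatial:
  assumes \<kappa>: "0 < \<kappa>" and \<eta>: "0 < \<eta>" and d: "3 \<le> DIM('a::euclidean_space)"
  shows "far \<kappa> (\<eta>\<^sup>2) (0::'a) \<le> 2 * \<eta> powr (2 - real DIM('a))"
proof -
  define T a where "T = \<eta>\<^sup>2" and "a = real DIM('a) / 2"
  have T: "0 < T" using \<eta> by (simp add: T_def)
  have a: "3 / 2 \<le> a" using d by (simp add: a_def)
  let ?f = "\<lambda>t::real. t powr (- a)"
  have "(\<integral>\<^sup>+t. ennreal (?f t) * indicator {T..} t \<partial>lborel) = ennreal (0 - (- (T powr (1 - a) / (a - 1))))"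
  proof (rule nn_integral_FTC_atLeast)
    fix t :: real assume "T \<le> t"
    then have "0 < t" using T by simp
    have "- ((1 - a) * t powr (1 - a - 1) / (a - 1)) = ?f t"
      using a by (simp add: divide_simps) (simp add: algebra_simps)
    then show "((\<lambda>t. - (t powr (1 - a) / (a - 1))) has_real_derivative ?f t) (at t)"
      by (rule DERIV_cong[OF DERIV_minus[OF DERIV_cdivide[OF has_real_derivative_powr[OF \<open>0 < t\<close>]]]])
    show "0 \<le> ?f t" by simp
  next
    have "((\<lambda>t::real. t powr (1 - a)) \<longlongrightarrow> 0) at_top"
      using a by (intro tendsto_neg_powr filterlim_ident) auto
    then have "((\<lambda>t::real. - (t powr (1 - a) / (a - 1))) \<longlongrightarrow> - (0 / (a - 1))) at_top"
      using a by (intro tendsto_minus tendsto_divide tendsto_const) auto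
    then show "((\<lambda>t::real. - (t powr (1 - a) / (a - 1))) \<longlongrightarrow> 0) at_top" by simp
  qed measurable
  then have I: "(\<integral>\<^sup>+t. ennreal (?f t) * indicator {T..} t \<partial>lborel) = ennreal (T powr (1 - a) / (a - 1))" by simp
  have "ennreal (far \<kappa> T (0::'a)) = (\<integral>\<^sup>+t. ennreal (indicator {T<..} t * heat (1 * t) (0::'a)) \<partial>clock \<kappa>)"
    unfolding far_eq_env[OF \<kappa> T] env_def[OF \<kappa> T]
    by (intro nn_integral_eq_integral[symmetric] integrable_env \<kappa> T AE_I2) auto
  also have "\<dots> = (\<integral>\<^sup>+t. ennreal (indicator {0<..} t * exp (- (\<kappa>\<^sup>2 * t))) * ennreal (indicator {T<..} t * heat (1 * t) (0::'a)) \<partial>lborel)"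
    by (rule nn_integral_clock) measurable
  also have "\<dots> \<le> (\<integral>\<^sup>+t. ennreal (?f t) * indicator {T..} t \<partial>lborel)"
  proof (rule nn_integral_mono)
    fix t :: real
    show "ennreal (indicator {0<..} t * exp (- (\<kappa>\<^sup>2 * t))) * ennreal (indicator {T<..} t * heat (1 * t) (0::'a)) \<le> ennreal (?f t) * indicator {T..} t"
    proof (cases "T < t")
      case True
      then have t: "0 < t" using T by simp
      have "heat t (0::'a) \<le> ?f t"
        unfolding heat_zero a_def[symmetric] using t a pi_ge_two by (intro powr_mono2') auto
      then have "exp (- (\<kappa>\<^sup>2 * t)) * heat t (0::'a) \<le> 1 * ?f t" using t by (intro mult_mono) auto
      then show ?thesis using True t by (simp flip: ennreal_mult)
    qed simp
  qed
  finally have "far \<kappa> T (0::'a) \<le> T powr (1 - a) / (a - 1)"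
    unfolding I using a by (subst (asm) ennreal_le_iff) auto
  also have "\<dots> \<le> T powr (1 - a) / (1 / 2)" using a by (intro divide_left_mono) auto
  also have "T powr (1 - a) = \<eta> powr (2 - real DIM('a))"
  proof -
    have "T = \<eta> powr 2" using \<eta> by (simp add: T_def powr_numeral)
    moreover have "2 * (1 - a) = 2 - real DIM('a)" by (simp add: a_def)
    ultimately show ?thesis by (simp only: powr_powr)
  qed
  finally show ?thesis by (simp add: T_def)
qed

text \<open>In the plane the two occurrences of ln \<kappa> cancel exactly, leaving (1 - 2 ln
  \<eta>)/(4 pi). In higher dimension \<open>c_norm\<close> is 0. Either way the right side is free
  of \<kappa>.\<close>

lemma far_zero_add_c_norm_le:
  assumes \<kappa>: "0 < \<kappa>" and \<eta>: "0 < \<eta>" "\<eta> \<le> 1" "\<kappa> * \<eta> \<le> 1" and d: "2 \<le> DIM('a::euclidean_space)"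
  shows "far \<kappa> (\<eta>\<^sup>2) (0::'a) + c_norm \<kappa> DIM('a) \<le> 2 * ell DIM('a) \<eta>"
proof (cases "DIM('a) = 2")
  case True
  have l: "0 \<le> - ln \<eta>" using \<eta> by simp
  have "far \<kappa> (\<eta>\<^sup>2) (0::'a) + ln \<kappa> / (2 * pi) \<le> (1 - 2 * ln \<kappa> - 2 * ln \<eta>) / (4 * pi) + ln \<kappa> / (2 * pi)"
    by (intro add_right_mono far_zero_le_planar \<kappa> \<eta> True)
  also have "\<dots> = (1 - 2 * ln \<eta>) / (4 * pi)"
    by (simp add: field_simps)
  also have "\<dots> \<le> (1 - 2 * ln \<eta>) / 1"
    using l pi_ge_two by (intro divide_left_mono) auto
  also have "\<dots> \<le> 2 * ell 2 \<eta>" using l \<eta> by (simp add: ell_def ln_div)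
  finally show ?thesis unfolding c_norm_def True by simp
next
  case False
  then show ?thesis
    using far_zero_le_spatial[OF \<kappa> \<eta>(1), where ?'a='a] d by (simp add: c_norm_def ell_def)
qed

section \<open>Particles and background\<close>

locale configuration =
  fixes N :: nat and X :: "nat \<Rightarrow> 'a::euclidean_space" and \<rho> :: "'a \<Rightarrow> real" and \<Lambda> :: real
  assumes N: "0 < N" and inj: "inj_on X {..<N}" and density: "prob_density \<rho>"
    and rho_le: "AE x in lborel. \<bar>\<rho> x\<bar> \<le> \<Lambda>" and Lambda: "0 \<le> \<Lambda>"
begin

lemma rho_measurable [measurable]: "\<rho> \<in> borel_measurable borel"
  and rho_nonneg: "AE x in lborel. 0 \<le> \<rho> x"
  and rho_integrable: "integrable lborel \<rho>"
  and rho_integral: "(LBINT x. \<rho> x) = 1"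
  using density by (auto simp: prob_density_def)

lemma abs_rho_integral: "(LBINT x. \<bar>\<rho> x\<bar>) = 1"
proof -
  have "(LBINT x. \<bar>\<rho> x\<bar>) = (LBINT x. \<rho> x)"
    using rho_nonneg by (intro integral_cong_AE) auto
  then show ?thesis by (simp add: rho_integral)
qed

definition background :: "'a measure" where
  "background = density lborel (\<lambda>x. ennreal (\<rho> x))"

lemma sets_background [simp, measurable_cong]: "sets background = sets borel"
  by (simp add: background_def)

lemma space_background [simp]: "space background = UNIV"
  by (simp add: background_def)

lemma measurable_background_eq [simp]: "borel_measurable background = borel_measurable borel"
  by (intro measurable_cong_sets) auto

lemma prob_space_background: "prob_space background"
proof (rule prob_spaceI)
  have "emeasure background (space background) = (\<integral>\<^sup>+x. ennreal (\<rho> x) \<partial>lborel)"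
    unfolding background_def by (simp add: emeasure_density)
  also have "\<dots> = ennreal 1"
    unfolding rho_integral[symmetric] by (rule nn_integral_eq_integral[OF rho_integrable rho_nonneg])
  finally show "emeasure background (space background) = 1" by simp
qed

lemma integral_background:
  fixes F :: "'a \<Rightarrow> real"
  assumes [measurable]: "F \<in> borel_measurable borel"
  shows "(\<integral>x. F x \<partial>background) = (LBINT x. F x * \<rho> x)"
  unfolding background_def using rho_nonneg by (subst integral_density) (auto simp: mult.commute)

text \<open>The charge \<open>\<mu> - \<rho>\<close> as a weighted image of one product measure: the indices below \<open>N\<close>
  carry the particles and the index \<open>N\<close> carries the background.\<close>

definition charges :: "(nat \<times> 'a) measure" where
  "charges = count_space {..N} \<Otimes>\<^sub>M background"

definition position :: "nat \<times> 'a \<Rightarrow> 'a" where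
  "position p = (if fst p < N then X (fst p) else snd p)"

text \<open>The background value is a parameter so that one computation serves twice: c = -1 gives
  the signed charge, c = 1 its total variation.\<close>

definition weight :: "real \<Rightarrow> nat \<times> 'a \<Rightarrow> real" where
  "weight c p = (if fst p < N then 1 / real N else c)"

lemma measurable_position [measurable]: "position \<in> borel_measurable charges"
proof -
  have "X \<in> measurable (count_space {..N}) borel" by simp
  then have x: "(\<lambda>p. X (fst p)) \<in> borel_measurable charges"
    unfolding charges_def by (rule measurable_compose[OF measurable_fst])
  have y: "snd \<in> borel_measurable charges"
    unfolding charges_def by (simp add: measurable_snd'' cong: measurable_cong_sets)
  have "Measurable.pred (count_space {..N}) (\<lambda>i. i < N)" by simp
  then have "Measurable.pred charges (\<lambda>p. fst p < N)"
    unfolding charges_def by (rule measurable_compose[OF measurable_fst])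
  then show ?thesis
    unfolding position_def by (intro measurable_If x y) (simp add: pred_def)
qed

lemma measurable_weight [measurable]: "weight c \<in> borel_measurable charges"
  unfolding weight_def charges_def by measurable

lemma finite_measure_charges: "finite_measure charges"
proof -
  interpret prob_space background by (rule prob_space_background)
  show ?thesis
    unfolding charges_def
    by (intro finite_measure_pair_measure finite_measure_count_space) (auto intro: finite_measure_axioms)
qed

lemma integral_charges:
  fixes F :: "'a \<Rightarrow> real"
  assumes [measurable]: "F \<in> borel_measurable borel" and B: "\<And>x. \<bar>F x\<bar> \<le> B"
  shows "(\<integral>p. F (position p) * weight c p \<partial>charges) =
    1 / real N * (\<Sum>i<N. F (X i)) + c * (LBINT y. F y * \<rho> y)"
proof -
  interpret P: prob_space background by (rule prob_space_background)
  interpret Q: finite_measure "count_space {..N}" by (rule finite_measure_count_space) simp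
  interpret PQ: pair_sigma_finite "count_space {..N}" background ..
  have i: "integrable charges (\<lambda>p. F (position p) * weight c p)"
  proof (rule finite_measure.integrable_const_bound[OF finite_measure_charges, where B="B * (1 + \<bar>c\<bar>)"])
    have "0 \<le> B" using B[of 0] by linarith
    moreover have "\<bar>weight c p\<bar> \<le> 1 + \<bar>c\<bar>" for p
      using N unfolding weight_def by (auto simp: divide_le_eq_1 add_increasing2)
    ultimately show "AE p in charges. norm (F (position p) * weight c p) \<le> B * (1 + \<bar>c\<bar>)"
      using B by (auto simp: abs_mult intro!: mult_mono)
  qed measurable
  have "(\<integral>p. F (position p) * weight c p \<partial>charges) =
      (\<integral>i. (\<integral>y. F (position (i, y)) * weight c (i, y) \<partial>background) \<partial>count_space {..N})"
    using PQ.integral_fst'[OF i[unfolded charges_def]] by (simp add: charges_def)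
  also have "\<dots> = (\<Sum>i\<le>N. \<integral>y. F (position (i, y)) * weight c (i, y) \<partial>background)"
    by (rule lebesgue_integral_count_space_finite) simp
  also have "\<dots> = (\<Sum>i<N. \<integral>y. F (position (i, y)) * weight c (i, y) \<partial>background) +
      (\<integral>y. F (position (N, y)) * weight c (N, y) \<partial>background)"
    by (simp add: lessThan_Suc_atMost[symmetric])
  \<comment> \<open>For a particle index the integrand is constant in y, and the background has mass
    one.\<close>
  also have "(\<Sum>i<N. \<integral>y. F (position (i, y)) * weight c (i, y) \<partial>background) = (\<Sum>i<N. F (X i) * (1 / real N))"
    by (intro sum.cong refl) (simp add: position_def weight_def P.prob_space[simplified])
  also have "(\<integral>y. F (position (N, y)) * weight c (N, y) \<partial>background) = c * (LBINT y. F y * \<rho> y)"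
    by (simp add: position_def weight_def integral_background mult.commute)
  finally show ?thesis by (simp add: sum_distrib_left mult.commute sum_divide_distrib)
qed

sublocale charge charges position "weight (-1)" 1
proof (intro charge.intro charge_axioms.intro finite_measure_charges)
  show "\<bar>weight (- 1) a\<bar> \<le> 1" for a using N by (auto simp: weight_def divide_le_eq_1)
qed measurable

text \<open>Only the integral against the background is bounded, uniformly in the other point. This
  allows kernels that are singular on the diagonal and still controls the cross and background terms
  of \<open>offdiag_square\<close>.\<close>

definition admissible :: "('a \<Rightarrow> 'a \<Rightarrow> real) \<Rightarrow> real \<Rightarrow> bool" where
  "admissible k c \<longleftrightarrow> (\<lambda>(x, y). k x y) \<in> borel_measurable (borel \<Otimes>\<^sub>M borel) \<and>
     (\<forall>x. integrable lborel (\<lambda>y. k x y * \<rho> y) \<and> (LBINT y. \<bar>k x y * \<rho> y\<bar>) \<le> c)"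

lemma admissible_nonneg: "admissible k c \<Longrightarrow> 0 \<le> c"
proof -
  assume "admissible k c"
  then have "(LBINT y. \<bar>k undefined y * \<rho> y\<bar>) \<le> c" by (simp add: admissible_def)
  moreover have "0 \<le> (LBINT y. \<bar>k undefined y * \<rho> y\<bar>)" by simp
  ultimately show ?thesis by linarith
qed

lemma admissible_bounded:
  assumes k[measurable]: "(\<lambda>(x, y). k x y) \<in> borel_measurable (borel \<Otimes>\<^sub>M borel)" and B: "\<And>x y. \<bar>k x y\<bar> \<le> B"
  shows "admissible k B"
  unfolding admissible_def
proof (intro conjI allI k)
  fix x
  show i: "integrable lborel (\<lambda>y. k x y * \<rho> y)"
    by (rule integrable_mult_bounded[OF rho_integrable _ B]) measurable
  have "(LBINT y. \<bar>k x y * \<rho> y\<bar>) \<le> (LBINT y. B * \<bar>\<rho> y\<bar>)"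
  proof (rule integral_mono)
    show "\<bar>k x y * \<rho> y\<bar> \<le> B * \<bar>\<rho> y\<bar>" for y unfolding abs_mult by (intro mult_right_mono B) simp
  qed (use i rho_integrable in auto)
  then show "(LBINT y. \<bar>k x y * \<rho> y\<bar>) \<le> B" by (simp add: abs_rho_integral)
qed

text \<open>This is where the supremum bound of the density enters: it reduces the integral against
  \<rho> to \<Lambda> times the mass of K, whatever the position of x.\<close>

lemma admissible_convolution:
  assumes k[measurable]: "(\<lambda>(x, y). k x y) \<in> borel_measurable (borel \<Otimes>\<^sub>M borel)"
    and K: "integrable lborel K" "(LBINT z. K z) \<le> c" "\<And>z. K (- z) = K z"
    and le: "\<And>x y. \<bar>k x y\<bar> \<le> K (x - y)"
  shows "admissible k (\<Lambda> * c)"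
  unfolding admissible_def
proof (intro conjI allI k)
  fix x
  have Kxy: "K (x - y) = K (y - x)" for y by (metis K(3) minus_diff_eq)
  have Ki: "integrable lborel (\<lambda>y. \<Lambda> * K (y - x))"
    by (intro integrable_mult_right integrable_lborel_diff K)
  have ae: "AE y in lborel. \<bar>k x y * \<rho> y\<bar> \<le> \<Lambda> * K (y - x)"
    using rho_le
  proof eventually_elim
    case (elim y)
    have "\<bar>k x y\<bar> * \<bar>\<rho> y\<bar> \<le> K (y - x) * \<Lambda>"
      using elim le[of x y] Kxy[of y] by (intro mult_mono) (auto intro: order_trans[OF abs_ge_zero])
    then show ?case by (simp add: abs_mult mult.commute)
  qed
  show i: "integrable lborel (\<lambda>y. k x y * \<rho> y)"
  proof (rule Bochner_Integration.integrable_bound[OF Ki])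
    show "AE y in lborel. norm (k x y * \<rho> y) \<le> norm (\<Lambda> * K (y - x))"
      using ae by eventually_elim simp
  qed measurable
  have "(LBINT y. \<bar>k x y * \<rho> y\<bar>) \<le> (LBINT y. \<Lambda> * K (y - x))"
    using i by (intro integral_mono_AE Ki ae) auto
  also have "\<dots> = \<Lambda> * (LBINT z. K z)"
    using integral_lborel_diff[of K x] K(1) by simp
  also have "\<dots> \<le> \<Lambda> * c" by (intro mult_left_mono K Lambda)
  finally show "(LBINT y. \<bar>k x y * \<rho> y\<bar>) \<le> \<Lambda> * c" .
qed

lemma admissible_single:
  assumes "admissible k c"
  shows "\<bar>\<integral>y. k x y * \<rho> y \<partial>lborel\<bar> \<le> c"
  using assms integral_abs_bound[of lborel "\<lambda>y. k x y * \<rho> y"] unfolding admissible_def by (meson order_trans)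

lemma admissible_double:
  assumes a: "admissible k c"
  shows "integrable (lborel \<Otimes>\<^sub>M lborel) (\<lambda>(x, y). k x y * \<rho> x * \<rho> y)"
    and "integral\<^sup>L (lborel \<Otimes>\<^sub>M lborel) (\<lambda>(x, y). k x y * \<rho> x * \<rho> y) =
      (LBINT x. (LBINT y. k x y * \<rho> y) * \<rho> x)"
    and "\<bar>integral\<^sup>L (lborel \<Otimes>\<^sub>M lborel) (\<lambda>(x, y). k x y * \<rho> x * \<rho> y)\<bar> \<le> c"
proof -
  have km[measurable]: "(\<lambda>(x, y). k x y) \<in> borel_measurable (borel \<Otimes>\<^sub>M borel)"
    and ki: "\<And>x. integrable lborel (\<lambda>y. k x y * \<rho> y)" and kc: "\<And>x. (LBINT y. \<bar>k x y * \<rho> y\<bar>) \<le> c"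
    using a by (auto simp: admissible_def)
  have c: "0 \<le> c" by (rule admissible_nonneg[OF a])
  show i: "integrable (lborel \<Otimes>\<^sub>M lborel) (\<lambda>(x, y). k x y * \<rho> x * \<rho> y)"
  proof (rule lborel_pair.Fubini_integrable)
    show "integrable lborel (\<lambda>x. \<integral>y. norm (case (x, y) of (x, y) \<Rightarrow> k x y * \<rho> x * \<rho> y) \<partial>lborel)"
    proof (rule Bochner_Integration.integrable_bound)
      show "integrable lborel (\<lambda>x. c * \<bar>\<rho> x\<bar>)" using rho_integrable by simp
      show "AE x in lborel. norm (LBINT y. norm (case (x, y) of (x, y) \<Rightarrow> k x y * \<rho> x * \<rho> y)) \<le> norm (c * \<bar>\<rho> x\<bar>)"
      proof (rule AE_I2)
        fix x
        have "(LBINT y. norm (k x y * \<rho> x * \<rho> y)) = (LBINT y. \<bar>\<rho> x\<bar> * \<bar>k x y * \<rho> y\<bar>)"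
          by (simp add: abs_mult mult_ac)
        also have "\<dots> = \<bar>\<rho> x\<bar> * (LBINT y. \<bar>k x y * \<rho> y\<bar>)" by (rule integral_mult_right_zero)
        also have "\<dots> \<le> \<bar>\<rho> x\<bar> * c" by (intro mult_left_mono kc) simp
        finally show "norm (LBINT y. norm (case (x, y) of (x, y) \<Rightarrow> k x y * \<rho> x * \<rho> y)) \<le> norm (c * \<bar>\<rho> x\<bar>)"
          using c by (simp add: abs_mult mult.commute)
      qed
    qed measurable
    show "AE x in lborel. integrable lborel (\<lambda>y. case (x, y) of (x, y) \<Rightarrow> k x y * \<rho> x * \<rho> y)"
    proof (rule AE_I2)
      fix x
      have "integrable lborel (\<lambda>y. \<rho> x * (k x y * \<rho> y))" by (intro integrable_mult_right ki)
      then show "integrable lborel (\<lambda>y. case (x, y) of (x, y) \<Rightarrow> k x y * \<rho> x * \<rho> y)" by (simp add: mult_ac)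
    qed
  qed measurable
  show eq: "integral\<^sup>L (lborel \<Otimes>\<^sub>M lborel) (\<lambda>(x, y). k x y * \<rho> x * \<rho> y) =
      (LBINT x. (LBINT y. k x y * \<rho> y) * \<rho> x)"
    unfolding lborel_pair.integral_fst'[OF i, symmetric]
  proof (rule Bochner_Integration.integral_cong[OF refl])
    fix x
    have "(LBINT y. k x y * \<rho> x * \<rho> y) = (LBINT y. \<rho> x * (k x y * \<rho> y))" by (simp add: mult_ac)
    also have "\<dots> = \<rho> x * (LBINT y. k x y * \<rho> y)" by (rule integral_mult_right_zero)
    finally show "(LBINT y. (case (x, y) of (x, y) \<Rightarrow> k x y * \<rho> x * \<rho> y)) = (LBINT y. k x y * \<rho> y) * \<rho> x"
      by (simp add: mult.commute)
  qed
  have mi: "(\<lambda>x. \<integral>y. k x y * \<rho> y \<partial>lborel) \<in> borel_measurable lborel" by measurable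
  have ii: "integrable lborel (\<lambda>x. (LBINT y. k x y * \<rho> y) * \<rho> x)"
    by (rule integrable_mult_bounded[OF rho_integrable mi admissible_single[OF a]])
  have "\<bar>\<integral>x. (LBINT y. k x y * \<rho> y) * \<rho> x \<partial>lborel\<bar> \<le> (LBINT x. \<bar>(LBINT y. k x y * \<rho> y) * \<rho> x\<bar>)"
    by (rule integral_abs_bound)
  also have "\<dots> \<le> (LBINT x. c * \<bar>\<rho> x\<bar>)"
    using admissible_single[OF a] integrable_abs[OF ii] rho_integrable
    by (intro integral_mono) (auto simp: abs_mult intro!: mult_right_mono)
  finally show "\<bar>integral\<^sup>L (lborel \<Otimes>\<^sub>M lborel) (\<lambda>(x, y). k x y * \<rho> x * \<rho> y)\<bar> \<le> c"
    unfolding eq by (simp add: abs_rho_integral)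
qed

section \<open>Linearity and bounds of the off-diagonal square\<close>

lemma offdiag_square_add:
  assumes a: "admissible k c" and a': "admissible k' c'"
  shows "offdiag_square (\<lambda>x y. k x y + k' x y) N X \<rho> = offdiag_square k N X \<rho> + offdiag_square k' N X \<rho>"
proof -
  have ki: "\<And>x. integrable lborel (\<lambda>y. k x y * \<rho> y)" "\<And>x. integrable lborel (\<lambda>y. k' x y * \<rho> y)"
    using a a' by (auto simp: admissible_def)
  have 1: "(LBINT y. (k x y + k' x y) * \<rho> y) = (LBINT y. k x y * \<rho> y) + (LBINT y. k' x y * \<rho> y)" for x
    unfolding distrib_right by (rule Bochner_Integration.integral_add[OF ki])
  have 2: "integral\<^sup>L (lborel \<Otimes>\<^sub>M lborel) (\<lambda>(x, y). (k x y + k' x y) * \<rho> x * \<rho> y) =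
    integral\<^sup>L (lborel \<Otimes>\<^sub>M lborel) (\<lambda>(x, y). k x y * \<rho> x * \<rho> y) + integral\<^sup>L (lborel \<Otimes>\<^sub>M lborel) (\<lambda>(x, y). k' x y * \<rho> x * \<rho> y)"
    unfolding Bochner_Integration.integral_add[OF admissible_double(1)[OF a] admissible_double(1)[OF a'], symmetric]
    by (intro Bochner_Integration.integral_cong refl) (auto simp: distrib_right)
  show ?thesis
    unfolding offdiag_square_def 1 2 sum.distrib distrib_left by simp
qed

text \<open>The diagonal is invisible: distinct particles avoid it, and it is a null set for the
  integrals. This discards the conventional values of kernels at the origin.\<close>

lemma offdiag_square_cong:
  assumes [measurable]: "(\<lambda>(x, y). k x y) \<in> borel_measurable (borel \<Otimes>\<^sub>M borel)" "(\<lambda>(x, y). k' x y) \<in> borel_measurable (borel \<Otimes>\<^sub>M borel)"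
    and eq: "\<And>x y. x \<noteq> y \<Longrightarrow> k x y = k' x y"
  shows "offdiag_square k N X \<rho> = offdiag_square k' N X \<rho>"
proof -
  have "(\<Sum>i<N. \<Sum>j\<in>{..<N} - {i}. k (X i) (X j)) = (\<Sum>i<N. \<Sum>j\<in>{..<N} - {i}. k' (X i) (X j))"
  proof (intro sum.cong refl eq)
    fix i j assume "i \<in> {..<N}" "j \<in> {..<N} - {i}"
    then show "X i \<noteq> X j" using inj by (auto simp: inj_on_def)
  qed
  moreover have "(LBINT y. k x y * \<rho> y) = (LBINT y. k' x y * \<rho> y)" for x
  proof (rule integral_cong_AE)
    show "AE y in lborel. k x y * \<rho> y = k' x y * \<rho> y"
      using AE_lborel_singleton[of x] by eventually_elim (simp add: eq)
  qed measurable
  moreover have "integral\<^sup>L (lborel \<Otimes>\<^sub>M lborel) (\<lambda>(x, y). k x y * \<rho> x * \<rho> y) =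
     integral\<^sup>L (lborel \<Otimes>\<^sub>M lborel) (\<lambda>(x, y). k' x y * \<rho> x * \<rho> y)"
  proof (rule integral_cong_AE)
    have "AE p in lborel \<Otimes>\<^sub>M lborel. fst p \<noteq> (snd p :: 'a)"
    proof (rule lborel_pair.AE_pair_measure)
      show "{p \<in> space (lborel \<Otimes>\<^sub>M lborel). fst p \<noteq> (snd p :: 'a)} \<in> sets (lborel \<Otimes>\<^sub>M lborel)"
        by measurable
      show "AE x in lborel. AE y in lborel. fst (x, y) \<noteq> (snd (x, y) :: 'a)"
      proof (rule AE_I2)
        fix x :: 'a
        show "AE y in lborel. fst (x, y) \<noteq> snd (x, y)"
          using AE_lborel_singleton[of x] by eventually_elim auto
      qed
    qed
    then show "AE p in lborel \<Otimes>\<^sub>M lborel. (case p of (x, y) \<Rightarrow> k x y * \<rho> x * \<rho> y) = (case p of (x, y) \<Rightarrow> k' x y * \<rho> x * \<rho> y)"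
      by eventually_elim (auto simp: eq split: prod.split)
  qed measurable
  ultimately show ?thesis unfolding offdiag_square_def by simp
qed

definition pair_average :: "('a \<Rightarrow> 'a \<Rightarrow> real) \<Rightarrow> real" where
  "pair_average k = 1 / (real N)\<^sup>2 * (\<Sum>i<N. \<Sum>j\<in>{..<N} - {i}. k (X i) (X j))"

lemma pair_average_mono:
  assumes "\<And>x y. x \<noteq> y \<Longrightarrow> k x y \<le> k' x y"
  shows "pair_average k \<le> pair_average k'"
  unfolding pair_average_def
proof (intro mult_left_mono sum_mono assms)
  fix i j assume "i \<in> {..<N}" "j \<in> {..<N} - {i}"
  then show "X i \<noteq> X j" using inj by (auto simp: inj_on_def)
qed simp

lemma pair_average_cmult: "pair_average (\<lambda>x y. c * k x y) = c * pair_average k"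
  by (simp add: pair_average_def sum_distrib_left mult.left_commute)

lemma single_average_le:
  assumes a: "admissible k c"
  shows "\<bar>2 / real N * (\<Sum>i<N. \<integral>y. k (X i) y * \<rho> y \<partial>lborel)\<bar> \<le> 2 * c"
proof -
  have "\<bar>\<Sum>i<N. \<integral>y. k (X i) y * \<rho> y \<partial>lborel\<bar> \<le> (\<Sum>i<N. c)"
    by (intro order_trans[OF sum_abs] sum_mono admissible_single[OF a])
  then have "2 / real N * \<bar>\<Sum>i<N. \<integral>y. k (X i) y * \<rho> y \<partial>lborel\<bar> \<le> 2 / real N * (real N * c)"
    by (intro mult_left_mono) auto
  then show ?thesis using N by (simp add: abs_mult)
qed

text \<open>The background-background term of a nonnegative kernel may be dropped, so the only loss
  is the cross term, at most 2c.\<close>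

lemma offdiag_square_lower:
  assumes a: "admissible k c" and nn: "\<And>x y. 0 \<le> k x y"
  shows "pair_average k - 2 * c \<le> offdiag_square k N X \<rho>"
proof -
  have s: "AE x in lborel. 0 \<le> (LBINT y. k x y * \<rho> y) * \<rho> x"
    using rho_nonneg
  proof eventually_elim
    case (elim x)
    have "0 \<le> (LBINT y. k x y * \<rho> y)"
      using rho_nonneg nn by (intro integral_nonneg_AE) (auto elim!: eventually_mono)
    then show ?case using elim by simp
  qed
  have "0 \<le> integral\<^sup>L (lborel \<Otimes>\<^sub>M lborel) (\<lambda>(x, y). k x y * \<rho> x * \<rho> y)"
    unfolding admissible_double(2)[OF a] by (rule integral_nonneg_AE[OF s])
  then show ?thesis
    using single_average_le[OF a] unfolding offdiag_square_def pair_average_def by linarith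
qed

text \<open>For a signed kernel both remaining terms count: 2c from the cross term and c from the
  background.\<close>

lemma abs_offdiag_square_le:
  assumes a: "admissible k c"
  shows "\<bar>offdiag_square k N X \<rho>\<bar> \<le> pair_average (\<lambda>x y. \<bar>k x y\<bar>) + 3 * c"
proof -
  have "\<bar>\<Sum>i<N. \<Sum>j\<in>{..<N} - {i}. k (X i) (X j)\<bar> \<le> (\<Sum>i<N. \<Sum>j\<in>{..<N} - {i}. \<bar>k (X i) (X j)\<bar>)"
    by (intro order_trans[OF sum_abs] sum_mono sum_abs)
  then have "\<bar>1 / (real N)\<^sup>2 * (\<Sum>i<N. \<Sum>j\<in>{..<N} - {i}. k (X i) (X j))\<bar> \<le> pair_average (\<lambda>x y. \<bar>k x y\<bar>)"
    unfolding pair_average_def abs_mult by (intro mult_mono) auto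
  then show ?thesis
    using single_average_le[OF a] admissible_double(3)[OF a] unfolding offdiag_square_def by linarith
qed

lemma inner_pairing:
  assumes k[measurable]: "(\<lambda>(x, y). k x y) \<in> borel_measurable (borel \<Otimes>\<^sub>M borel)" and B: "\<And>x y. \<bar>k x y\<bar> \<le> B"
  shows "(\<integral>p. (\<integral>q. k (position p) (position q) * weight c q \<partial>charges) * weight c p \<partial>charges) =
    1 / (real N)\<^sup>2 * (\<Sum>i<N. \<Sum>j<N. k (X i) (X j))
    + c / real N * (\<Sum>i<N. \<integral>y. k (X i) y * \<rho> y \<partial>lborel)
    + c / real N * (\<Sum>j<N. \<integral>x. k x (X j) * \<rho> x \<partial>lborel)
    + c\<^sup>2 * integral\<^sup>L (lborel \<Otimes>\<^sub>M lborel) (\<lambda>(x, y). k x y * \<rho> x * \<rho> y)"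
proof -
  have a: "admissible k B" by (rule admissible_bounded[OF k B])
  define \<Phi> where "\<Phi> x = 1 / real N * (\<Sum>j<N. k x (X j)) + c * (LBINT y. k x y * \<rho> y)" for x
  have \<Phi>: "(\<integral>q. k x (position q) * weight c q \<partial>charges) = \<Phi> x" for x
    unfolding \<Phi>_def by (rule integral_charges[OF _ B]) measurable
  have \<Phi>m[measurable]: "\<Phi> \<in> borel_measurable borel" unfolding \<Phi>_def by measurable
  have \<Phi>b: "\<bar>\<Phi> x\<bar> \<le> B + \<bar>c\<bar> * B" for x
  proof -
    have "\<bar>\<Sum>j<N. k x (X j)\<bar> \<le> (\<Sum>j<N. B)" by (intro order_trans[OF sum_abs] sum_mono B)
    then have "\<bar>1 / real N * (\<Sum>j<N. k x (X j))\<bar> \<le> B" using N by (simp add: abs_mult field_simps)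
    moreover have "\<bar>c * (LBINT y. k x y * \<rho> y)\<bar> \<le> \<bar>c\<bar> * B"
      unfolding abs_mult by (intro mult_left_mono admissible_single[OF a]) simp
    ultimately show ?thesis unfolding \<Phi>_def by linarith
  qed
  have "(\<integral>p. \<Phi> (position p) * weight c p \<partial>charges) = 1 / real N * (\<Sum>i<N. \<Phi> (X i)) + c * (LBINT y. \<Phi> y * \<rho> y)"
    by (rule integral_charges[OF \<Phi>m \<Phi>b])
  moreover have "(\<Sum>i<N. \<Phi> (X i)) = 1 / real N * (\<Sum>i<N. \<Sum>j<N. k (X i) (X j)) + c * (\<Sum>i<N. \<integral>y. k (X i) y * \<rho> y \<partial>lborel)"
    unfolding \<Phi>_def sum.distrib sum_distrib_left by (rule refl)
  moreover have "(LBINT x. \<Phi> x * \<rho> x) = 1 / real N * (\<Sum>j<N. \<integral>x. k x (X j) * \<rho> x \<partial>lborel) +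
      c * integral\<^sup>L (lborel \<Otimes>\<^sub>M lborel) (\<lambda>(x, y). k x y * \<rho> x * \<rho> y)"
  proof -
    have ij: "integrable lborel (\<lambda>x. k x (X j) * \<rho> x)" for j
      by (rule integrable_mult_bounded[OF rho_integrable _ B]) measurable
    have isum: "integrable lborel (\<lambda>x. 1 / real N * (\<Sum>j<N. k x (X j) * \<rho> x))"
      by (intro integrable_mult_right Bochner_Integration.integrable_sum ij)
    have idbl: "integrable lborel (\<lambda>x. c * ((LBINT y. k x y * \<rho> y) * \<rho> x))"
      by (intro integrable_mult_right integrable_mult_bounded[OF rho_integrable _ admissible_single[OF a]]) measurable
    have "(LBINT x. \<Phi> x * \<rho> x) = (LBINT x. 1 / real N * (\<Sum>j<N. k x (X j) * \<rho> x) + c * ((LBINT y. k x y * \<rho> y) * \<rho> x))"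
      unfolding \<Phi>_def distrib_right sum_distrib_right[symmetric] by (simp only: mult.assoc)
    also have "\<dots> = 1 / real N * (\<Sum>j<N. \<integral>x. k x (X j) * \<rho> x \<partial>lborel) + c * (LBINT x. (LBINT y. k x y * \<rho> y) * \<rho> x)"
      unfolding Bochner_Integration.integral_add[OF isum idbl] integral_mult_right_zero
      by (subst Bochner_Integration.integral_sum[OF ij]) (rule refl)
    finally show ?thesis unfolding admissible_double(2)[OF a] .
  qed
  ultimately show ?thesis
    unfolding \<Phi> by (simp add: distrib_left power2_eq_square)
qed

lemma sum_split_diagonal: "(\<Sum>i<N. \<Sum>j<N. k (X i) (X j)) = (\<Sum>i<N. \<Sum>j\<in>{..<N} - {i}. k (X i) (X j)) + (\<Sum>i<N. k (X i) (X i) :: real)"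
  unfolding sum.distrib[symmetric] by (intro sum.cong refl) (simp add: sum.remove[of "{..<N}"] add.commute)

text \<open>The difference is the self-interaction of the particles, which becomes a term of order
  1/N in the error. Symmetry merges the two cross terms.\<close>

lemma pairing_eq_offdiag_square:
  assumes k: "(\<lambda>(x, y). k x y) \<in> borel_measurable (borel \<Otimes>\<^sub>M borel)" and B: "\<And>x y. \<bar>k x y\<bar> \<le> B"
    and sym: "\<And>x y. k x y = k y x"
  shows "pairing k = offdiag_square k N X \<rho> + 1 / (real N)\<^sup>2 * (\<Sum>i<N. k (X i) (X i))"
proof -
  have "(\<Sum>j<N. \<integral>x. k x (X j) * \<rho> x \<partial>lborel) = (\<Sum>i<N. \<integral>y. k (X i) y * \<rho> y \<partial>lborel)"
    by (intro sum.cong refl Bochner_Integration.integral_cong) (metis sym)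
  then show ?thesis
    unfolding pairing_def inner_pairing[OF k B] offdiag_square_def sum_split_diagonal distrib_left by simp
qed

lemma total_variation_pairing_le:
  assumes k: "(\<lambda>(x, y). k x y) \<in> borel_measurable (borel \<Otimes>\<^sub>M borel)" and B: "\<And>x y. \<bar>k x y\<bar> \<le> B"
    and sym: "\<And>x y. k x y = k y x" and a: "admissible k c"
  shows "total_variation_pairing k \<le> pair_average k + 1 / (real N)\<^sup>2 * (\<Sum>i<N. k (X i) (X i)) + 3 * c"
proof -
  have w: "\<bar>weight (- 1) p\<bar> = weight 1 p" for p by (simp add: weight_def)
  have "(\<Sum>j<N. \<integral>x. k x (X j) * \<rho> x \<partial>lborel) = (\<Sum>i<N. \<integral>y. k (X i) y * \<rho> y \<partial>lborel)"
    by (intro sum.cong refl Bochner_Integration.integral_cong) (metis sym)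
  then have "total_variation_pairing k = pair_average k + 1 / (real N)\<^sup>2 * (\<Sum>i<N. k (X i) (X i))
      + 2 / real N * (\<Sum>i<N. \<integral>y. k (X i) y * \<rho> y \<partial>lborel)
      + integral\<^sup>L (lborel \<Otimes>\<^sub>M lborel) (\<lambda>(x, y). k x y * \<rho> x * \<rho> y)"
    unfolding total_variation_pairing_def w inner_pairing[OF k B] pair_average_def sum_split_diagonal distrib_left by simp
  then show ?thesis
    using single_average_le[OF a] admissible_double(3)[OF a] by linarith
qed

end

section \<open>Energy and commutator of a configuration\<close>

lemma (in charge) pairing_sum:
  assumes fin: "finite I"
    and k: "\<And>i. i \<in> I \<Longrightarrow> (\<lambda>(x, y). k i x y) \<in> borel_measurable (borel \<Otimes>\<^sub>M borel)"
    and B: "\<And>i x y. i \<in> I \<Longrightarrow> \<bar>k i x y\<bar> \<le> B i"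
  shows "pairing (\<lambda>x y. \<Sum>i\<in>I. k i x y) = (\<Sum>i\<in>I. pairing (k i))"
proof -
  have m: "(\<lambda>(x, y). \<Sum>i\<in>I. k i x y) \<in> borel_measurable (borel \<Otimes>\<^sub>M borel)"
    using borel_measurable_sum[of I "\<lambda>i (x, y). k i x y"] k by (simp add: case_prod_beta')
  have b: "\<bar>\<Sum>i\<in>I. k i x y\<bar> \<le> (\<Sum>i\<in>I. B i)" for x y
    by (intro order_trans[OF sum_abs] sum_mono B)
  have "pairing (\<lambda>x y. \<Sum>i\<in>I. k i x y) =
     (\<integral>p. (\<Sum>i\<in>I. k i (pos (fst p)) (pos (snd p)) * w (snd p) * w (fst p)) \<partial>(M \<Otimes>\<^sub>M M))"
    unfolding pairing_eq_product(1)[OF m b] sum_distrib_right by (rule refl)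
  also have "\<dots> = (\<Sum>i\<in>I. pairing (k i))"
    by (subst Bochner_Integration.integral_sum)
      (auto intro!: sum.cong pairing_eq_product(2)[OF k B] pairing_eq_product(1)[OF k B, symmetric])
  finally show ?thesis .
qed

context configuration
begin

context
  fixes \<kappa> :: real
  assumes \<kappa>: "0 < \<kappa>"
begin

lemma measurable_near_kernel [measurable]:
  "(\<lambda>(x, y). near \<kappa> T (x - y :: 'a)) \<in> borel_measurable (borel \<Otimes>\<^sub>M borel)"
proof -
  note [measurable] = measurable_near[OF \<kappa>, where ?'a='a]
  show ?thesis by measurable
qed

lemma measurable_far_kernel [measurable]:
  assumes T: "0 < T"
  shows "(\<lambda>(x, y). far \<kappa> T (x - y :: 'a)) \<in> borel_measurable (borel \<Otimes>\<^sub>M borel)"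
proof -
  note [measurable] = measurable_far[OF \<kappa> T, where ?'a='a]
  show ?thesis by measurable
qed

lemma admissible_near: "0 < T \<Longrightarrow> admissible (\<lambda>x y. near \<kappa> T (x - y)) (\<Lambda> * T)"
  by (rule admissible_convolution[OF measurable_near_kernel integrable_near[OF \<kappa>]]) auto

lemma far_kernel_bounded:
  assumes T: "0 < T"
  obtains B where "\<And>x y :: 'a. \<bar>far \<kappa> T (x - y)\<bar> \<le> B"
proof -
  obtain B where "\<And>z :: 'a. \<bar>far \<kappa> T z\<bar> \<le> B" by (rule far_bounded[OF \<kappa> T]) blast
  then show thesis by (intro that[of B]) blast
qed

lemma modulated_energy_split:
  assumes T: "0 < T"
  shows "modulated_energy \<kappa> N X \<rho> =
    offdiag_square (\<lambda>x y. near \<kappa> T (x - y)) N X \<rho> + offdiag_square (\<lambda>x y. far \<kappa> T (x - y)) N X \<rho>"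
proof -
  obtain B where B: "\<And>x y :: 'a. \<bar>far \<kappa> T (x - y)\<bar> \<le> B" by (rule far_kernel_bounded[OF T]) blast
  note [measurable] = measurable_near[OF \<kappa>, where ?'a='a] measurable_far[OF \<kappa> T, where ?'a='a]
  have y: "yukawa \<kappa> = (\<lambda>z :: 'a. if z = 0 then 0 else near \<kappa> T z + far \<kappa> T z)"
    by (rule ext) (auto simp: yukawa_zero near_add_far(1)[OF \<kappa> T])
  have "modulated_energy \<kappa> N X \<rho> = offdiag_square (\<lambda>x y. near \<kappa> T (x - y) + far \<kappa> T (x - y)) N X \<rho>"
    unfolding modulated_energy_def
  proof (rule offdiag_square_cong)
    show "(\<lambda>(x, y). yukawa \<kappa> (x - y :: 'a)) \<in> borel_measurable (borel \<Otimes>\<^sub>M borel)"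
      unfolding y by measurable
  qed (measurable, simp add: near_add_far(1)[OF \<kappa> T])
  also have "\<dots> = offdiag_square (\<lambda>x y. near \<kappa> T (x - y)) N X \<rho> + offdiag_square (\<lambda>x y. far \<kappa> T (x - y)) N X \<rho>"
    by (rule offdiag_square_add[OF admissible_near[OF T] admissible_bounded[OF measurable_far_kernel[OF T] B]])
  finally show ?thesis .
qed

text \<open>The far part becomes a full pairing once the self-interaction is added. The near part is
  nonnegative as a kernel, and its cross term costs 2 \<Lambda> T because its mass is at most
  T.\<close>

lemma modulated_energy_lower:
  assumes T: "0 < T"
  shows "pairing (\<lambda>x y. far \<kappa> T (x - y)) + pair_average (\<lambda>x y. near \<kappa> T (x - y)) \<le>
    modulated_energy \<kappa> N X \<rho> + far \<kappa> T (0::'a) / real N + 2 * \<Lambda> * T"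
proof -
  obtain B where B: "\<And>x y :: 'a. \<bar>far \<kappa> T (x - y)\<bar> \<le> B" by (rule far_kernel_bounded[OF T]) blast
  have sym: "far \<kappa> T (x - y) = far \<kappa> T (y - x)" for x y :: 'a
    by (metis far_minus minus_diff_eq)
  have "pairing (\<lambda>x y. far \<kappa> T (x - y)) = offdiag_square (\<lambda>x y. far \<kappa> T (x - y)) N X \<rho> +
     1 / (real N)\<^sup>2 * (\<Sum>i<N. far \<kappa> T (X i - X i))"
    by (rule pairing_eq_offdiag_square[OF measurable_far_kernel[OF T] B sym])
  moreover have "1 / (real N)\<^sup>2 * (\<Sum>i<N. far \<kappa> T (X i - X i)) = far \<kappa> T (0::'a) / real N"
    using N by (simp add: power2_eq_square)
  moreover have "pair_average (\<lambda>x y. near \<kappa> T (x - y)) - 2 * (\<Lambda> * T) \<le> offdiag_square (\<lambda>x y. near \<kappa> T (x - y)) N X \<rho>"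
    by (rule offdiag_square_lower[OF admissible_near[OF T]]) simp
  ultimately show ?thesis unfolding modulated_energy_split[OF T] by linarith
qed

lemma pairing_far_nonneg:
  assumes T: "0 < T"
  shows "0 \<le> pairing (\<lambda>x y. far \<kappa> T (x - y))"
proof -
  \<comment> \<open>\<open>pairing_far\<close> speaks of truncation at twice the time s, hence s = T
    / 2.\<close>
  interpret sc: screened_charge charges position "weight (- 1)" 1 \<kappa> "T / 2"
    using \<kappa> T by unfold_locales auto
  show ?thesis using sc.pairing_far sc.energy_nonneg by simp
qed

lemma pair_average_nonneg:
  assumes "\<And>x y. 0 \<le> k x y"
  shows "0 \<le> pair_average k"
  unfolding pair_average_def using assms by (intro mult_nonneg_nonneg sum_nonneg) auto

text \<open>Off the diagonal the heat kernel at 2T is dominated by the near kernel up to 4T through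
  \<open>heat_le_near\<close>. The diagonal gives the 1/N term, and the background the term in
  \<Lambda> T.\<close>

lemma total_variation_heat_le:
  assumes T: "0 < T"
  shows "2 * T * total_variation_pairing (\<lambda>x y. heat (2 * T) (x - y)) \<le>
    2 powr (real DIM('a) / 2) * exp (4 * \<kappa>\<^sup>2 * T) * pair_average (\<lambda>x y. near \<kappa> (4 * T) (x - y))
    + 2 * T * heat (2 * T) (0::'a) / real N + 6 * \<Lambda> * T"
proof -
  let ?k = "\<lambda>x y :: 'a. heat (2 * T) (x - y)"
  have T2: "0 < 2 * T" using T by simp
  have km: "(\<lambda>(x, y). ?k x y) \<in> borel_measurable (borel \<Otimes>\<^sub>M borel)" by measurable
  have B: "\<bar>?k x y\<bar> \<le> heat (2 * T) (0::'a)" for x y using heat_le_zero[OF T2, of "x - y"] by simp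
  have a: "admissible ?k (\<Lambda> * 1)"
    by (rule admissible_convolution[OF km integrable_heat[OF T2]]) (simp_all add: integral_heat[OF T2])
  have "total_variation_pairing ?k \<le> pair_average ?k + 1 / (real N)\<^sup>2 * (\<Sum>i<N. ?k (X i) (X i)) + 3 * (\<Lambda> * 1)"
    by (rule total_variation_pairing_le[OF km B heat_commute a])
  also have "1 / (real N)\<^sup>2 * (\<Sum>i<N. ?k (X i) (X i)) = heat (2 * T) (0::'a) / real N"
    using N by (simp add: power2_eq_square)
  finally have "2 * T * total_variation_pairing ?k \<le> 2 * T * (pair_average ?k + heat (2 * T) (0::'a) / real N + 3 * (\<Lambda> * 1))"
    using T by (intro mult_left_mono) auto
  also have "\<dots> = pair_average (\<lambda>x y. 2 * T * ?k x y) + 2 * T * heat (2 * T) (0::'a) / real N + 6 * \<Lambda> * T"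
    unfolding pair_average_cmult by (simp add: algebra_simps)
  finally have 1: "2 * T * total_variation_pairing ?k \<le> pair_average (\<lambda>x y. 2 * T * ?k x y) + 2 * T * heat (2 * T) (0::'a) / real N + 6 * \<Lambda> * T" .
  have "pair_average (\<lambda>x y. 2 * T * ?k x y) \<le>
     pair_average (\<lambda>x y. 2 powr (real DIM('a) / 2) * exp (4 * \<kappa>\<^sup>2 * T) * near \<kappa> (4 * T) (x - y))"
  proof (rule pair_average_mono)
    fix x y :: 'a assume "x \<noteq> y"
    then show "2 * T * ?k x y \<le> 2 powr (real DIM('a) / 2) * exp (4 * \<kappa>\<^sup>2 * T) * near \<kappa> (4 * T) (x - y)"
      using heat_le_near[OF \<kappa> _ T2, of "x - y"] by (simp add: mult_ac)
  qed
  then show ?thesis using 1 unfolding pair_average_cmult by linarith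
qed

section \<open>The commutator of a Lipschitz field: near and far parts\<close>

context
  fixes u :: "'a \<Rightarrow> 'a" and L :: real
  assumes u: "\<And>x y. norm (u x - u y) \<le> L * norm (x - y)"
begin

lemma L_nonneg: "0 \<le> L"
proof -
  obtain b :: 'a where b: "b \<in> Basis" using nonempty_Basis by blast
  show ?thesis using u[of b 0] b by (simp add: order_trans[OF norm_ge_zero])
qed

lemma component_lipschitz: "e \<in> Basis \<Longrightarrow> \<bar>u x \<bullet> e - u y \<bullet> e\<bar> \<le> L * norm (x - y)"
  using Basis_le_norm[of e "u x - u y"] u[of x y] by (simp add: inner_diff_left)

lemma u_measurable [measurable]: "u \<in> borel_measurable borel"
proof -
  have "L-lipschitz_on UNIV u"
    using u L_nonneg by (intro lipschitz_onI) (auto simp: dist_norm)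
  then show ?thesis by (intro borel_measurable_continuous_onI lipschitz_on_continuous_on)
qed

definition near_commutator :: "real \<Rightarrow> 'a \<Rightarrow> 'a \<Rightarrow> real" where
  "near_commutator T x y = near1 \<kappa> T (x - y) * ((u x - u y) \<bullet> (x - y))"

definition far_commutator_kernel :: "real \<Rightarrow> 'a \<Rightarrow> 'a \<Rightarrow> 'a \<Rightarrow> real" where
  "far_commutator_kernel T e x y = (u x \<bullet> e - u y \<bullet> e) * far1 \<kappa> T e (x - y)"

text \<open>On the diagonal every term contains the vanishing factor u x - u y, so the value of
  \<open>gradient\<close> at the origin is harmless.\<close>

lemma commutator_kernel_split:
  assumes T: "0 < T"
  shows "(u x - u y) \<bullet> gradient (yukawa \<kappa>) (x - y) = near_commutator T x y + (\<Sum>e\<in>Basis. far_commutator_kernel T e x y)"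
proof (cases "x = y")
  case False
  then have z: "x - y \<noteq> 0" by simp
  have "(u x - u y) \<bullet> gradient (yukawa \<kappa>) (x - y) =
     (\<Sum>e\<in>Basis. ((u x - u y) \<bullet> e) * (near1 \<kappa> T (x - y) * ((x - y) \<bullet> e) + far1 \<kappa> T e (x - y)))"
    by (subst euclidean_inner) (simp add: near_add_far(2)[OF \<kappa> T z])
  also have "\<dots> = near1 \<kappa> T (x - y) * (\<Sum>e\<in>Basis. ((u x - u y) \<bullet> e) * ((x - y) \<bullet> e)) + (\<Sum>e\<in>Basis. far_commutator_kernel T e x y)"
    unfolding far_commutator_kernel_def inner_diff_left[of "u x" "u y", symmetric]
    by (simp add: distrib_left sum.distrib sum_distrib_left mult_ac)
  also have "(\<Sum>e\<in>Basis. ((u x - u y) \<bullet> e) * ((x - y) \<bullet> e)) = (u x - u y) \<bullet> (x - y)"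
    by (rule euclidean_inner[symmetric])
  finally show ?thesis by (simp add: near_commutator_def)
qed (simp add: near_commutator_def far_commutator_kernel_def)

lemma near_commutator_le:
  assumes T: "0 < T"
  shows "\<bar>near_commutator T x y\<bar> \<le> L * (2 powr (real DIM('a) / 2) * exp (\<kappa>\<^sup>2 * T)) * near \<kappa> (2 * T) (x - y)"
proof (cases "x = y")
  case True
  then show ?thesis using L_nonneg by (simp add: near_commutator_def)
next
  case False
  then have z: "x - y \<noteq> 0" by simp
  have "\<bar>(u x - u y) \<bullet> (x - y)\<bar> \<le> (L * norm (x - y)) * norm (x - y)"
    by (intro order_trans[OF Cauchy_Schwarz_ineq2] mult_right_mono u) simp
  then have "\<bar>near_commutator T x y\<bar> \<le> \<bar>near1 \<kappa> T (x - y)\<bar> * ((L * norm (x - y)) * norm (x - y))"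
    unfolding near_commutator_def abs_mult by (intro mult_left_mono) auto
  also have "\<dots> = L * ((norm (x - y))\<^sup>2 * \<bar>near1 \<kappa> T (x - y)\<bar>)"
    by (simp add: power2_eq_square mult_ac)
  also have "\<dots> \<le> L * (2 powr (real DIM('a) / 2) * exp (\<kappa>\<^sup>2 * T) * near \<kappa> (2 * T) (x - y))"
    by (intro mult_left_mono near1_le_near \<kappa> z T L_nonneg)
  finally show ?thesis by (simp add: mult.assoc)
qed

lemma admissible_near_commutator:
  assumes T: "0 < T"
  shows "admissible (near_commutator T) (\<Lambda> * (L * (2 powr (real DIM('a) / 2) * exp (\<kappa>\<^sup>2 * T)) * (2 * T)))"
proof (rule admissible_convolution[where K="\<lambda>z. L * (2 powr (real DIM('a) / 2) * exp (\<kappa>\<^sup>2 * T)) * near \<kappa> (2 * T) z"])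
  note [measurable] = measurable_near1[OF \<kappa>, where ?'a='a]
  show "(\<lambda>(x, y). near_commutator T x y) \<in> borel_measurable (borel \<Otimes>\<^sub>M borel)"
    unfolding near_commutator_def by measurable
  have T2: "0 < 2 * T" using T by simp
  show "integrable lborel (\<lambda>z::'a. L * (2 powr (real DIM('a) / 2) * exp (\<kappa>\<^sup>2 * T)) * near \<kappa> (2 * T) z)"
    by (intro integrable_mult_right integrable_near \<kappa> T2)
  show "(LBINT z. L * (2 powr (real DIM('a) / 2) * exp (\<kappa>\<^sup>2 * T)) * near \<kappa> (2 * T) (z::'a))
    \<le> L * (2 powr (real DIM('a) / 2) * exp (\<kappa>\<^sup>2 * T)) * (2 * T)"
    unfolding integral_mult_right_zero using L_nonneg by (intro mult_left_mono integrable_near \<kappa> T2) auto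
qed (use near_commutator_le[OF T] in auto)

text \<open>The natural bound involves near pairs up to 2T. It is weakened to 4T so that the same
  pair average also serves the remainder of the far part.\<close>

lemma near_commutator_bound:
  assumes T: "0 < T"
  shows "\<bar>offdiag_square (near_commutator T) N X \<rho>\<bar> \<le>
    L * (2 powr (real DIM('a) / 2) * exp (\<kappa>\<^sup>2 * T)) * (pair_average (\<lambda>x y. near \<kappa> (4 * T) (x - y)) + 6 * \<Lambda> * T)"
proof -
  let ?c = "L * (2 powr (real DIM('a) / 2) * exp (\<kappa>\<^sup>2 * T))"
  have c: "0 \<le> ?c" using L_nonneg by simp
  have "pair_average (\<lambda>x y. \<bar>near_commutator T x y\<bar>) \<le> pair_average (\<lambda>x y. ?c * near \<kappa> (4 * T) (x - y))"
  proof (rule pair_average_mono)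
    fix x y :: 'a assume "x \<noteq> y"
    then show "\<bar>near_commutator T x y\<bar> \<le> ?c * near \<kappa> (4 * T) (x - y)"
      using T by (intro order_trans[OF near_commutator_le[OF T]] mult_left_mono near_mono \<kappa> c) auto
  qed
  then have "\<bar>offdiag_square (near_commutator T) N X \<rho>\<bar> \<le>
      ?c * pair_average (\<lambda>x y. near \<kappa> (4 * T) (x - y)) + 3 * (\<Lambda> * (?c * (2 * T)))"
    using abs_offdiag_square_le[OF admissible_near_commutator[OF T]] unfolding pair_average_cmult by linarith
  also have "\<dots> = ?c * (pair_average (\<lambda>x y. near \<kappa> (4 * T) (x - y)) + 6 * \<Lambda> * T)"
    by (simp only: distrib_left) (simp add: mult_ac)
  finally show ?thesis .
qed

lemma far_commutator_kernel_facts: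
  assumes T: "0 < T" and e: "e \<in> Basis"
  shows "(\<lambda>(x, y). far_commutator_kernel T e x y) \<in> borel_measurable (borel \<Otimes>\<^sub>M borel)"
    and "\<exists>B. \<forall>x y. \<bar>far_commutator_kernel T e x y\<bar> \<le> B"
    and "far_commutator_kernel T e x y = far_commutator_kernel T e y x"
proof -
  have e1: "norm e = 1" using e by simp
  note [measurable] = measurable_far1[OF \<kappa> T, where ?'a='a]
  show "(\<lambda>(x, y). far_commutator_kernel T e x y) \<in> borel_measurable (borel \<Otimes>\<^sub>M borel)"
    unfolding far_commutator_kernel_def by measurable
  obtain B where B: "\<And>z::'a. norm z * \<bar>far1 \<kappa> T e z\<bar> \<le> B" by (rule norm_mult_far1_bounded[OF \<kappa> T e1]) blast
  have "\<bar>far_commutator_kernel T e x y\<bar> \<le> L * B" for x y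
  proof -
    have "\<bar>far_commutator_kernel T e x y\<bar> \<le> L * norm (x - y) * \<bar>far1 \<kappa> T e (x - y)\<bar>"
      unfolding far_commutator_kernel_def abs_mult by (intro mult_right_mono component_lipschitz e) simp
    also have "\<dots> \<le> L * B" unfolding mult.assoc by (intro mult_left_mono B L_nonneg)
    finally show ?thesis .
  qed
  then show "\<exists>B. \<forall>x y. \<bar>far_commutator_kernel T e x y\<bar> \<le> B" by blast
  have "far1 \<kappa> T e (x - y) = - far1 \<kappa> T e (y - x)" by (metis far1_minus minus_diff_eq)
  then show "far_commutator_kernel T e x y = far_commutator_kernel T e y x"
    by (simp add: far_commutator_kernel_def algebra_simps)
qed

lemma far_commutator_bound:
  assumes T: "0 < T"
  shows "\<bar>offdiag_square (\<lambda>x y. \<Sum>e\<in>Basis. far_commutator_kernel T e x y) N X \<rho>\<bar> \<le>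
    real DIM('a) * (L * ((real DIM('a) + 3) * pairing (\<lambda>x y. far \<kappa> T (x - y)) +
      2 ^ DIM('a) * (2 * T * total_variation_pairing (\<lambda>x y. heat (2 * T) (x - y)))))"
    and "\<exists>c. admissible (\<lambda>x y. \<Sum>e\<in>Basis. far_commutator_kernel T e x y) c"
proof -
  interpret sc: screened_charge charges position "weight (- 1)" 1 \<kappa> "T / 2"
    using \<kappa> T by unfold_locales auto
  let ?k = "\<lambda>x y. \<Sum>e\<in>Basis. far_commutator_kernel T e x y"
  note km = far_commutator_kernel_facts(1)[OF T]
  note sym = far_commutator_kernel_facts(3)[OF T]
  obtain B where B: "\<And>e x y. e \<in> Basis \<Longrightarrow> \<bar>far_commutator_kernel T e x y\<bar> \<le> B e"
    using far_commutator_kernel_facts(2)[OF T] by metis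
  have m: "(\<lambda>(x, y). ?k x y) \<in> borel_measurable (borel \<Otimes>\<^sub>M borel)"
    using borel_measurable_sum[of Basis "\<lambda>e (x, y). far_commutator_kernel T e x y"] km by (simp add: case_prod_beta')
  have b: "\<bar>?k x y\<bar> \<le> (\<Sum>e\<in>Basis. B e)" for x y
    by (intro order_trans[OF sum_abs] sum_mono B)
  show "\<exists>c. admissible ?k c" using admissible_bounded[OF m b] by blast
  have "pairing ?k = offdiag_square ?k N X \<rho> + 1 / (real N)\<^sup>2 * (\<Sum>i<N. ?k (X i) (X i))"
    by (rule pairing_eq_offdiag_square[OF m b]) (intro sum.cong refl sym)
  \<comment> \<open>The commutator kernel vanishes on the diagonal, so including the diagonal
    changes nothing.\<close>
  then have "offdiag_square ?k N X \<rho> = pairing ?k"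
    by (simp add: far_commutator_kernel_def)
  also have "\<dots> = (\<Sum>e\<in>Basis. pairing (far_commutator_kernel T e))"
    by (rule pairing_sum[OF finite_Basis km B])
  finally have eq: "offdiag_square ?k N X \<rho> = (\<Sum>e\<in>Basis. pairing (far_commutator_kernel T e))" .
  have one: "\<bar>pairing (far_commutator_kernel T e)\<bar> \<le> L * ((real DIM('a) + 3) * pairing (\<lambda>x y. far \<kappa> T (x - y)) +
      2 ^ DIM('a) * (2 * T * total_variation_pairing (\<lambda>x y. heat (2 * T) (x - y))))" if e: "e \<in> Basis" for e
  proof -
    have "\<bar>pairing (\<lambda>x y. (u x \<bullet> e - u y \<bullet> e) * far1 \<kappa> (2 * (T / 2)) e (x - y))\<bar> \<le>
       L * ((real DIM('a) + 3) * sc.energy + 4 * 2 ^ DIM('a) * (T / 2) * total_variation_pairing (\<lambda>x y. heat (4 * (T / 2)) (x - y)))"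
      by (rule sc.far_commutator[OF e component_lipschitz[OF e]])
    then show ?thesis
      unfolding sc.pairing_far[symmetric] far_commutator_kernel_def[abs_def] by (simp add: mult.assoc mult.left_commute)
  qed
  show "\<bar>offdiag_square ?k N X \<rho>\<bar> \<le> real DIM('a) * (L * ((real DIM('a) + 3) * pairing (\<lambda>x y. far \<kappa> T (x - y)) +
      2 ^ DIM('a) * (2 * T * total_variation_pairing (\<lambda>x y. heat (2 * T) (x - y)))))"
    unfolding eq using sum_mono[of Basis, OF one] by (intro order_trans[OF sum_abs]) simp
qed

text \<open>The number exp 4 in D bounds exp (4 \<kappa>^2 T), the larger of the two exponential
  losses, by the assumption on \<kappa>^2 T.\<close>

lemma commutator_bound:
  assumes T: "0 < T" and \<kappa>T: "\<kappa>\<^sup>2 * T \<le> 1"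
  defines "D \<equiv> 2 powr (real DIM('a) / 2) * exp 4" and "d \<equiv> real DIM('a)" and "p \<equiv> 2 ^ DIM('a) :: real"
  shows "\<bar>commutator \<kappa> N X \<rho> u\<bar> \<le> L * ((6 * D + d * (d + 3) + d * p * (D + 6)) *
    (pairing (\<lambda>x y. far \<kappa> T (x - y)) + pair_average (\<lambda>x y. near \<kappa> (4 * T) (x - y))
      + T * heat (2 * T) (0::'a) / real N + \<Lambda> * T))"
proof -
  let ?D = "2 powr (real DIM('a) / 2)"
  define P where "P = pairing (\<lambda>x y. far \<kappa> T (x - y))"
  define R where "R = pair_average (\<lambda>x y. near \<kappa> (4 * T) (x - y))"
  define H where "H = T * heat (2 * T) (0::'a) / real N"
  define V where "V = 2 * T * total_variation_pairing (\<lambda>x y. heat (2 * T) (x - y))"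
  have P: "0 \<le> P" unfolding P_def by (rule pairing_far_nonneg[OF T])
  have R: "0 \<le> R" unfolding R_def by (rule pair_average_nonneg) simp
  have H: "0 \<le> H" unfolding H_def using T by simp
  have LT: "0 \<le> \<Lambda> * T" using Lambda T by simp
  have D: "0 \<le> D" by (simp add: D_def)
  have d: "0 \<le> d" by (simp add: d_def)
  have p: "0 \<le> p" by (simp add: p_def)
  have D1: "?D * exp (\<kappa>\<^sup>2 * T) \<le> D" unfolding D_def using \<kappa>T by (intro mult_left_mono) auto
  have "4 * \<kappa>\<^sup>2 * T \<le> 4" using \<kappa>T by simp
  then have D4: "?D * exp (4 * \<kappa>\<^sup>2 * T) \<le> D" unfolding D_def by (intro mult_left_mono) auto
  have V: "V \<le> D * R + 2 * H + 6 * (\<Lambda> * T)"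
  proof -
    have "?D * exp (4 * \<kappa>\<^sup>2 * T) * R \<le> D * R" by (rule mult_right_mono[OF D4 R])
    then show ?thesis
      using total_variation_heat_le[OF T] unfolding V_def R_def H_def by simp
  qed
  obtain c where ac: "admissible (\<lambda>x y. \<Sum>e\<in>Basis. far_commutator_kernel T e x y) c"
    using far_commutator_bound(2)[OF T] by blast
  have "commutator \<kappa> N X \<rho> u = offdiag_square (near_commutator T) N X \<rho> +
      offdiag_square (\<lambda>x y. \<Sum>e\<in>Basis. far_commutator_kernel T e x y) N X \<rho>"
    unfolding commutator_def commutator_kernel_split[OF T]
    by (rule offdiag_square_add[OF admissible_near_commutator[OF T] ac])
  then have "\<bar>commutator \<kappa> N X \<rho> u\<bar> \<le> L * (?D * exp (\<kappa>\<^sup>2 * T)) * (R + 6 * \<Lambda> * T) + d * (L * ((d + 3) * P + p * V))"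
    using near_commutator_bound[OF T] far_commutator_bound(1)[OF T] unfolding R_def P_def V_def d_def p_def by linarith
  also have "\<dots> = L * (?D * exp (\<kappa>\<^sup>2 * T) * (R + 6 * \<Lambda> * T) + d * ((d + 3) * P + p * V))"
    by (simp add: algebra_simps)
  also have "\<dots> \<le> L * (D * (R + 6 * \<Lambda> * T) + d * ((d + 3) * P + p * (D * R + 2 * H + 6 * (\<Lambda> * T))))"
    using R LT d p by (intro mult_left_mono[OF _ L_nonneg] add_mono mult_right_mono[OF D1] mult_left_mono V order_refl) auto
  also have "\<dots> \<le> L * ((6 * D + d * (d + 3) + d * p * (D + 6)) * (P + R + H + \<Lambda> * T))"
  proof (rule mult_left_mono[OF _ L_nonneg])
    \<comment> \<open>The sum of three parts is chosen to dominate all four coefficients at once: D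
      + d p D for R, d (d + 3) for P, 2 d p for H, and 6 D + 6 d p for \<Lambda> T.\<close>
    let ?K = "6 * D + d * (d + 3) + d * p * (D + 6)"
    have nn: "0 \<le> d * (d + 3)" "0 \<le> d * p * D" "0 \<le> d * p" using D d p by auto
    have K: "?K = 6 * D + d * (d + 3) + d * p * D + 6 * (d * p)" by (simp add: algebra_simps)
    have "(D + d * p * D) * R \<le> ?K * R" "(d * (d + 3)) * P \<le> ?K * P"
      "(2 * (d * p)) * H \<le> ?K * H" "(6 * D + 6 * (d * p)) * (\<Lambda> * T) \<le> ?K * (\<Lambda> * T)"
      using nn D R P H LT unfolding K by (intro mult_right_mono; linarith)+
    then have "(D + d * p * D) * R + (d * (d + 3)) * P + (2 * (d * p)) * H + (6 * D + 6 * (d * p)) * (\<Lambda> * T)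
        \<le> ?K * R + ?K * P + ?K * H + ?K * (\<Lambda> * T)" by linarith
    then show "D * (R + 6 * \<Lambda> * T) + d * ((d + 3) * P + p * (D * R + 2 * H + 6 * (\<Lambda> * T)))
       \<le> ?K * (P + R + H + \<Lambda> * T)"
      by (simp only: distrib_left distrib_right mult_ac)
  qed
  finally show ?thesis unfolding P_def R_def H_def .
qed

end

end

end

section \<open>Error terms, seminorms and the final estimate\<close>

lemma ell_nonneg: "0 \<le> ell d \<eta>"
  by (simp add: ell_def)

lemma heat_zero_le_ell:
  assumes \<eta>: "0 < \<eta>" and d: "2 \<le> DIM('a::euclidean_space)"
  shows "\<eta>\<^sup>2 * heat (2 * \<eta>\<^sup>2) (0::'a) \<le> ell DIM('a) \<eta>"
proof -
  let ?a = "- (real DIM('a) / 2)"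
  have T: "\<eta>\<^sup>2 = \<eta> powr 2" using \<eta> by (simp add: powr_numeral)
  have pos: "0 < \<eta>\<^sup>2" using \<eta> by simp
  have "1 * \<eta>\<^sup>2 \<le> (4 * pi * 2) * \<eta>\<^sup>2"
    using pi_ge_two by (intro mult_right_mono) auto
  then have "heat (2 * \<eta>\<^sup>2) (0::'a) \<le> (\<eta>\<^sup>2) powr ?a"
    unfolding heat_zero using pos by (intro powr_mono2') (auto simp: mult_ac)
  then have "\<eta>\<^sup>2 * heat (2 * \<eta>\<^sup>2) (0::'a) \<le> \<eta>\<^sup>2 * (\<eta>\<^sup>2) powr ?a"
    by (intro mult_left_mono) auto
  also have "\<dots> = \<eta> powr (2 - real DIM('a))"
    unfolding T powr_powr powr_add[symmetric] by simp
  also have "\<dots> \<le> ell DIM('a) \<eta>"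
    using \<eta> by (cases "DIM('a) = 2") (auto simp: ell_def)
  finally show ?thesis .
qed

lemma lip_seminorm_bound:
  fixes u :: "'a::euclidean_space \<Rightarrow> 'a"
  assumes "L-lipschitz_on UNIV u"
  shows "norm (u x - u y) \<le> lip_seminorm u * norm (x - y)"
proof (cases "x = y")
  case False
  have "bdd_above ((\<lambda>(x, y). dist (u x) (u y) / dist x y) ` {(x, y). x \<noteq> y})"
  proof (rule bdd_aboveI)
    fix r assume "r \<in> (\<lambda>(x, y). dist (u x) (u y) / dist x y) ` {(x, y). x \<noteq> y}"
    then obtain x y where "x \<noteq> y" "r = dist (u x) (u y) / dist x y" by auto
    then show "r \<le> L" using lipschitz_onD[OF assms, of x y] by (simp add: divide_le_eq)
  qed
  then have "dist (u x) (u y) / dist x y \<le> lip_seminorm u"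
    unfolding lip_seminorm_def using False by (intro cSUP_upper2[where x="(x, y)"]) auto
  then show ?thesis using False by (simp add: dist_norm field_simps)
qed simp

lemma Linf_norm_bound:
  assumes "Linf_norm f \<le> ereal \<Lambda>"
  shows "AE x in lborel. \<bar>f x\<bar> \<le> \<Lambda>"
  using esssup_AE[of "\<lambda>x. ereal \<bar>f x\<bar>" lborel]
proof eventually_elim
  case (elim x)
  then have "ereal \<bar>f x\<bar> \<le> ereal \<Lambda>" using assms unfolding Linf_norm_def by (rule order_trans)
  then show ?case by simp
qed

text \<open>K is the constant of \<open>commutator_bound\<close>. The factor 2 arises because the
  far energy and the near pairs are each charged to the full normalized energy.\<close>

theorem commutator_estimate:
  fixes X :: "nat \<Rightarrow> 'a::euclidean_space" and \<rho> :: "'a \<Rightarrow> real" and u :: "'a \<Rightarrow> 'a"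
  assumes dim: "2 \<le> DIM('a)" and N: "0 < N" and \<kappa>: "0 < \<kappa>" and \<eta>: "0 < \<eta>" "\<eta> \<le> 1" "\<kappa> * \<eta> \<le> 1"
    and \<Lambda>: "1 \<le> \<Lambda>" and \<rho>: "prob_density \<rho>" "Linf_norm \<rho> \<le> ereal \<Lambda>" and X: "inj_on X {..<N}"
    and u: "\<exists>L. L-lipschitz_on UNIV u"
  defines "D \<equiv> 2 powr (real DIM('a) / 2) * exp 4" and "d \<equiv> real DIM('a)" and "p \<equiv> 2 ^ DIM('a) :: real"
  defines "K \<equiv> 6 * D + d * (d + 3) + d * p * (D + 6)"
  defines "F \<equiv> normalized_energy \<kappa> N X \<rho>" and "\<epsilon> \<equiv> err DIM('a) N \<kappa> \<eta>"
  shows "\<epsilon> \<le> F + 9 * \<Lambda> * \<epsilon>" and "0 \<le> \<epsilon>"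
    and "\<bar>commutator \<kappa> N X \<rho> u\<bar> \<le> 2 * K * lip_seminorm u * (F + 9 * \<Lambda> * \<epsilon>)"
proof -
  interpret configuration N X \<rho> \<Lambda>
    using N X \<rho>(1) \<Lambda> Linf_norm_bound[OF \<rho>(2)] by unfold_locales auto
  obtain L where L: "L-lipschitz_on UNIV u" using u by blast
  note lip = lip_seminorm_bound[OF L]
  define T where "T = \<eta>\<^sup>2"
  define l where "l = ell DIM('a) \<eta> / real N"
  define P where "P = pairing (\<lambda>x y. far \<kappa> T (x - y))"
  define R where "R = pair_average (\<lambda>x y. near \<kappa> (4 * T) (x - y))"
  have T: "0 < T" "0 < 4 * T" using \<eta> by (auto simp: T_def)
  have l: "0 \<le> l" by (simp add: l_def ell_nonneg)
  have \<kappa>T: "0 \<le> \<kappa>\<^sup>2 * T" "\<kappa>\<^sup>2 * T \<le> 1"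
    using \<kappa> \<eta> by (auto simp: T_def power_le_one simp flip: power_mult_distrib)
  have \<epsilon>: "\<epsilon> = l + T + \<kappa>\<^sup>2 * T" by (simp add: \<epsilon>_def err_def l_def T_def)
  show \<epsilon>0: "0 \<le> \<epsilon>" unfolding \<epsilon> using l T \<kappa>T by linarith
  have l\<epsilon>: "l + \<Lambda> * T \<le> \<Lambda> * \<epsilon>"
  proof -
    have "l \<le> \<Lambda> * l" using \<Lambda> l by (simp add: mult_le_cancel_right1)
    moreover have "0 \<le> \<Lambda> * (\<kappa>\<^sup>2 * T)" using \<Lambda> \<kappa>T by simp
    ultimately show ?thesis unfolding \<epsilon> distrib_left by linarith
  qed
  have F: "modulated_energy \<kappa> N X \<rho> + far \<kappa> T (0::'a) / real N \<le> F + 2 * l"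
  proof -
    have "far \<kappa> T (0::'a) + c_norm \<kappa> DIM('a) \<le> 2 * ell DIM('a) \<eta>"
      unfolding T_def by (rule far_zero_add_c_norm_le[OF \<kappa> \<eta> dim])
    then have "(far \<kappa> T (0::'a) + c_norm \<kappa> DIM('a)) / real N \<le> 2 * ell DIM('a) \<eta> / real N"
      by (rule divide_right_mono) simp
    then show ?thesis unfolding F_def normalized_energy_def l_def by (simp add: add_divide_distrib)
  qed
  have P: "0 \<le> P" "0 \<le> R" unfolding P_def R_def
    by (intro pairing_far_nonneg[OF \<kappa>] pair_average_nonneg[OF \<kappa>] T near_nonneg)+
  have LT: "0 \<le> \<Lambda> * T" using \<Lambda> T by simp
  \<comment> \<open>At truncation time T the density costs only 2 \<Lambda> T. The larger 8
    \<Lambda> T is written to match \<open>RA\<close>.\<close>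
  have PA: "P \<le> F + 2 * l + 8 * (\<Lambda> * T)"
  proof -
    have "0 \<le> pair_average (\<lambda>x y. near \<kappa> T (x - y))" by (intro pair_average_nonneg[OF \<kappa>] near_nonneg)
    then show ?thesis
      using modulated_energy_lower[OF \<kappa> T(1)] F LT unfolding P_def by linarith
  qed
  \<comment> \<open>Near pairs are needed up to 4T, so the energy is bounded from below a second
    time, at 4T, with loss 8 \<Lambda> T. The self-interaction is smaller there, so \<open>F\<close>
    still applies.\<close>
  have RA: "R \<le> F + 2 * l + 8 * (\<Lambda> * T)"
  proof -
    have "far \<kappa> (4 * T) (0::'a) \<le> far \<kappa> T (0::'a)" using T by (intro far_zero_antimono[OF \<kappa> T(1)]) simp
    then have "far \<kappa> (4 * T) (0::'a) / real N \<le> far \<kappa> T (0::'a) / real N" by (rule divide_right_mono) simp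
    moreover have "0 \<le> pairing (\<lambda>x y. far \<kappa> (4 * T) (x - y))" by (rule pairing_far_nonneg[OF \<kappa> T(2)])
    ultimately show ?thesis
      using modulated_energy_lower[OF \<kappa> T(2)] F unfolding R_def by linarith
  qed
  \<comment> \<open>By \<open>l\<epsilon>\<close>, eight of the nine copies of \<Lambda> \<epsilon>
    cover 2 l + 8 \<Lambda> T, and the last one dominates \<epsilon>.\<close>
  show "\<epsilon> \<le> F + 9 * \<Lambda> * \<epsilon>"
  proof -
    have "\<epsilon> \<le> \<Lambda> * \<epsilon>" using \<Lambda> \<epsilon>0 by (simp add: mult_le_cancel_right1)
    then show ?thesis using PA P l l\<epsilon> LT by linarith
  qed
  have D: "0 \<le> D" by (simp add: D_def)
  have K: "0 \<le> K" using D unfolding K_def d_def p_def by (intro add_nonneg_nonneg mult_nonneg_nonneg) auto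
  have H: "T * heat (2 * T) (0::'a) / real N \<le> l"
    unfolding T_def l_def by (intro divide_right_mono heat_zero_le_ell \<eta> dim) simp
  have "\<bar>commutator \<kappa> N X \<rho> u\<bar> \<le> lip_seminorm u * (K * (P + R + T * heat (2 * T) (0::'a) / real N + \<Lambda> * T))"
    unfolding P_def R_def K_def D_def d_def p_def
    by (rule commutator_bound[OF \<kappa> lip T(1) \<kappa>T(2)])
  also have "\<dots> \<le> lip_seminorm u * (K * (2 * (F + 9 * \<Lambda> * \<epsilon>)))"
  proof (rule mult_left_mono[OF mult_left_mono[OF _ K] L_nonneg[OF \<kappa> lip]])
    have "9 * \<Lambda> * \<epsilon> = 9 * (\<Lambda> * \<epsilon>)" by simp
    then show "P + R + T * heat (2 * T) (0::'a) / real N + \<Lambda> * T \<le> 2 * (F + 9 * \<Lambda> * \<epsilon>)"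
      using PA RA H l l\<epsilon> LT by argo
  qed
  finally show "\<bar>commutator \<kappa> N X \<rho> u\<bar> \<le> 2 * K * lip_seminorm u * (F + 9 * \<Lambda> * \<epsilon>)"
    by (simp only: mult_ac)
qed

theorem theorem1p1:
  fixes \<kappa>\<^sub>s :: real
  assumes "CARD('d::finite) \<ge> 2" and "\<kappa>\<^sub>s > 0"
  shows "\<exists>\<eta>\<^sub>0>0. \<forall>\<Lambda>\<ge>1. \<exists>C\<ge>1. \<exists>B\<ge>1.
    \<forall>(N::nat) (\<kappa>::real) (\<eta>::real) (\<rho> :: real ^ 'd \<Rightarrow> real)
      (X :: nat \<Rightarrow> real ^ 'd) (u :: real ^ 'd \<Rightarrow> real ^ 'd).
      N \<ge> 2 \<and> 0 < \<kappa> \<and> \<kappa> \<le> \<kappa>\<^sub>s \<and> 0 < \<eta> \<and> \<eta> < \<eta>\<^sub>0 \<and>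
      prob_density \<rho> \<and> Linf_norm \<rho> \<le> ereal \<Lambda> \<and>
      inj_on X {..<N} \<and> (\<exists>L. L-lipschitz_on UNIV u)
      \<longrightarrow>
      normalized_energy \<kappa> N X \<rho> + B * err CARD('d) N \<kappa> \<eta> \<ge> err CARD('d) N \<kappa> \<eta> \<and>
      err CARD('d) N \<kappa> \<eta> \<ge> 0 \<and>
      \<bar>commutator \<kappa> N X \<rho> u\<bar>
        \<le> C * lip_seminorm u * (normalized_energy \<kappa> N X \<rho> + B * err CARD('d) N \<kappa> \<eta>)"
proof -
  have dim: "DIM(real ^ 'd) = CARD('d)" by simp
  have dim2: "2 \<le> DIM(real ^ 'd)" using assms(1) by simp
  define D where "D = 2 powr (real DIM(real ^ 'd) / 2) * exp 4"
  define K where "K = 6 * D + real DIM(real ^ 'd) * (real DIM(real ^ 'd) + 3) + real DIM(real ^ 'd) * 2 ^ DIM(real ^ 'd) * (D + 6)"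
  have D: "0 \<le> D" by (simp add: D_def)
  \<comment> \<open>This secures C \<ge> 1: the middle summand of K is d (d + 3), which is at least
    6 because d \<ge> 2.\<close>
  have sum: "1 \<le> 2 * (a + b + c)" if "0 \<le> a" "2 * 3 \<le> b" "0 \<le> c" for a b c :: real
  proof -
    have "6 \<le> a + b + c" using that by simp
    then show ?thesis by simp
  qed
  have "2 * 3 \<le> real DIM(real ^ 'd) * (real DIM(real ^ 'd) + 3)"
    using dim2 by (intro mult_mono) auto
  then have K: "1 \<le> 2 * K" unfolding K_def using D by (intro sum) auto
  have pos: "0 < 1 / (1 + \<kappa>\<^sub>s)" using assms(2) by simp
  show ?thesis
  \<comment> \<open>This threshold gives \<eta> \<le> 1 and \<kappa> \<eta> \<le> 1 together, and it
    depends on the upper bound of \<kappa> alone.\<close>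
  proof (rule exI[of _ "1 / (1 + \<kappa>\<^sub>s)"], rule conjI[OF pos], intro allI impI)
    fix \<Lambda> :: real assume \<Lambda>: "1 \<le> \<Lambda>"
    have B: "1 \<le> 9 * \<Lambda>" using \<Lambda> by simp
    show "\<exists>C\<ge>1. \<exists>B\<ge>1.
    \<forall>(N::nat) (\<kappa>::real) (\<eta>::real) (\<rho> :: real ^ 'd \<Rightarrow> real)
      (X :: nat \<Rightarrow> real ^ 'd) (u :: real ^ 'd \<Rightarrow> real ^ 'd).
      N \<ge> 2 \<and> 0 < \<kappa> \<and> \<kappa> \<le> \<kappa>\<^sub>s \<and> 0 < \<eta> \<and> \<eta> < 1 / (1 + \<kappa>\<^sub>s) \<and>
      prob_density \<rho> \<and> Linf_norm \<rho> \<le> ereal \<Lambda> \<and>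
      inj_on X {..<N} \<and> (\<exists>L. L-lipschitz_on UNIV u)
      \<longrightarrow>
      normalized_energy \<kappa> N X \<rho> + B * err CARD('d) N \<kappa> \<eta> \<ge> err CARD('d) N \<kappa> \<eta> \<and>
      err CARD('d) N \<kappa> \<eta> \<ge> 0 \<and>
      \<bar>commutator \<kappa> N X \<rho> u\<bar>
        \<le> C * lip_seminorm u * (normalized_energy \<kappa> N X \<rho> + B * err CARD('d) N \<kappa> \<eta>)"
    proof (rule exI[of _ "2 * K"], rule conjI[OF K], rule exI[of _ "9 * \<Lambda>"], rule conjI[OF B], intro allI impI, elim conjE)
      fix N :: nat and \<kappa> \<eta> :: real and \<rho> :: "real ^ 'd \<Rightarrow> real"
        and X :: "nat \<Rightarrow> real ^ 'd" and u :: "real ^ 'd \<Rightarrow> real ^ 'd"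
      assume N: "2 \<le> N" and \<kappa>: "0 < \<kappa>" "\<kappa> \<le> \<kappa>\<^sub>s" and \<eta>: "0 < \<eta>" "\<eta> < 1 / (1 + \<kappa>\<^sub>s)"
        and \<rho>: "prob_density \<rho>" "Linf_norm \<rho> \<le> ereal \<Lambda>" and X: "inj_on X {..<N}" and u: "\<exists>L. L-lipschitz_on UNIV u"
      have "\<eta> * (1 + \<kappa>\<^sub>s) < 1" using \<eta> assms(2) by (simp add: field_simps)
      then have "\<eta> + \<kappa>\<^sub>s * \<eta> < 1" by (simp add: algebra_simps)
      moreover have "\<kappa> * \<eta> \<le> \<kappa>\<^sub>s * \<eta>" "0 \<le> \<kappa> * \<eta>" using \<kappa> \<eta> by (auto intro: mult_right_mono)
      ultimately have small: "\<eta> \<le> 1" "\<kappa> * \<eta> \<le> 1" using \<eta> by linarith+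
      have N0: "0 < N" using N by simp
      from commutator_estimate[OF dim2 N0 \<kappa>(1) \<eta>(1) small \<Lambda> \<rho> X u]
      show "err CARD('d) N \<kappa> \<eta> \<le> normalized_energy \<kappa> N X \<rho> + 9 * \<Lambda> * err CARD('d) N \<kappa> \<eta> \<and>
        0 \<le> err CARD('d) N \<kappa> \<eta> \<and>
        \<bar>commutator \<kappa> N X \<rho> u\<bar> \<le> 2 * K * lip_seminorm u * (normalized_energy \<kappa> N X \<rho> + 9 * \<Lambda> * err CARD('d) N \<kappa> \<eta>)"
        unfolding K_def D_def dim by blast
    qed
  qed
qed

end
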